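(* Let $\Omega$ be a strictly convex proper open set of $\mathbb{RP}^n$ ($n\ge2$) with $C^1$ boundary. Pick $x^+\in\partial\Omega$, and choose any affine chart containing $x^+$ and a Euclidean metric on it. Then for any nonzero $v\in T\mathcal H_{x^+}$, $$\overline\eta(x^+,v)=\frac{2}{\underline\alpha(x^+,p_{x^+}(v))}-1,\qquad \underline\eta(x^+,v)=\frac{2}{\overline\alpha(x^+,p_{x^+}(v))}-1,$$ where $\underline\alpha(x^+,\cdot)$ and $\overline\alpha(x^+,\cdot)$ denote the lower and upper Lyapunov exponents of the graph of $\partial\Omega$ at $x^+$ (with the convention $2/(+\infty)=0$).
   Context: Hilbert geometry: $d_\Omega(x,y)=\frac12|\log[a,b,x,y]|$, $a,b$ being the intersection points of the line $(xy)$ with $\partial\Omega$ and $[a,b,x,y]=\frac{|ax|/|bx|}{|ay|/|by|}$. It is generated by the Finsler metric $F(x,\xi)=\frac{|\xi|}{2}\big(\frac1{|xx^+|}+\frac1{|xx^-|}\big)$, where (in a chart in which $\Omega$ is bounded, with Euclidean norm $|\cdot|$) $x^\pm$ are the intersection points of the line $x+\mathbb R\xi$ with $\partial\Omega$. Fix $x^+\in\partial\Omega$. The radial flow $\varphi^t_{x^+}:\Omega\to\Omega$ moves each $x$ at unit $F$-speed along the line $(xx^+)$ toward $x^+$; it is a $C^1$ flow. Horospheres about $x^+$ are the level sets of the Busemann functions $y\mapsto b_{x^+}(x,y)=\lim_{p\to x^+}\big(d_\Omega(x,p)-d_\Omega(y,p)\big)$; $T\mathcal H_{x^+}\subset T\Omega$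 is the bundle whose fibre at $x$ is the tangent space at $x$ to the horosphere about $x^+$ through $x$. It is invariant under $d\varphi_{x^+}^t$. Parallel transport in the direction of $x^+$: for $v\in T\mathcal H_{x^+}$, the parallel transport is $T^t_{x^+}(v)=e^{t}\,d\varphi^t_{x^+}(v)$. The upper and lower parallel Lyapunov exponents of $v\in T\mathcal H_{x^+}\smallsetminus\{0\}$ are $$\overline\eta(x^+,v)=\limsup_{t\to+\infty}\frac1t\log F(T^t_{x^+}v),\qquad \underline\eta(x^+,v)=\liminf_{t\to+\infty}\frac1t\log F(T^t_{x^+}v).$$ For $v$ in the fibre of $T\mathcal H_{x^+}$ at $x$, $p_{x^+}(v)$ is the projection of $v$ to $T_{x^+}\partial\Omega$ parallel to the direction of the line $(xx^+)$, in the chosen affine chart. Graph of $\partial\Omega$ at $x^+$: near $x^+$, $\partial\Omega$ is the graph over a neighbourhood of $0$ in $T_{x^+}\partial\Omega$ (origin at $x^+$) of a strictly convex $C^1$ function $f\ge0$ with $f(0)=0$, $f'(0)=0$, heights being measured along the inner normal. Its upper and lower Lyapunov exponents in the direction $u\in T_{x^+}\partial\Omega\smallsetminus\{0\}$ are $$\overline\alpha(x^+,u)=\limsup_{t\to0}\frac{\log\frac{f(tu)+f(-tu)}2}{\log|t|},\qquad \underline\alpha(x^+,u)=\liminf_{t\to0}\frac{\log\frac{f(tu)+f(-tu)}2}{\log|t|},$$ with values in $[1,+\infty]$. *)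

theory Defs
  imports "HOL-Analysis.Analysis"
begin

section \<open>Projective space and its affine charts\<close>

text \<open>
  Points of the projective space of a vector space are its lines through the origin. A set of
  points is open iff the cone over it (without the origin) is open, i.e. the topology is the
  quotient topology. Real projective n-space is \<open>proj_space :: ('a \<times> real) set set\<close>
  for a Euclidean space \<open>'a\<close> of dimension n.
\<close>

definition proj_space :: "'v::euclidean_space set set" where
  "proj_space = {span {w} | w. w \<noteq> 0}"

definition proj_topology :: "'v::euclidean_space set topology" where
  "proj_topology = topology (\<lambda>U. U \<subseteq> proj_space \<and> open {w. w \<noteq> 0 \<and> span {w} \<in> U})"

lemma openin_proj_topology:
  "openin proj_topology U \<longleftrightarrow> U \<subseteq> proj_space \<and> open {w. w \<noteq> 0 \<and> span {w} \<in> U}"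
proof -
  have "istopology (\<lambda>U::'a set set. U \<subseteq> proj_space \<and> open {w. w \<noteq> 0 \<and> span {w} \<in> U})"
    unfolding istopology_def
  proof (intro conjI allI impI)
    fix S T :: "'a set set"
    assume S: "S \<subseteq> proj_space \<and> open {w. w \<noteq> 0 \<and> span {w} \<in> S}"
      and T: "T \<subseteq> proj_space \<and> open {w. w \<noteq> 0 \<and> span {w} \<in> T}"
    show "S \<inter> T \<subseteq> proj_space" using S by blast
    have "{w. w \<noteq> 0 \<and> span {w} \<in> S \<inter> T}
        = {w. w \<noteq> 0 \<and> span {w} \<in> S} \<inter> {w. w \<noteq> 0 \<and> span {w} \<in> T}" by blast
    then show "open {w. w \<noteq> 0 \<and> span {w} \<in> S \<inter> T}" using S T by auto
  next
    fix K :: "'a set set set"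
    assume K: "\<forall>U\<in>K. U \<subseteq> proj_space \<and> open {w. w \<noteq> 0 \<and> span {w} \<in> U}"
    then show "\<Union>K \<subseteq> proj_space" by blast
    have "{w. w \<noteq> 0 \<and> span {w} \<in> \<Union>K} = (\<Union>U\<in>K. {w. w \<noteq> 0 \<and> span {w} \<in> U})" by blast
    then show "open {w. w \<noteq> 0 \<and> span {w} \<in> \<Union>K}" using K by auto
  qed
  then show ?thesis unfolding proj_topology_def by simp
qed

abbreviation proj_boundary :: "'v::euclidean_space set set \<Rightarrow> 'v set set" where
  "proj_boundary \<Omega> \<equiv> proj_topology frontier_of \<Omega>"

text \<open>
  An affine chart together with a Euclidean metric on it is encoded by a linear automorphism
  \<open>L\<close>: the hyperplane at infinity is given by \<open>snd (L w) = 0\<close>, and the line of \<open>w\<close> has the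
  coordinate \<open>fst (L w) / snd (L w)\<close> in the Euclidean space \<open>'a\<close>. Since \<open>L\<close> is arbitrary, every
  affine chart with every Euclidean metric on it arises in this way (up to isometry).
\<close>

definition affine_chart :: "('a::euclidean_space \<times> real \<Rightarrow> 'a \<times> real) \<Rightarrow> bool" where
  "affine_chart L \<longleftrightarrow> linear L \<and> bij L"

definition chart_dom :: "('a::euclidean_space \<times> real \<Rightarrow> 'a \<times> real) \<Rightarrow> ('a \<times> real) set set" where
  "chart_dom L = {P \<in> proj_space. \<exists>w\<in>P. snd (L w) \<noteq> 0}"

definition chart_map :: "('a::euclidean_space \<times> real \<Rightarrow> 'a \<times> real) \<Rightarrow> ('a \<times> real) set \<Rightarrow> 'a" where
  "chart_map L P = (THE y. \<exists>w\<in>P. L w = (y, 1))"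

definition chart_inv :: "('a::euclidean_space \<times> real \<Rightarrow> 'a \<times> real) \<Rightarrow> 'a \<Rightarrow> ('a \<times> real) set" where
  "chart_inv L y = span {inv L (y, 1)}"

definition chart_image ::
    "('a::euclidean_space \<times> real \<Rightarrow> 'a \<times> real) \<Rightarrow> ('a \<times> real) set set \<Rightarrow> 'a set" where
  "chart_image L S = chart_map L ` (S \<inter> chart_dom L)"

lemma chart_map_span:
  assumes "affine_chart L" and "snd (L w) \<noteq> 0"
  shows "chart_map L (span {w}) = fst (L w) /\<^sub>R snd (L w)"
proof -
  have lin: "linear L" using assms(1) by (simp add: affine_chart_def)
  show ?thesis
    unfolding chart_map_def
  proof (rule the_equality)
    have "L (inverse (snd (L w)) *\<^sub>R w) = (fst (L w) /\<^sub>R snd (L w), 1)"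
      using assms(2) by (simp add: linear_cmul[OF lin] prod_eq_iff)
    then show "\<exists>u\<in>span {w}. L u = (fst (L w) /\<^sub>R snd (L w), 1)"
      by (meson insertI1 span_base span_scale)
  next
    fix y assume "\<exists>u\<in>span {w}. L u = (y, 1)"
    then obtain c where "L (c *\<^sub>R w) = (y, 1)" by (auto simp: span_singleton)
    then have "c *\<^sub>R fst (L w) = y" "c * snd (L w) = 1"
      by (auto simp: linear_cmul[OF lin] prod_eq_iff)
    then show "y = fst (L w) /\<^sub>R snd (L w)"
      using assms(2) by (metis inverse_unique mult.commute)
  qed
qed

text \<open>A chart whose hyperplane at infinity avoids the closure of \<open>\<Omega>\<close>.\<close>

definition bounded_chart ::
    "('a::euclidean_space \<times> real) set set \<Rightarrow> ('a \<times> real \<Rightarrow> 'a \<times> real) \<Rightarrow> bool" where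
  "bounded_chart \<Omega> L \<longleftrightarrow> affine_chart L \<and> \<Omega> \<subseteq> chart_dom L \<and> bounded (chart_image L \<Omega>)"

definition strictly_convex_proper_open :: "('a::euclidean_space \<times> real) set set \<Rightarrow> bool" where
  "strictly_convex_proper_open \<Omega> \<longleftrightarrow>
     openin proj_topology \<Omega> \<and>
     (\<exists>L. bounded_chart \<Omega> L \<and> convex (chart_image L \<Omega>) \<and>
          (\<forall>a\<in>frontier (chart_image L \<Omega>). \<forall>b\<in>frontier (chart_image L \<Omega>).
             closed_segment a b \<subseteq> frontier (chart_image L \<Omega>) \<longrightarrow> a = b))"

section \<open>C1 hypersurfaces and tangent spaces\<close>

definition C1_hypersurface :: "'a::euclidean_space set \<Rightarrow> bool" where
  "C1_hypersurface S \<longleftrightarrow>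
     (\<forall>z\<in>S. \<exists>N \<psi> G. open N \<and> z \<in> N \<and>
        (\<forall>y\<in>N. ((\<psi> :: 'a \<Rightarrow> real) has_derivative (\<lambda>h. G y \<bullet> h)) (at y)) \<and>
        continuous_on N G \<and> (\<forall>y\<in>N. G y \<noteq> 0) \<and>
        S \<inter> N = {y \<in> N. \<psi> y = 0})"

definition C1_boundary :: "('a::euclidean_space \<times> real) set set \<Rightarrow> bool" where
  "C1_boundary \<Omega> \<longleftrightarrow> (\<forall>L. affine_chart L \<longrightarrow> C1_hypersurface (chart_image L (proj_boundary \<Omega>)))"

text \<open>Velocities at \<open>x\<close> of curves in \<open>S\<close>; only applied to C1 hypersurfaces.\<close>

definition tangent_space :: "'a::euclidean_space set \<Rightarrow> 'a \<Rightarrow> 'a set" where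
  "tangent_space S x =
     {v. \<exists>\<gamma>::real \<Rightarrow> 'a. \<gamma> 0 = x \<and> (\<gamma> has_vector_derivative v) (at 0) \<and>
          (\<forall>\<^sub>F s in at 0. \<gamma> s \<in> S)}"

section \<open>Hilbert geometry of a bounded convex open set\<close>

definition exit_point :: "'a::euclidean_space set \<Rightarrow> 'a \<Rightarrow> 'a \<Rightarrow> 'a" where
  "exit_point D x \<xi> = (THE z. z \<in> frontier D \<and> (\<exists>s>0. z = x + s *\<^sub>R \<xi>))"

definition hilbert_dist :: "'a::euclidean_space set \<Rightarrow> 'a \<Rightarrow> 'a \<Rightarrow> real" where
  "hilbert_dist D x y =
     (if x = y then 0
      else let a = exit_point D x (x - y); b = exit_point D x (y - x)
           in 1/2 * \<bar>ln ((dist a x / dist b x) / (dist a y / dist b y))\<bar>)"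

definition finsler :: "'a::euclidean_space set \<Rightarrow> 'a \<Rightarrow> 'a \<Rightarrow> real" where
  "finsler D x \<xi> =
     norm \<xi> / 2 * (1 / dist x (exit_point D x \<xi>) + 1 / dist x (exit_point D x (- \<xi>)))"

text \<open>
  The point reached at time \<open>t\<close> by the curve starting at \<open>x\<close> which moves straight toward the
  boundary point \<open>z\<close> with Finsler speed 1: its velocity at \<open>y\<close> is the positive multiple of
  \<open>z - y\<close> of Finsler norm 1.
\<close>

definition radial_flow :: "'a::euclidean_space set \<Rightarrow> 'a \<Rightarrow> real \<Rightarrow> 'a \<Rightarrow> 'a" where
  "radial_flow D z t x =
     (THE y. \<exists>\<gamma>::real \<Rightarrow> 'a. \<gamma> 0 = x \<and>
        (\<forall>s. \<gamma> s \<in> D \<and>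
             (\<gamma> has_vector_derivative ((z - \<gamma> s) /\<^sub>R finsler D (\<gamma> s) (z - \<gamma> s))) (at s)) \<and>
        y = \<gamma> t)"

definition busemann :: "'a::euclidean_space set \<Rightarrow> 'a \<Rightarrow> 'a \<Rightarrow> 'a \<Rightarrow> real" where
  "busemann D z x y = Lim (at z within D) (\<lambda>p. hilbert_dist D x p - hilbert_dist D y p)"

text \<open>The horosphere about \<open>z\<close> through \<open>x\<close>.\<close>

definition horosphere :: "'a::euclidean_space set \<Rightarrow> 'a \<Rightarrow> 'a \<Rightarrow> 'a set" where
  "horosphere D z x = {y \<in> D. busemann D z x y = busemann D z x x}"

text \<open>For \<open>v\<close> tangent at \<open>x\<close>; the result is a tangent vector at \<open>radial_flow D z t x\<close>.\<close>

definition parallel_transport ::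
    "'a::euclidean_space set \<Rightarrow> 'a \<Rightarrow> real \<Rightarrow> 'a \<Rightarrow> 'a \<Rightarrow> 'a" where
  "parallel_transport D z t x v = exp t *\<^sub>R frechet_derivative (radial_flow D z t) (at x) v"

definition upper_parallel_exponent :: "'a::euclidean_space set \<Rightarrow> 'a \<Rightarrow> 'a \<Rightarrow> 'a \<Rightarrow> ereal" where
  "upper_parallel_exponent D z x v =
     Limsup at_top (\<lambda>t. ereal (1 / t *
       ln (finsler D (radial_flow D z t x) (parallel_transport D z t x v))))"

definition lower_parallel_exponent :: "'a::euclidean_space set \<Rightarrow> 'a \<Rightarrow> 'a \<Rightarrow> 'a \<Rightarrow> ereal" where
  "lower_parallel_exponent D z x v =
     Liminf at_top (\<lambda>t. ereal (1 / t *
       ln (finsler D (radial_flow D z t x) (parallel_transport D z t x v))))"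

section \<open>The boundary as a graph\<close>

text \<open>
  In the chart \<open>L\<close>, near the boundary point \<open>X\<close>, the boundary of \<open>\<Omega>\<close> is the graph of \<open>f\<close> over
  the tangent space there (with origin at \<open>X\<close>), heights being measured along the inner unit
  normal \<open>\<nu>\<close>. Only the values of \<open>f\<close> on the tangent space, near 0, matter.
\<close>

definition boundary_graph ::
    "('a::euclidean_space \<times> real) set set \<Rightarrow> ('a \<times> real \<Rightarrow> 'a \<times> real) \<Rightarrow> ('a \<times> real) set
       \<Rightarrow> ('a \<Rightarrow> real) \<Rightarrow> bool" where
  "boundary_graph \<Omega> L X f \<longleftrightarrow>
     (let S = chart_image L (proj_boundary \<Omega>); z = chart_map L X; T = tangent_space S z in
      \<exists>\<nu> r N f'.
        norm \<nu> = 1 \<and> (\<forall>u\<in>T. \<nu> \<bullet> u = 0) \<and>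
        (\<forall>\<^sub>F s in at_right 0. z + s *\<^sub>R \<nu> \<in> chart_image L \<Omega>) \<and>
        r > 0 \<and> open N \<and> z \<in> N \<and>
        S \<inter> N = (\<lambda>u. z + u + f u *\<^sub>R \<nu>) ` (T \<inter> ball 0 r) \<and>
        (\<forall>u\<in>T \<inter> ball 0 r. \<forall>w\<in>T \<inter> ball 0 r. \<forall>s\<in>{0<..<1}.
           u \<noteq> w \<longrightarrow> f ((1 - s) *\<^sub>R u + s *\<^sub>R w) < (1 - s) * f u + s * f w) \<and>
        (\<forall>u\<in>T \<inter> ball 0 r. (f has_derivative f' u) (at u within T)) \<and>
        (\<forall>h\<in>T. continuous_on (T \<inter> ball 0 r) (\<lambda>u. f' u h)) \<and>
        (\<forall>u\<in>T \<inter> ball 0 r. f u \<ge> 0) \<and> f 0 = 0 \<and> (\<forall>h\<in>T. f' 0 h = 0))"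

definition upper_graph_exponent :: "('a::euclidean_space \<Rightarrow> real) \<Rightarrow> 'a \<Rightarrow> ereal" where
  "upper_graph_exponent f u =
     Limsup (at 0) (\<lambda>t::real. ereal (ln ((f (t *\<^sub>R u) + f (- t *\<^sub>R u)) / 2) / ln \<bar>t\<bar>))"

definition lower_graph_exponent :: "('a::euclidean_space \<Rightarrow> real) \<Rightarrow> 'a \<Rightarrow> ereal" where
  "lower_graph_exponent f u =
     Liminf (at 0) (\<lambda>t::real. ereal (ln ((f (t *\<^sub>R u) + f (- t *\<^sub>R u)) / 2) / ln \<bar>t\<bar>))"

section \<open>Projection to the tangent space of the boundary\<close>

text \<open>A vector given in chart \<open>B\<close> at the point \<open>P\<close>, read in chart \<open>C\<close>.\<close>

definition change_chart ::
    "('a::euclidean_space \<times> real \<Rightarrow> 'a \<times> real) \<Rightarrow> ('a \<times> real \<Rightarrow> 'a \<times> real) \<Rightarrow> ('a \<times> real) set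
       \<Rightarrow> 'a \<Rightarrow> 'a" where
  "change_chart B C P v =
     frechet_derivative (chart_map C \<circ> chart_inv B) (at (chart_map B P)) v"

text \<open>
  For \<open>w\<close> a vector at the point \<open>P\<close> in chart \<open>L\<close>: its projection to the tangent space of the
  boundary at \<open>X\<close>, parallel to the line through \<open>P\<close> and \<open>X\<close>.
\<close>

definition boundary_projection ::
    "('a::euclidean_space \<times> real) set set \<Rightarrow> ('a \<times> real \<Rightarrow> 'a \<times> real) \<Rightarrow> ('a \<times> real) set
       \<Rightarrow> ('a \<times> real) set \<Rightarrow> 'a \<Rightarrow> 'a" where
  "boundary_projection \<Omega> L X P w =
     (THE u. u \<in> tangent_space (chart_image L (proj_boundary \<Omega>)) (chart_map L X) \<and>
             w - u \<in> span {chart_map L X - chart_map L P})"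

end

theory Submission
  imports Defs "HOL-Real_Asymp.Real_Asymp"
begin

text \<open>
  Let \<open>m(y)\<close> be the position of \<open>y\<close> on its chord through the boundary point \<open>z = x\<^sup>+\<close>, normalised to
  be 0 at \<open>z\<close> and 1 at the other end. The radial flow is \<open>y \<mapsto> z + \<epsilon> (y - z)\<close> with
  \<open>\<epsilon> = 1 / (m + e\<^bsup>2t\<^esup> (1 - m))\<close>, and the horospheres about \<open>z\<close> are the level sets of
  \<open>g \<bullet> (y - z) / (1 - m(y))\<close>, \<open>g\<close> being normal to the boundary at \<open>z\<close>. Hence the flow sends
  \<open>v = u + \<kappa> (x - z)\<close>, tangent to the horosphere, with \<open>u\<close> tangent to the boundary at \<open>z\<close>, to
  \<open>\<epsilon> (u + \<epsilon> \<kappa> (x - z))\<close>. The Finsler norm of this vector is governed by the two times at which the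
  chord through \<open>z + \<epsilon> (x - z)\<close> in that direction meets the boundary; there the height of the boundary
  above its tangent space is comparable to \<open>\<epsilon> \<approx> e\<^bsup>-2t\<^esup>\<close>. The smaller of the two times therefore
  inverts, up to constants, the mean height \<open>h(s) = (f(su) + f(-su)) / 2\<close>, so that
  \<open>log F / t = - 1 + 2 log s / log h(s) + o(1)\<close>. Both a change of the affine chart and tilting the slice
  off the normal direction alter the heights by bounded factors only.
\<close>

section \<open>Growth exponents of inverse functions\<close>

text \<open>Flow and horospheres live in a chart where the domain is bounded, but \<open>f\<close>
  is a graph in an arbitrary chart. Heights are therefore compared only on the plane slice through z
  spanned by u and x - z: there a change of chart multiplies both coordinates by one factor, which
  has a nonzero limit at z, possibly negative. The boundary is only C1. Moving chord ends and
  Busemann functions are controlled by secant normals: vectors orthogonal to the difference of two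
  nearby boundary points and tending to the normal. Exact identities between two points thus replace
  expansions. The mean height enters because the Finsler norm is a mean of reciprocal exit times,
  dominated by the shorter one. At that time one of f(su), f(-su) has order \<epsilon>, and
  monotonicity along rays keeps the other from being of larger order. The shorter time is no exact
  inverse of h and is not known to be monotone; only strict monotonicity of h compares the two. In
  the exponent, -1 is 1 - 2: the factor exp t of parallel transport against the overall scale
  \<epsilon> of the flow's derivative.\<close>

lemma Limsup_compose_filterlim:
  fixes g :: "'b \<Rightarrow> 'c::complete_linorder"
  assumes "filterlim f G F"
  shows "Limsup F (\<lambda>x. g (f x)) \<le> Limsup G g"
  unfolding Limsup_le_iff
  using assms by (auto simp: filterlim_iff dest!: Limsup_lessD)

lemma Liminf_compose_filterlim:
  fixes g :: "'b \<Rightarrow> 'c::complete_linorder"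
  assumes "filterlim f G F"
  shows "Liminf G g \<le> Liminf F (\<lambda>x. g (f x))"
  unfolding le_Liminf_iff
  using assms by (auto simp: filterlim_iff dest!: less_LiminfD)

text \<open>Reparametrising by \<open>f\<close> can only lose cluster values, which gives one
  inequality for each limit; reparametrising back by the eventual right inverse \<open>f'\<close>
  gives the other.\<close>

lemma Limsup_Liminf_compose_inverse:
  fixes g :: "'b \<Rightarrow> 'c::complete_linorder"
  assumes "filterlim f G F" "filterlim f' F G" "\<forall>\<^sub>F y in G. f (f' y) = y"
  shows "Limsup F (\<lambda>x. g (f x)) = Limsup G g" "Liminf F (\<lambda>x. g (f x)) = Liminf G g"
proof -
  have "Limsup G g = Limsup G (\<lambda>y. g (f (f' y)))" "Liminf G g = Liminf G (\<lambda>y. g (f (f' y)))"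
    using assms(3) by (auto intro!: Limsup_eq Liminf_eq elim: eventually_mono)
  then show "Limsup F (\<lambda>x. g (f x)) = Limsup G g" "Liminf F (\<lambda>x. g (f x)) = Liminf G g"
    using Limsup_compose_filterlim[OF assms(1), of g] Liminf_compose_filterlim[OF assms(1), of g]
      Limsup_compose_filterlim[OF assms(2), of "\<lambda>x. g (f x)"]
      Liminf_compose_filterlim[OF assms(2), of "\<lambda>x. g (f x)"]
    by simp_all
qed

lemma Limsup_ereal_close_le:
  assumes "((\<lambda>x. X x - Y x) \<longlongrightarrow> 0) F" "F \<noteq> bot"
  shows "Limsup F (\<lambda>x. ereal (X x)) \<le> Limsup F (\<lambda>x. ereal (Y x))"
proof (rule ereal_le_epsilon2)
  fix e :: real assume "e > 0"
  with assms(1) have "\<forall>\<^sub>F x in F. \<bar>X x - Y x\<bar> < e"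
    by (auto simp: tendsto_iff dist_real_def)
  then have "Limsup F (\<lambda>x. ereal (X x)) \<le> Limsup F (\<lambda>x. ereal (Y x) + ereal e)"
    by (intro Limsup_mono) (auto elim!: eventually_mono)
  then show "Limsup F (\<lambda>x. ereal (X x)) \<le> Limsup F (\<lambda>x. ereal (Y x)) + ereal e"
    using assms(2) by (simp add: Limsup_add_ereal_right del: plus_ereal.simps)
qed

lemma Limsup_ereal_close:
  assumes "((\<lambda>x. X x - Y x) \<longlongrightarrow> 0) F" "F \<noteq> bot"
  shows "Limsup F (\<lambda>x. ereal (X x)) = Limsup F (\<lambda>x. ereal (Y x))"
proof -
  have "((\<lambda>x. Y x - X x) \<longlongrightarrow> 0) F"
    using tendsto_minus[OF assms(1)] by simp
  then show ?thesis using assms by (intro antisym Limsup_ereal_close_le)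
qed

lemma Liminf_ereal_close:
  assumes "((\<lambda>x. X x - Y x) \<longlongrightarrow> 0) F" "F \<noteq> bot"
  shows "Liminf F (\<lambda>x. ereal (X x)) = Liminf F (\<lambda>x. ereal (Y x))"
proof -
  have "((\<lambda>x. - X x - - Y x) \<longlongrightarrow> 0) F"
    using tendsto_minus[OF assms(1)] by simp
  from Limsup_ereal_close[OF this assms(2)] show ?thesis
    using ereal_Limsup_uminus[of F "\<lambda>x. ereal (X x)"] ereal_Limsup_uminus[of F "\<lambda>x. ereal (Y x)"]
    by simp
qed

text \<open>The difference of the logarithms stays bounded by \<bar>ln c\<bar> + \<bar>ln C\<bar>
  while \<open>ln (x t)\<close> diverges. This is why bounded factors do not affect
  exponents.\<close>

lemma tendsto_ln_ratio_1:
  fixes x y :: "'b \<Rightarrow> real"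
  assumes x: "filterlim x (at_right 0) F" and c: "c > 0"
    and y: "\<forall>\<^sub>F t in F. c * x t \<le> y t \<and> y t \<le> C * x t"
  shows "((\<lambda>t. ln (y t) / ln (x t)) \<longlongrightarrow> 1) F"
proof -
  have pos: "\<forall>\<^sub>F t in F. 0 < x t \<and> x t < 1"
    using eventually_compose_filterlim[OF eventually_at_right_real[of 0 1] x] by simp
  have bd: "\<forall>\<^sub>F t in F. norm (ln (y t) - ln (x t)) \<le> \<bar>ln c\<bar> + \<bar>ln C\<bar>"
    using y pos
  proof eventually_elim
    case (elim t)
    have "0 < c * x t" using elim c by simp
    with elim have p: "0 < c * x t" "0 < y t" "0 < C * x t" by linarith+
    then have C: "C > 0" using elim by (simp add: zero_less_mult_iff)
    have "ln (c * x t) \<le> ln (y t)" "ln (y t) \<le> ln (C * x t)"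
      using elim p by auto
    then show ?case using elim c C by (simp add: ln_mult)
  qed
  have "filterlim (\<lambda>t. ln (x t)) at_bot F"
    by (rule filterlim_compose[OF ln_at_0 x])
  then have inv: "((\<lambda>t. inverse (ln (x t))) \<longlongrightarrow> 0) F"
    by (intro tendsto_inverse_0[THEN filterlim_compose] filterlim_at_bot_imp_at_infinity)
  have "((\<lambda>t. inverse (ln (x t)) * (ln (y t) - ln (x t))) \<longlongrightarrow> 0) F"
  proof (rule Lim_null_comparison)
    show "\<forall>\<^sub>F t in F. norm (inverse (ln (x t)) * (ln (y t) - ln (x t)))
        \<le> \<bar>inverse (ln (x t))\<bar> * (\<bar>ln c\<bar> + \<bar>ln C\<bar>)"
      using bd by eventually_elim (auto simp: abs_mult intro!: mult_left_mono)
    show "((\<lambda>t. \<bar>inverse (ln (x t))\<bar> * (\<bar>ln c\<bar> + \<bar>ln C\<bar>)) \<longlongrightarrow> 0) F"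
      by (intro tendsto_mult_left_zero tendsto_rabs_zero inv)
  qed
  then have "((\<lambda>t. 1 + inverse (ln (x t)) * (ln (y t) - ln (x t))) \<longlongrightarrow> 1 + 0) F"
    by (intro tendsto_intros)
  moreover have "\<forall>\<^sub>F t in F. 1 + inverse (ln (x t)) * (ln (y t) - ln (x t)) = ln (y t) / ln (x t)"
    using pos by eventually_elim (simp add: field_simps)
  ultimately show ?thesis
    by (simp add: filterlim_cong)
qed

text \<open>The difference equals \<open>ln w / ln y\<close> times \<open>ln y / ln x - 1\<close>, a
  bounded quantity times a null one.\<close>

lemma tendsto_ln_quotient_diff_0:
  fixes x y w :: "'b \<Rightarrow> real"
  assumes x: "filterlim x (at_right 0) F" and c: "c > 0"
    and y: "\<forall>\<^sub>F t in F. c * x t \<le> y t \<and> y t \<le> C * x t"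
    and b: "\<forall>\<^sub>F t in F. \<bar>ln (w t) / ln (y t)\<bar> \<le> M"
    and y1: "\<forall>\<^sub>F t in F. 0 < y t \<and> y t < 1"
  shows "((\<lambda>t. ln (w t) / ln (x t) - ln (w t) / ln (y t)) \<longlongrightarrow> 0) F"
proof (rule Lim_null_comparison)
  have "((\<lambda>t. ln (y t) / ln (x t) - 1) \<longlongrightarrow> 1 - 1) F"
    by (intro tendsto_intros tendsto_ln_ratio_1[OF x c y])
  then show "((\<lambda>t. M * \<bar>ln (y t) / ln (x t) - 1\<bar>) \<longlongrightarrow> 0) F"
    by (auto intro!: tendsto_mult_right_zero tendsto_rabs_zero)
  show "\<forall>\<^sub>F t in F. norm (ln (w t) / ln (x t) - ln (w t) / ln (y t))
      \<le> M * \<bar>ln (y t) / ln (x t) - 1\<bar>"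
    using b y1
  proof eventually_elim
    case (elim t)
    then have "ln (y t) \<noteq> 0" by (simp)
    then have "ln (w t) / ln (x t) - ln (w t) / ln (y t)
        = ln (w t) / ln (y t) * (ln (y t) / ln (x t) - 1)"
      by (simp add: field_simps)
    then have "norm (ln (w t) / ln (x t) - ln (w t) / ln (y t))
        = \<bar>ln (w t) / ln (y t)\<bar> * \<bar>ln (y t) / ln (x t) - 1\<bar>"
      by (metis abs_mult real_norm_def)
    then show ?case using elim(1) by (metis abs_ge_zero mult_right_mono)
  qed
qed

lemma filterlim_at_right_0_iff:
  "filterlim f (at_right (0::real)) F \<longleftrightarrow> (f \<longlongrightarrow> 0) F \<and> (\<forall>\<^sub>F x in F. 0 < f x)"
  by (auto simp: filterlim_at elim: eventually_mono)

text \<open>Here \<open>a\<close> inverts \<open>h\<close> only up to the factors \<open>c\<close>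
  and \<open>C\<close>. Putting s = \<open>a \<epsilon>\<close> gives one inequality for each limit.
  For the converse ones, \<epsilon> is taken to be a suitable multiple of \<open>h s\<close>, so
  that monotonicity of \<open>h\<close> puts \<open>a \<epsilon>\<close> on a known side of s; the
  multiple is then removed from the logarithm.\<close>

lemma Limsup_Liminf_inverse_rate:
  fixes h a :: "real \<Rightarrow> real"
  assumes r: "0 < r" "r \<le> 1"
    and h_pos: "\<And>s. 0 < s \<Longrightarrow> s < r \<Longrightarrow> 0 < h s"
    and h_mono: "\<And>s t. 0 < s \<Longrightarrow> s < t \<Longrightarrow> t < r \<Longrightarrow> h s < h t"
    and h_le: "\<And>s. 0 < s \<Longrightarrow> s < r \<Longrightarrow> h s \<le> s"
    and a: "filterlim a (at_right 0) (at_right 0)"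
    and c: "0 < c" "0 < C"
    and ha: "\<forall>\<^sub>F \<epsilon> in at_right 0. c * \<epsilon> \<le> h (a \<epsilon>) \<and> h (a \<epsilon>) \<le> C * \<epsilon>"
  shows "Limsup (at_right 0) (\<lambda>\<epsilon>. ereal (ln (a \<epsilon>) / ln \<epsilon>))
           = Limsup (at_right 0) (\<lambda>s. ereal (ln s / ln (h s)))"
    and "Liminf (at_right 0) (\<lambda>\<epsilon>. ereal (ln (a \<epsilon>) / ln \<epsilon>))
           = Liminf (at_right 0) (\<lambda>s. ereal (ln s / ln (h s)))"
    and "\<forall>\<^sub>F \<epsilon> in at_right 0. \<bar>ln (a \<epsilon>) / ln \<epsilon>\<bar> \<le> 2"
proof -
  have small: "\<forall>\<^sub>F s in at_right 0. 0 < s \<and> s < r"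
    using eventually_at_right_real[OF r(1)] by simp
  have small_a: "\<forall>\<^sub>F \<epsilon> in at_right 0. 0 < a \<epsilon> \<and> a \<epsilon> < r"
    by (rule eventually_compose_filterlim[OF small a])
  have bound: "\<bar>ln s / ln (h s)\<bar> \<le> 1" if "0 < s" "s < r" for s
  proof -
    have "ln (h s) \<le> ln s" using h_pos[OF that] h_le[OF that] that by simp
    moreover have "ln s < 0" using that r by simp
    ultimately show ?thesis by (simp add: abs_if field_simps)
  qed
  have h0: "filterlim h (at_right 0) (at_right 0)"
    unfolding filterlim_at_right_0_iff
  proof
    show "(h \<longlongrightarrow> 0) (at_right 0)"
    proof (rule Lim_null_comparison)
      show "\<forall>\<^sub>F s in at_right 0. norm (h s) \<le> s"
        using small by eventually_elim (use h_pos h_le in fastforce)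
    qed (simp add: filterlim_ident tendsto_ident_at)
    show "\<forall>\<^sub>F s in at_right 0. 0 < h s" using small by eventually_elim (use h_pos in simp)
  qed
  have y1: "0 < h s \<and> h s < 1" if "0 < s" "s < r" for s
    using h_pos[OF that] h_le[OF that] that r by auto
  have id: "filterlim (\<lambda>e. e) (at_right 0) (at_right (0::real))" by (rule filterlim_ident)
  have d1: "((\<lambda>\<epsilon>. ln (a \<epsilon>) / ln \<epsilon> - ln (a \<epsilon>) / ln (h (a \<epsilon>))) \<longlongrightarrow> 0) (at_right 0)"
    by (rule tendsto_ln_quotient_diff_0[OF id c(1) ha, where M = 1])
       (use small_a bound y1 in \<open>auto elim!: eventually_mono\<close>)
  show "\<forall>\<^sub>F \<epsilon> in at_right 0. \<bar>ln (a \<epsilon>) / ln \<epsilon>\<bar> \<le> 2"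
    using tendstoD[OF d1, of 1, simplified] small_a
  proof eventually_elim
    case (elim \<epsilon>)
    then show ?case using bound[of "a \<epsilon>"] by linarith
  qed
  have h_k: "filterlim (\<lambda>s. h s / k) (at_right 0) (at_right 0)" if "k > 0" for k
    using h0 that unfolding filterlim_at_right_0_iff
    by (auto intro!: tendsto_divide_zero elim: eventually_mono)
  have d2: "((\<lambda>s. ln s / ln (h s / k) - ln s / ln (h s)) \<longlongrightarrow> 0) (at_right 0)" if "k > 0" for k
    by (rule tendsto_ln_quotient_diff_0[OF h_k[OF that] that, where M = 1 and C = k])
       (use that small bound y1 in \<open>auto elim!: eventually_mono\<close>)
  have nb: "at_right (0::real) \<noteq> bot" by simp
  let ?g = "\<lambda>\<epsilon>. ereal (ln (a \<epsilon>) / ln \<epsilon>)" and ?y = "\<lambda>s. ereal (ln s / ln (h s))"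
  have lt1: "\<forall>\<^sub>F \<epsilon> in at_right 0. \<epsilon> < (1::real)"
    using eventually_at_right_real[of 0 "1::real"] by (auto elim: eventually_mono)
  have "Limsup (at_right 0) ?y = Limsup (at_right 0) (\<lambda>s. ereal (ln s / ln (h s / (2 * C))))"
    using Limsup_ereal_close[OF d2[of "2 * C"] nb] c by simp
  also have "\<dots> \<le> Limsup (at_right 0) (\<lambda>s. ?g (h s / (2 * C)))"
  proof (rule Limsup_mono)
    have "\<forall>\<^sub>F s in at_right 0. (c * (h s / (2 * C)) \<le> h (a (h s / (2 * C)))
        \<and> h (a (h s / (2 * C))) \<le> C * (h s / (2 * C)))
        \<and> (0 < a (h s / (2 * C)) \<and> a (h s / (2 * C)) < r) \<and> h s / (2 * C) < 1"
      using c by (intro eventually_compose_filterlim[OF _ h_k] eventually_conj ha small_a lt1) simp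
    with small show "\<forall>\<^sub>F s in at_right 0. ereal (ln s / ln (h s / (2 * C))) \<le> ?g (h s / (2 * C))"
    proof eventually_elim
      case (elim s)
      have "0 < h s" using elim h_pos by simp
      \<comment> \<open>At \<epsilon> = h s / (2 C) the upper bound C \<epsilon> is half of h s; the
        spare factor 2 makes the inequality strict, so strict monotonicity yields a \<epsilon> < s.
        Division by a negative logarithm reverses the order.\<close>
      then have "h (a (h s / (2 * C))) < h s" using elim c by (simp add: field_simps)
      then have "a (h s / (2 * C)) < s"
        using elim h_mono[of s "a (h s / (2 * C))"] by (metis less_asym linorder_neqE)
      then have "ln (a (h s / (2 * C))) \<le> ln s" using elim by simp
      moreover have "ln (h s / (2 * C)) < 0" using elim c \<open>0 < h s\<close> by (intro ln_less_zero) auto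
      ultimately show ?case by (simp add: divide_right_mono_neg)
    qed
  qed
  also have "\<dots> \<le> Limsup (at_right 0) ?g"
    using c by (intro Limsup_compose_filterlim[of "\<lambda>s. h s / (2 * C)" _ _ ?g] h_k) simp
  finally have 1: "Limsup (at_right 0) ?y \<le> Limsup (at_right 0) ?g" .
  have "Liminf (at_right 0) ?g \<le> Liminf (at_right 0) (\<lambda>s. ?g (h s / (c / 2)))"
    using c by (intro Liminf_compose_filterlim[of "\<lambda>s. h s / (c / 2)" _ _ ?g] h_k) simp
  also have "\<dots> \<le> Liminf (at_right 0) (\<lambda>s. ereal (ln s / ln (h s / (c / 2))))"
  proof (rule Liminf_mono)
    have "\<forall>\<^sub>F s in at_right 0. (c * (h s / (c / 2)) \<le> h (a (h s / (c / 2)))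
        \<and> h (a (h s / (c / 2))) \<le> C * (h s / (c / 2)))
        \<and> (0 < a (h s / (c / 2)) \<and> a (h s / (c / 2)) < r) \<and> h s / (c / 2) < 1"
      using c by (intro eventually_compose_filterlim[OF _ h_k] eventually_conj ha small_a lt1) simp
    with small show "\<forall>\<^sub>F s in at_right 0. ?g (h s / (c / 2)) \<le> ereal (ln s / ln (h s / (c / 2)))"
    proof eventually_elim
      case (elim s)
      have "0 < h s" using elim h_pos by simp
      \<comment> \<open>Mirror choice for the lower limit: at \<epsilon> = 2 h s / c the lower bound
        c \<epsilon> is twice h s, which forces s < a \<epsilon>.\<close>
      then have "h s < h (a (h s / (c / 2)))" using elim c by (simp add: field_simps)
      then have "s < a (h s / (c / 2))"
        using elim h_mono[of "a (h s / (c / 2))" s] by (metis less_asym linorder_neqE)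
      then have "ln s \<le> ln (a (h s / (c / 2)))" using elim by simp
      moreover have "ln (h s / (c / 2)) < 0" using elim c \<open>0 < h s\<close> by (intro ln_less_zero) auto
      ultimately show ?case by (simp add: divide_right_mono_neg)
    qed
  qed
  also have "\<dots> = Liminf (at_right 0) ?y"
    using Liminf_ereal_close[OF d2[of "c / 2"] nb] c by simp
  finally have 2: "Liminf (at_right 0) ?g \<le> Liminf (at_right 0) ?y" .
  show "Limsup (at_right 0) ?g = Limsup (at_right 0) ?y"
    using 1 Limsup_compose_filterlim[OF a, of ?y] Limsup_ereal_close[OF d1 nb] by simp
  show "Liminf (at_right 0) ?g = Liminf (at_right 0) ?y"
    using 2 Liminf_compose_filterlim[OF a, of ?y] Liminf_ereal_close[OF d1 nb] by simp
qed

text \<open>The graph exponents are two-sided limits of even functions; t and \<bar>t\<bar> serve as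
  reparametrisations in the two directions.\<close>

lemma Limsup_Liminf_at_0_even:
  fixes g :: "real \<Rightarrow> 'c::complete_linorder"
  assumes "\<And>t. g (- t) = g t"
  shows "Limsup (at 0) g = Limsup (at_right 0) g" "Liminf (at 0) g = Liminf (at_right 0) g"
proof -
  have r: "filterlim (\<lambda>t. t) (at 0) (at_right (0::real))"
    by (simp add: filterlim_def at_le)
  have a: "filterlim (\<lambda>t. \<bar>t\<bar>) (at_right 0) (at (0::real))"
    unfolding filterlim_at_right_0_iff
    by (auto intro: tendsto_rabs_zero tendsto_ident_at simp: eventually_at_filter)
  have "g \<bar>t\<bar> = g t" for t using assms by (simp add: abs_if)
  then show "Limsup (at 0) g = Limsup (at_right 0) g" "Liminf (at 0) g = Liminf (at_right 0) g"
    using Limsup_compose_filterlim[OF r, of g] Limsup_compose_filterlim[OF a, of g]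
      Liminf_compose_filterlim[OF r, of g] Liminf_compose_filterlim[OF a, of g]
    by simp_all
qed

text \<open>Inversion reverses the order of the nonnegative extended reals, so it exchanges the
  upper and the lower limit; its value 0 at infinity realises the convention 2 / (+infinity) =
  0.\<close>

lemma Limsup_Liminf_inverse_affine:
  fixes X Y :: "'b \<Rightarrow> real"
  assumes F: "F \<noteq> bot" and pos: "\<forall>\<^sub>F s in F. 0 < X s" and Y: "\<forall>\<^sub>F s in F. Y s = inverse (X s)"
  shows "Limsup F (\<lambda>s. ereal (2 * Y s - 1)) = 2 / Liminf F (\<lambda>s. ereal (X s)) - 1"
    and "Liminf F (\<lambda>s. ereal (2 * Y s - 1)) = 2 / Limsup F (\<lambda>s. ereal (X s)) - 1"
proof -
  have *: "\<forall>\<^sub>F s in F. ereal (2 * Y s - 1) = ereal 2 * inverse (ereal (X s)) + ereal (- 1)"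
    using pos Y by eventually_elim simp
  have nn: "\<forall>\<^sub>F s in F. 0 \<le> ereal (X s)" using pos by eventually_elim simp
  have m1: "x + ereal (- 1) = x - 1" for x :: ereal
    by (simp add: minus_ereal_def one_ereal_def)
  have "Limsup F (\<lambda>s. ereal (2 * Y s - 1))
      = Limsup F (\<lambda>s. ereal 2 * inverse (ereal (X s)) + ereal (- 1))"
    by (rule Limsup_eq[OF *])
  also have "\<dots> = ereal 2 * inverse (Liminf F (\<lambda>s. ereal (X s))) + ereal (- 1)"
    using F by (simp add: Limsup_add_ereal_right Limsup_ereal_mult_left Limsup_inverse_ereal[OF F nn]
        del: plus_ereal.simps inverse_ereal.simps)
  finally show "Limsup F (\<lambda>s. ereal (2 * Y s - 1)) = 2 / Liminf F (\<lambda>s. ereal (X s)) - 1"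
    by (simp only: m1 divide_ereal_def numeral_eq_ereal)
  have "Liminf F (\<lambda>s. ereal (2 * Y s - 1))
      = Liminf F (\<lambda>s. ereal 2 * inverse (ereal (X s)) + ereal (- 1))"
    by (rule Liminf_eq[OF *])
  also have "\<dots> = ereal 2 * inverse (Limsup F (\<lambda>s. ereal (X s))) + ereal (- 1)"
    using F by (simp add: Liminf_add_ereal_right Liminf_ereal_mult_left Liminf_inverse_ereal[OF F nn]
        del: plus_ereal.simps inverse_ereal.simps)
  finally show "Liminf F (\<lambda>s. ereal (2 * Y s - 1)) = 2 / Limsup F (\<lambda>s. ereal (X s)) - 1"
    by (simp only: m1 divide_ereal_def numeral_eq_ereal)
qed

text \<open>Up to bounded errors, ln E = - 2 t and ln W = - ln a. With Q = ln a / ln \<epsilon> at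
  \<epsilon> = E t, this gives ln Z = t + ln E + ln W = t (2 Q - 1) + O(1), and division by t
  removes the error. Boundedness of Q is what keeps Q (ln E + 2 t) inside that error.\<close>

lemma Limsup_Liminf_growth:
  fixes a W Z :: "real \<Rightarrow> real" and m :: real
  defines "E \<equiv> \<lambda>t. 1 / (m + exp (2 * t) * (1 - m))"
  assumes m: "0 < m" "m < 1"
    and a: "filterlim a (at_right 0) (at_right 0)"
    and bd: "\<forall>\<^sub>F \<epsilon> in at_right 0. \<bar>ln (a \<epsilon>) / ln \<epsilon>\<bar> \<le> M"
    and c: "0 < c"
    and W: "\<forall>\<^sub>F \<epsilon> in at_right 0. c \<le> W \<epsilon> * a \<epsilon> \<and> W \<epsilon> * a \<epsilon> \<le> C"
    and Z: "\<forall>\<^sub>F t in at_top. Z t = exp t * E t * W (E t)"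
  shows "Limsup at_top (\<lambda>t. ereal (1 / t * ln (Z t)))
           = Limsup (at_right 0) (\<lambda>\<epsilon>. ereal (2 * (ln (a \<epsilon>) / ln \<epsilon>) - 1))"
    and "Liminf at_top (\<lambda>t. ereal (1 / t * ln (Z t)))
           = Liminf (at_right 0) (\<lambda>\<epsilon>. ereal (2 * (ln (a \<epsilon>) / ln \<epsilon>) - 1))"
proof -
  have e1: "exp (2 * t) \<ge> 1" if "t \<ge> 0" for t :: real using that by simp
  have D0: "m + exp (2 * t) * (1 - m) > 0" for t
    using m by (intro add_pos_pos mult_pos_pos) auto
  then have E0: "E t > 0" for t
    unfolding E_def by simp
  have lnE: "\<bar>ln (E t) + 2 * t\<bar> \<le> \<bar>ln (1 - m)\<bar>" if "t \<ge> 0" for t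
  proof -
    have "ln (E t) + 2 * t = - ln ((m + exp (2 * t) * (1 - m)) / exp (2 * t))"
      unfolding E_def using m D0[of t] by (simp add: ln_div)
    moreover have "(m + exp (2 * t) * (1 - m)) / exp (2 * t) \<le> 1"
      using e1[OF that] m mult_left_mono[OF e1[OF that], of m]
      by (simp add: field_simps)
    moreover have "1 - m \<le> (m + exp (2 * t) * (1 - m)) / exp (2 * t)"
      using m by (simp add: field_simps)
    ultimately show ?thesis
      using m by (simp add: abs_if ln_mono)
  qed
  have Elim: "filterlim E (at_right 0) at_top"
  proof -
    have "(E \<longlongrightarrow> 0) at_top"
    proof (rule Lim_null_comparison)
      have "((\<lambda>t::real. exp (- 2 * t)) \<longlongrightarrow> 0) at_top" by real_asymp
      then show "((\<lambda>t. 1 / (1 - m) * exp (- 2 * t)) \<longlongrightarrow> 0) at_top"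
        by (rule tendsto_mult_right_zero)
      show "\<forall>\<^sub>F t in at_top. norm (E t) \<le> 1 / (1 - m) * exp (- 2 * t)"
      proof (intro always_eventually allI)
        fix t
        have "E t \<le> 1 / (exp (2 * t) * (1 - m))"
          unfolding E_def using m by (intro divide_left_mono mult_pos_pos D0) auto
        then show "norm (E t) \<le> 1 / (1 - m) * exp (- 2 * t)"
          using E0[of t] by (simp add: exp_minus field_simps)
      qed
    qed
    then show ?thesis using E0 by (simp add: filterlim_at_right_0_iff)
  qed
  \<comment> \<open>The solution t of E t = \<epsilon>. Every small \<epsilon> is thus reached by
    the flow, so no value of the limits at 0 is lost along E.\<close>
  define T where "T \<epsilon> = ln ((1 / \<epsilon> - m) / (1 - m)) / 2" for \<epsilon>
  have Tlim: "filterlim T at_top (at_right 0)"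
  proof (rule filterlim_at_top_mono)
    show "filterlim (\<lambda>\<epsilon>::real. ln (1 / \<epsilon> - 1) / 2) at_top (at_right 0)" by real_asymp
    show "\<forall>\<^sub>F \<epsilon> in at_right 0. ln (1 / \<epsilon> - 1) / 2 \<le> T \<epsilon>"
      using eventually_at_right_real[OF zero_less_one]
    proof eventually_elim
      case (elim \<epsilon>)
      then have p: "1 / \<epsilon> - 1 > 0" by simp
      have "1 / \<epsilon> - 1 \<le> 1 / \<epsilon> - m" using m by simp
      also have "\<dots> \<le> (1 / \<epsilon> - m) / (1 - m)"
        using m p by (simp add: pos_le_divide_eq mult_left_le)
      finally show ?case using p by (simp add: T_def)
    qed
  qed
  have ET: "\<forall>\<^sub>F \<epsilon> in at_right 0. E (T \<epsilon>) = \<epsilon>"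
    using eventually_at_right_real[OF zero_less_one]
  proof eventually_elim
    case (elim \<epsilon>)
    then have "1 / \<epsilon> > 1" by simp
    then have "1 / \<epsilon> - m > 0" using m by linarith
    then have "exp (2 * T \<epsilon>) = (1 / \<epsilon> - m) / (1 - m)"
      unfolding T_def using m by simp
    then show ?case unfolding E_def using m elim by simp
  qed
  let ?q = "\<lambda>\<epsilon>. 2 * (ln (a \<epsilon>) / ln \<epsilon>) - 1"
  have ap: "\<forall>\<^sub>F \<epsilon> in at_right 0. 0 < a \<epsilon>"
    using a by (simp add: filterlim_at_right_0_iff)
  have lt1: "\<forall>\<^sub>F \<epsilon> in at_right 0. \<epsilon> < (1::real)"
    using eventually_at_right_real[of 0 "1::real"] by (auto elim: eventually_mono)
  let ?R = "\<bar>ln (1 - m)\<bar> + \<bar>ln c\<bar> + \<bar>ln C\<bar> + M * \<bar>ln (1 - m)\<bar>"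
  have "((\<lambda>t. 1 / t * ln (Z t) - ?q (E t)) \<longlongrightarrow> 0) at_top"
  proof (rule Lim_null_comparison)
    have "\<forall>\<^sub>F t in at_top. \<bar>ln (a (E t)) / ln (E t)\<bar> \<le> M \<and> 0 < a (E t) \<and> E t < 1
        \<and> (c \<le> W (E t) * a (E t) \<and> W (E t) * a (E t) \<le> C)"
      by (intro eventually_compose_filterlim[OF _ Elim] eventually_conj bd ap lt1 W)
    with Z eventually_gt_at_top[of 0]
    show "\<forall>\<^sub>F t in at_top. norm (1 / t * ln (Z t) - ?q (E t)) \<le> ?R / t"
    proof eventually_elim
      case (elim t)
      let ?e = "E t"
      have Wp: "0 < W ?e"
        using elim c by (smt (verit) zero_less_mult_pos2)
      have lZ: "ln (Z t) = t + ln ?e + ln (W ?e)"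
        using elim Wp E0[of t] by (simp add: ln_mult)
      have Wa: "\<bar>ln (W ?e) + ln (a ?e)\<bar> \<le> \<bar>ln c\<bar> + \<bar>ln C\<bar>"
      proof -
        have "ln c \<le> ln (W ?e * a ?e)" "ln (W ?e * a ?e) \<le> ln C"
          using elim c by auto
        then show ?thesis using Wp elim by (simp add: ln_mult)
      qed
      have "ln ?e \<noteq> 0" using elim E0[of t] by simp
      define Q where "Q = ln (a ?e) / ln ?e"
      have Q: "ln (a ?e) = Q * ln ?e" "\<bar>Q\<bar> \<le> M"
        using \<open>ln ?e \<noteq> 0\<close> elim by (auto simp: Q_def)
      \<comment> \<open>ln a is added and, written as Q ln E, subtracted again: each of the three
        groups is then bounded uniformly in t.\<close>
      have "t * (1 / t * ln (Z t) - (2 * Q - 1))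
          = (ln ?e + 2 * t) + (ln (W ?e) + ln (a ?e)) - Q * (ln ?e + 2 * t)"
        unfolding lZ Q(1) using elim by (simp add: algebra_simps)
      also have "\<bar>\<dots>\<bar> \<le> \<bar>ln ?e + 2 * t\<bar> + \<bar>ln (W ?e) + ln (a ?e)\<bar> + \<bar>Q * (ln ?e + 2 * t)\<bar>"
        by linarith
      also have "\<dots> \<le> ?R"
      proof -
        have "\<bar>Q * (ln ?e + 2 * t)\<bar> \<le> M * \<bar>ln (1 - m)\<bar>"
          unfolding abs_mult using Q lnE[of t] elim by (intro mult_mono) auto
        then show ?thesis using Wa lnE[of t] elim by linarith
      qed
      finally have "\<bar>t * (1 / t * ln (Z t) - (2 * Q - 1))\<bar> \<le> ?R" .
      then have "t * norm (1 / t * ln (Z t) - (2 * Q - 1)) \<le> ?R"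
        using elim by (simp add: abs_mult)
      then show ?case
        using elim unfolding Q_def by (subst pos_le_divide_eq) (simp_all add: mult.commute)
    qed
    show "((\<lambda>t. ?R / t) \<longlongrightarrow> 0) at_top"
      by (intro tendsto_divide_0[OF tendsto_const] filterlim_at_top_imp_at_infinity filterlim_ident)
  qed
  note close = this
  show "Limsup at_top (\<lambda>t. ereal (1 / t * ln (Z t))) = Limsup (at_right 0) (\<lambda>\<epsilon>. ereal (?q \<epsilon>))"
    using Limsup_ereal_close[OF close]
      Limsup_Liminf_compose_inverse(1)[OF Elim Tlim ET, of "\<lambda>\<epsilon>. ereal (?q \<epsilon>)"] by simp
  show "Liminf at_top (\<lambda>t. ereal (1 / t * ln (Z t))) = Liminf (at_right 0) (\<lambda>\<epsilon>. ereal (?q \<epsilon>))"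
    using Liminf_ereal_close[OF close]
      Limsup_Liminf_compose_inverse(2)[OF Elim Tlim ET, of "\<lambda>\<epsilon>. ereal (?q \<epsilon>)"] by simp
qed

lemma Limsup_Liminf_affine:
  fixes Y :: "'b \<Rightarrow> real"
  assumes F: "F \<noteq> bot"
  shows "Limsup F (\<lambda>s. ereal (2 * Y s - 1)) = ereal 2 * Limsup F (\<lambda>s. ereal (Y s)) + ereal (- 1)"
    and "Liminf F (\<lambda>s. ereal (2 * Y s - 1)) = ereal 2 * Liminf F (\<lambda>s. ereal (Y s)) + ereal (- 1)"
proof -
  have *: "ereal (2 * Y s - 1) = ereal 2 * ereal (Y s) + ereal (- 1)" for s by simp
  show "Limsup F (\<lambda>s. ereal (2 * Y s - 1)) = ereal 2 * Limsup F (\<lambda>s. ereal (Y s)) + ereal (- 1)"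
    unfolding * using F
    by (simp add: Limsup_add_ereal_right Limsup_ereal_mult_left del: plus_ereal.simps times_ereal.simps)
  show "Liminf F (\<lambda>s. ereal (2 * Y s - 1)) = ereal 2 * Liminf F (\<lambda>s. ereal (Y s)) + ereal (- 1)"
    unfolding * using F
    by (simp add: Liminf_add_ereal_right Liminf_ereal_mult_left del: plus_ereal.simps times_ereal.simps)
qed

section \<open>Tangent spaces of C1 hypersurfaces\<close>

text \<open>\<open>A b b'\<close> is the gradient at a mean value point of the segment from b' to b.
  That point lies in every ball around z containing both ends, so convergence holds with both points
  moving at once, whatever mean value point is chosen.\<close>

lemma C1_secant_normal:
  fixes G :: "'a::euclidean_space \<Rightarrow> 'a" and \<psi> :: "'a \<Rightarrow> real"
  assumes N: "open N" "z \<in> N"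
    and der: "\<And>y. y \<in> N \<Longrightarrow> (\<psi> has_derivative (\<lambda>h. G y \<bullet> h)) (at y)"
    and cont: "continuous_on N G"
  obtains A where "((\<lambda>p. A (fst p) (snd p)) \<longlongrightarrow> G z) (nhds (z, z))"
    and "\<forall>\<^sub>F p in nhds (z, z). A (fst p) (snd p) \<bullet> (fst p - snd p) = \<psi> (fst p) - \<psi> (snd p)"
proof -
  obtain d where d: "d > 0" "ball z d \<subseteq> N"
    using N by (auto simp: open_contains_ball)
  have "\<exists>c\<in>closed_segment b b'. G c \<bullet> (b - b') = \<psi> b - \<psi> b'"
    if bb: "b \<in> ball z d" "b' \<in> ball z d" for b b'
  proof -
    have seg: "b' + t *\<^sub>R (b - b') \<in> closed_segment b b'" if "t \<in> {0..1}" for t :: real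
      using that unfolding closed_segment_commute[of b]
      by (auto simp: in_segment algebra_simps intro!: exI[of _ t])
    have segN: "closed_segment b b' \<subseteq> N"
      using closed_segment_subset[OF bb convex_ball] d by blast
    have "\<exists>t\<in>{0<..<1::real}. \<psi> (b' + 1 *\<^sub>R (b - b')) - \<psi> (b' + 0 *\<^sub>R (b - b'))
        = (\<lambda>h. G (b' + t *\<^sub>R (b - b')) \<bullet> (h *\<^sub>R (b - b'))) (1 - 0)"
    proof (rule mvt_simple[of 0 1 "\<lambda>t. \<psi> (b' + t *\<^sub>R (b - b'))"])
      fix t :: real assume "0 \<le> t" "t \<le> 1"
      then have "b' + t *\<^sub>R (b - b') \<in> N" using seg segN by auto
      then show "((\<lambda>t. \<psi> (b' + t *\<^sub>R (b - b'))) has_derivative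
          (\<lambda>h. G (b' + t *\<^sub>R (b - b')) \<bullet> (h *\<^sub>R (b - b')))) (at t within {0..1})"
        by (intro has_derivative_compose[of "\<lambda>t. b' + t *\<^sub>R (b - b')" _ _ _ \<psi>, OF _ der])
           (auto intro!: derivative_eq_intros)
    qed simp
    then obtain t where "t \<in> {0<..<1::real}"
      "\<psi> b - \<psi> b' = G (b' + t *\<^sub>R (b - b')) \<bullet> (b - b')" by auto
    then show ?thesis using seg[of t] by (intro bexI[of _ "b' + t *\<^sub>R (b - b')"]) auto
  qed
  then obtain c where c: "\<And>b b'. b \<in> ball z d \<Longrightarrow> b' \<in> ball z d \<Longrightarrow>
      c b b' \<in> closed_segment b b' \<and> G (c b b') \<bullet> (b - b') = \<psi> b - \<psi> b'"
    by metis
  have "((\<lambda>p. c (fst p) (snd p)) \<longlongrightarrow> z) (nhds (z, z))"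
  proof (rule tendstoI)
    fix e :: real assume "e > 0"
    let ?r = "min d e"
    have "\<forall>\<^sub>F p in nhds (z, z). p \<in> ball z ?r \<times> ball z ?r"
      using d \<open>e > 0\<close> by (intro eventually_nhds_in_open open_Times) auto
    then show "\<forall>\<^sub>F p in nhds (z, z). dist (c (fst p) (snd p)) z < e"
    proof eventually_elim
      case (elim p)
      then have p: "fst p \<in> ball z d" "snd p \<in> ball z d" "fst p \<in> ball z e" "snd p \<in> ball z e"
        by auto
      have "c (fst p) (snd p) \<in> ball z e"
        using c[OF p(1,2)] closed_segment_subset[OF p(3,4) convex_ball] by blast
      then show ?case by (simp add: dist_commute)
    qed
  qed
  moreover have "(G \<longlongrightarrow> G z) (nhds z)"
    using cont N by (metis continuous_on_eq_continuous_at isCont_def tendsto_at_iff_tendsto_nhds)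
  ultimately have 1: "((\<lambda>p. G (c (fst p) (snd p))) \<longlongrightarrow> G z) (nhds (z, z))"
    by (metis filterlim_compose)
  have "\<forall>\<^sub>F p in nhds (z, z). p \<in> ball z d \<times> ball z d"
    using d by (intro eventually_nhds_in_open open_Times) auto
  then have 2: "\<forall>\<^sub>F p in nhds (z, z). G (c (fst p) (snd p)) \<bullet> (fst p - snd p) = \<psi> (fst p) - \<psi> (snd p)"
    by eventually_elim (use c in auto)
  show ?thesis by (rule that[of "\<lambda>b b'. G (c b b')"]) (use 1 2 in simp_all)
qed

text \<open>Chain rule along a curve in S. It is stated for subsets of a level set near z, so that
  it applies both to the boundary and to a horosphere known through one equation satisfied by its
  points.\<close>

lemma tangent_space_orthogonal:
  assumes "(\<psi> has_derivative (\<lambda>h. g \<bullet> h)) (at z)"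
    and "\<forall>\<^sub>F y in nhds z. y \<in> S \<longrightarrow> \<psi> y = c" and "\<psi> z = (c::real)"
    and "u \<in> tangent_space S z"
  shows "g \<bullet> u = 0"
proof -
  obtain \<gamma> where \<gamma>: "\<gamma> (0::real) = z" "(\<gamma> has_vector_derivative u) (at 0)"
    "\<forall>\<^sub>F s in at 0. \<gamma> s \<in> S"
    using assms(4) by (auto simp: tangent_space_def)
  have "((\<lambda>s. \<psi> (\<gamma> s)) has_derivative (\<lambda>h. g \<bullet> (h *\<^sub>R u))) (at 0)"
    using has_derivative_compose[of \<gamma> "\<lambda>h. h *\<^sub>R u" 0 UNIV \<psi> "\<lambda>h. g \<bullet> h"] \<gamma> assms(1)
    by (simp add: has_vector_derivative_def)
  moreover have "(\<gamma> \<longlongrightarrow> z) (at 0)"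
    using has_vector_derivative_continuous[OF \<gamma>(2)] \<gamma>(1) by (simp add: continuous_within)
  then have "\<forall>\<^sub>F s in at 0. \<gamma> s \<in> S \<longrightarrow> \<psi> (\<gamma> s) = c"
    using assms(2) by (rule eventually_compose_filterlim[rotated])
  with \<gamma>(3) have "\<forall>\<^sub>F s in at 0. \<psi> (\<gamma> s) = c" by eventually_elim simp
  ultimately have "((\<lambda>s. c) has_derivative (\<lambda>h. g \<bullet> (h *\<^sub>R u))) (at 0)"
    using has_derivative_transform_eventually[of "\<lambda>s. \<psi> (\<gamma> s)" "\<lambda>h. g \<bullet> (h *\<^sub>R u)" 0 UNIV "\<lambda>s. c"]
      \<gamma>(1) assms(3) by simp
  moreover have "((\<lambda>s. c) has_derivative (\<lambda>h. 0)) (at (0::real))" by simp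
  ultimately have "(\<lambda>h. g \<bullet> (h *\<^sub>R u)) = (\<lambda>h. 0)" by (rule has_derivative_unique)
  from fun_cong[OF this, of 1] show ?thesis by simp
qed

text \<open>Above each tangent vector \<open>s u\<close> the zero set is reached by the shortest shift along the
  gradient; the intermediate value theorem bounds that shift by \<open>o(s)\<close>.\<close>

lemma kernel_subset_tangent_space:
  fixes \<psi> :: "'a::euclidean_space \<Rightarrow> real"
  assumes N: "open N" "z \<in> N"
    and cont: "continuous_on N \<psi>"
    and der: "(\<psi> has_derivative (\<lambda>h. g \<bullet> h)) (at z)"
    and g: "g \<noteq> 0" and z: "\<psi> z = 0"
    and S: "\<And>y. y \<in> N \<Longrightarrow> \<psi> y = 0 \<Longrightarrow> y \<in> S"
    and u: "g \<bullet> u = 0"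
  shows "u \<in> tangent_space S z"
proof -
  define y where "y s c = z + s *\<^sub>R u + c *\<^sub>R g" for s c :: real
  obtain d where d: "d > 0" "cball z d \<subseteq> N"
    using N by (auto simp: open_contains_cball)
  have ex: "\<forall>\<^sub>F s in at 0. \<exists>c. \<bar>c\<bar> \<le> k * \<bar>s\<bar> \<and> y s c \<in> cball z d \<and> \<psi> (y s c) = 0" if k: "k > 0" for k
  proof -
    have gg: "g \<bullet> g > 0" using g by simp
    let ?L = "norm u + k * norm g + 1"
    have L: "?L > 0" using k by (simp add: add_nonneg_pos)
    \<comment> \<open>With this tolerance the linearisation error at distance \<bar>s\<bar>
      \<open>?L\<close> is half of k \<bar>s\<bar> (g \<bullet> g), the absolute value of the linear
      part at c = k \<bar>s\<bar> and at c = - k \<bar>s\<bar>; hence \<psi> changes sign between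
      these shifts.\<close>
    define e where "e = k * (g \<bullet> g) / (2 * ?L)"
    have e: "e > 0" using k gg L by (simp add: e_def)
    obtain \<delta> where \<delta>: "\<delta> > 0" "\<And>w. norm (w - z) < \<delta> \<Longrightarrow> norm (\<psi> w - \<psi> z - g \<bullet> (w - z)) \<le> e * norm (w - z)"
      using der e unfolding has_derivative_at_alt by meson
    have "\<forall>\<^sub>F s in at 0. \<bar>s\<bar> * ?L < min \<delta> d \<and> s \<noteq> 0"
    proof (intro eventually_conj)
      have "((\<lambda>s. \<bar>s\<bar> * ?L) \<longlongrightarrow> \<bar>0::real\<bar> * ?L) (at 0)" by (intro tendsto_intros)
      from order_tendstoD(2)[OF this, of "min \<delta> d"] \<delta> d
      show "\<forall>\<^sub>F s in at 0. \<bar>s\<bar> * ?L < min \<delta> d" by simp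
      show "\<forall>\<^sub>F s in at 0. s \<noteq> (0::real)" by (simp add: eventually_at_filter)
    qed
    then show ?thesis
    proof eventually_elim
      case (elim s)
      have near: "norm (y s c - z) \<le> \<bar>s\<bar> * ?L" if "\<bar>c\<bar> \<le> k * \<bar>s\<bar>" for c
      proof -
        have "norm (y s c - z) \<le> \<bar>s\<bar> * norm u + \<bar>c\<bar> * norm g"
          unfolding y_def by (rule norm_triangle_le[of "s *\<^sub>R u", THEN order_trans[rotated]])
             (auto simp: algebra_simps)
        also have "\<dots> \<le> \<bar>s\<bar> * norm u + (k * \<bar>s\<bar>) * norm g"
          using that by (intro add_left_mono mult_right_mono) auto
        also have "\<dots> \<le> \<bar>s\<bar> * ?L" by (simp add: algebra_simps)
        finally show ?thesis .
      qed
      have val: "\<bar>\<psi> (y s c) - c * (g \<bullet> g)\<bar> \<le> k * \<bar>s\<bar> * (g \<bullet> g) / 2" if "\<bar>c\<bar> \<le> k * \<bar>s\<bar>" for c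
      proof -
        have "norm (\<psi> (y s c) - \<psi> z - g \<bullet> (y s c - z)) \<le> e * norm (y s c - z)"
          using near[OF that] elim by (intro \<delta>(2)) linarith
        also have "\<dots> \<le> e * (\<bar>s\<bar> * ?L)" using near[OF that] e by (intro mult_left_mono) auto
        also have "\<dots> = (e * ?L) * \<bar>s\<bar>" by (simp only: mult_ac)
        also have "e * ?L = k * (g \<bullet> g) / 2"
          unfolding e_def using less_imp_neq[OF L] by (simp only: times_divide_eq_left) (simp add: divide_simps)
        also have "k * (g \<bullet> g) / 2 * \<bar>s\<bar> = k * \<bar>s\<bar> * (g \<bullet> g) / 2" by simp
        finally show ?thesis using u z by (simp add: y_def inner_add_right inner_diff_right)
      qed
      have k2: "k * \<bar>s\<bar> * (g \<bullet> g) > 0" using k gg elim by simp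
      have inb: "y s c \<in> cball z d" if "\<bar>c\<bar> \<le> k * \<bar>s\<bar>" for c
        using near[OF that] elim by (simp add: dist_norm norm_minus_commute)
      have "\<exists>c\<ge>- (k * \<bar>s\<bar>). c \<le> k * \<bar>s\<bar> \<and> \<psi> (y s c) = 0"
      proof (rule IVT')
        show "\<psi> (y s (- (k * \<bar>s\<bar>))) \<le> 0" "0 \<le> \<psi> (y s (k * \<bar>s\<bar>))"
          using val[of "- (k * \<bar>s\<bar>)"] val[of "k * \<bar>s\<bar>"] k2 k
          unfolding abs_le_iff by auto
        show "- (k * \<bar>s\<bar>) \<le> k * \<bar>s\<bar>" using k by simp
        show "continuous_on {- (k * \<bar>s\<bar>)..k * \<bar>s\<bar>} (\<lambda>c. \<psi> (y s c))"
        proof (rule continuous_on_compose2[OF cont])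
          show "continuous_on {- (k * \<bar>s\<bar>)..k * \<bar>s\<bar>} (y s)"
            unfolding y_def by (intro continuous_intros)
          show "y s ` {- (k * \<bar>s\<bar>)..k * \<bar>s\<bar>} \<subseteq> N"
            using inb d by (auto simp: abs_le_iff)
        qed
      qed
      then show ?case using inb by (auto simp: abs_le_iff)
    qed
  qed
  define Z where "Z s = {c. y s c \<in> cball z d \<and> \<psi> (y s c) = 0}" for s
  have min: "\<exists>c\<in>Z s. \<forall>c'\<in>Z s. \<bar>c\<bar> \<le> \<bar>c'\<bar>" if ne: "Z s \<noteq> {}" for s
  proof -
    obtain c0 where c0: "c0 \<in> Z s" using ne by blast
    have "continuous_on (y s -` cball z d) (\<lambda>c. \<psi> (y s c))"
      by (rule continuous_on_compose2[OF cont]) (use d in \<open>auto simp: y_def intro!: continuous_intros\<close>)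
    moreover have "closed (y s -` cball z d)"
      by (intro closed_vimage) (auto simp: y_def intro!: continuous_intros)
    ultimately have "closed (Z s)"
      unfolding Z_def using continuous_closed_preimage[of "y s -` cball z d" "\<lambda>c. \<psi> (y s c)" "{0}"]
      by (simp add: vimage_def Int_def)
    then have "compact (Z s \<inter> cball 0 \<bar>c0\<bar>)" by (intro closed_Int_compact) auto
    then obtain c where c: "c \<in> Z s \<inter> cball 0 \<bar>c0\<bar>" "\<forall>c'\<in>Z s \<inter> cball 0 \<bar>c0\<bar>. \<bar>c\<bar> \<le> \<bar>c'\<bar>"
      using continuous_attains_inf[of "Z s \<inter> cball 0 \<bar>c0\<bar>" abs] c0
      by (auto simp: continuous_on_rabs)
    show ?thesis
    proof (rule bexI[of _ c])
      show "\<forall>c'\<in>Z s. \<bar>c\<bar> \<le> \<bar>c'\<bar>"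
      proof
        fix c' assume "c' \<in> Z s"
        then show "\<bar>c\<bar> \<le> \<bar>c'\<bar>"
          using c by (cases "c' \<in> cball 0 \<bar>c0\<bar>") auto
      qed
    qed (use c in blast)
  qed
  \<comment> \<open>The zero found in \<open>ex\<close> depends on k. A zero of least modulus obeys
    the bounds k \<bar>s\<bar> for all k simultaneously, each for s close enough to 0, which makes
    the derivative of c at 0 vanish.\<close>
  define c where "c s = (if s = 0 then 0 else (SOME c. c \<in> Z s \<and> (\<forall>c'\<in>Z s. \<bar>c\<bar> \<le> \<bar>c'\<bar>)))" for s
  have cs: "c s \<in> Z s \<and> (\<forall>c'\<in>Z s. \<bar>c s\<bar> \<le> \<bar>c'\<bar>)" if "Z s \<noteq> {}" "s \<noteq> 0" for s
    using someI_ex[of "\<lambda>c. c \<in> Z s \<and> (\<forall>c'\<in>Z s. \<bar>c\<bar> \<le> \<bar>c'\<bar>)"] min[OF that(1)] that(2)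
    by (auto simp: c_def)
  have ev: "\<forall>\<^sub>F s in at 0. \<bar>c s\<bar> \<le> k * \<bar>s\<bar> \<and> y s (c s) \<in> S" if k: "k > 0" for k
  proof -
    have "\<forall>\<^sub>F s in at 0. s \<noteq> (0::real)" by (simp add: eventually_at_filter)
    with ex[OF k] show ?thesis
    proof eventually_elim
      case (elim s)
      then obtain c' where c': "\<bar>c'\<bar> \<le> k * \<bar>s\<bar>" "c' \<in> Z s" by (auto simp: Z_def)
      then have "c s \<in> Z s" "\<bar>c s\<bar> \<le> \<bar>c'\<bar>" using cs[of s] elim by auto
      then show ?case using c' S d by (auto simp: Z_def)
    qed
  qed
  define \<gamma> where "\<gamma> s = y s (c s)" for s
  have "((\<lambda>s. c s / s) \<longlongrightarrow> 0) (at 0)"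
  proof (rule tendstoI)
    fix e :: real assume "e > 0"
    then have "\<forall>\<^sub>F s in at 0. \<bar>c s\<bar> \<le> e / 2 * \<bar>s\<bar> \<and> y s (c s) \<in> S" by (intro ev) simp
    moreover have "\<forall>\<^sub>F s in at 0. s \<noteq> (0::real)" by (simp add: eventually_at_filter)
    ultimately show "\<forall>\<^sub>F s in at 0. dist (c s / s) 0 < e"
    proof eventually_elim
      case (elim s)
      then have "\<bar>c s\<bar> / \<bar>s\<bar> \<le> e / 2" by (simp add: pos_divide_le_eq)
      then have "\<bar>c s / s\<bar> \<le> e / 2" by simp
      then show ?case using \<open>e > 0\<close> unfolding dist_real_def by linarith
    qed
  qed
  then have "(c has_field_derivative 0) (at 0)"
    by (simp add: has_field_derivative_iff c_def)
  then have "(\<gamma> has_vector_derivative (1 *\<^sub>R u + 0 *\<^sub>R g)) (at 0)"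
    unfolding \<gamma>_def y_def
    by (auto intro!: derivative_eq_intros simp: has_real_derivative_iff_has_vector_derivative)
  moreover have "\<gamma> 0 = z" by (simp add: \<gamma>_def y_def c_def)
  moreover have "\<forall>\<^sub>F s in at 0. \<gamma> s \<in> S"
    using ev[of 1] by (auto simp: \<gamma>_def elim: eventually_mono)
  ultimately show ?thesis by (auto simp: tangent_space_def)
qed

text \<open>On S the defining function vanishes, so its secant gradients are orthogonal to chords of
  S. Later limits use A instead of \<psi>: it yields the derivative of \<open>depth\<close> and the
  Busemann function from exact identities between two boundary points.\<close>

lemma C1_hypersurface_normal:
  fixes S :: "'a::euclidean_space set"
  assumes "C1_hypersurface S" "z \<in> S"
  obtains g A where "g \<noteq> 0" "tangent_space S z = {u. g \<bullet> u = 0}"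
    and "((\<lambda>p. A (fst p) (snd p)) \<longlongrightarrow> g) (nhds (z, z))"
    and "\<forall>\<^sub>F p in nhds (z, z). fst p \<in> S \<longrightarrow> snd p \<in> S \<longrightarrow> A (fst p) (snd p) \<bullet> (fst p - snd p) = 0"
proof -
  from bspec[OF assms(1)[unfolded C1_hypersurface_def] assms(2)]
  obtain N \<psi> G where *: "open N \<and> z \<in> N \<and>
        (\<forall>y\<in>N. ((\<psi> :: 'a \<Rightarrow> real) has_derivative (\<lambda>h. G y \<bullet> h)) (at y)) \<and>
        continuous_on N G \<and> (\<forall>y\<in>N. G y \<noteq> 0) \<and> S \<inter> N = {y \<in> N. \<psi> y = 0}"
    by (elim exE)
  then have N: "open N" "z \<in> N"
    and der: "\<And>y. y \<in> N \<Longrightarrow> (\<psi> has_derivative (\<lambda>h. G y \<bullet> h)) (at y)"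
    and G: "continuous_on N G" "\<And>y. y \<in> N \<Longrightarrow> G y \<noteq> 0" and S: "S \<inter> N = {y \<in> N. \<psi> y = 0}"
    by simp_all
  obtain A where A: "((\<lambda>p. A (fst p) (snd p)) \<longlongrightarrow> G z) (nhds (z, z))"
    "\<forall>\<^sub>F p in nhds (z, z). A (fst p) (snd p) \<bullet> (fst p - snd p) = \<psi> (fst p) - \<psi> (snd p)"
    by (rule C1_secant_normal[OF N der G(1)])
  have SN: "\<psi> y = 0" if "y \<in> S" "y \<in> N" for y using S that by blast
  have "\<forall>\<^sub>F p in nhds (z, z). p \<in> N \<times> N"
    using N by (intro eventually_nhds_in_open open_Times) auto
  with A(2) have sec: "\<forall>\<^sub>F p in nhds (z, z). fst p \<in> S \<longrightarrow> snd p \<in> S \<longrightarrow>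
      A (fst p) (snd p) \<bullet> (fst p - snd p) = 0"
    by eventually_elim (auto simp: SN)
  have z: "\<psi> z = 0" using S N assms by blast
  have "\<forall>\<^sub>F y in nhds z. y \<in> S \<longrightarrow> \<psi> y = 0"
    using eventually_nhds_in_open[OF N] by eventually_elim (auto simp: SN)
  then have 1: "G z \<bullet> u = 0" if "u \<in> tangent_space S z" for u
    using tangent_space_orthogonal[OF der[OF N(2)] _ z that] by simp
  have "continuous_on N \<psi>"
    using der by (meson continuous_at_imp_continuous_on has_derivative_continuous)
  then have 2: "u \<in> tangent_space S z" if "G z \<bullet> u = 0" for u
    using kernel_subset_tangent_space[OF N _ der[OF N(2)] G(2)[OF N(2)] z _ that, of S] S by blast
  show ?thesis
  proof (rule that[of "G z" A])
    show "tangent_space S z = {u. G z \<bullet> u = 0}" using 1 2 by blast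
  qed (fact G(2)[OF N(2)], fact A(1), fact sec)
qed

section \<open>Affine charts and their transitions\<close>

lemma affine_chartD:
  assumes "affine_chart L"
  shows "linear L" "linear (inv L)" "L (inv L w) = w" "inv L (L w) = w"
  using assms
  by (auto simp: affine_chart_def bij_def surj_f_inv_f intro: inj_linear_imp_inv_linear)

lemma chart_dom_span_iff:
  assumes "affine_chart L" "w \<noteq> 0"
  shows "span {w} \<in> chart_dom L \<longleftrightarrow> snd (L w) \<noteq> 0"
proof -
  have "span {w} \<in> proj_space" using assms(2) unfolding proj_space_def by blast
  moreover have "(\<exists>v\<in>span {w}. snd (L v) \<noteq> 0) \<longleftrightarrow> snd (L w) \<noteq> 0"
    using linear_cmul[OF affine_chartD(1)[OF assms(1)]]
    by (auto simp: span_singleton intro: exI[of _ "1::real"])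
  ultimately show ?thesis by (simp add: chart_dom_def)
qed

lemma topspace_proj_topology: "topspace proj_topology = proj_space"
proof -
  have "{w::'a. w \<noteq> 0 \<and> span {w} \<in> proj_space} = - {0}"
    by (auto simp: proj_space_def)
  then have "openin proj_topology (proj_space :: 'a set set)"
    unfolding openin_proj_topology by (simp only: open_Compl[OF closed_singleton] order_refl simp_thms)
  moreover have "topspace (proj_topology :: 'a set topology) \<subseteq> proj_space"
    using openin_topspace openin_proj_topology by blast
  ultimately show ?thesis using openin_subset by blast
qed

text \<open>Invariance under nonzero scalars makes U its own full preimage under the map from
  vectors to lines.\<close>

lemma openin_proj_cone:
  fixes U :: "'v::euclidean_space set"
  assumes "open U" "0 \<notin> U" and cone: "\<And>w c. w \<in> U \<Longrightarrow> c \<noteq> 0 \<Longrightarrow> c *\<^sub>R w \<in> U"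
  shows "openin proj_topology ((\<lambda>w. span {w}) ` U)"
proof -
  have "w \<in> U" if w: "w \<noteq> 0" "span {w} = span {w'}" "w' \<in> U" for w w'
  proof -
    have "w \<in> span {w'}" using w(2) by (metis insertI1 span_base)
    then obtain c where "w = c *\<^sub>R w'" by (auto simp: span_singleton)
    then show ?thesis using cone[OF w(3)] w(1) by auto
  qed
  then have "{w. w \<noteq> 0 \<and> span {w} \<in> (\<lambda>w. span {w}) ` U} = U"
    using assms(2) by auto
  moreover have "(\<lambda>w. span {w}) ` U \<subseteq> proj_space"
    using assms(2) unfolding proj_space_def by blast
  ultimately show ?thesis using assms(1) by (simp add: openin_proj_topology)
qed

lemma chart_inv_nonzero:
  assumes "affine_chart L"
  shows "inv L (y, 1) \<noteq> 0"
proof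
  assume "inv L (y, 1) = 0"
  then have "L 0 = (y, 1)" using affine_chartD(3)[OF assms, of "(y, 1)"] by simp
  then show False using linear_0[OF affine_chartD(1)[OF assms]] by (simp add: zero_prod_def)
qed

lemma chart_inv_in_chart_dom:
  assumes "affine_chart L"
  shows "chart_inv L y \<in> chart_dom L"
  unfolding chart_inv_def
  using assms by (simp add: chart_dom_span_iff chart_inv_nonzero affine_chartD(3))

lemma chart_map_chart_inv:
  assumes "affine_chart L"
  shows "chart_map L (chart_inv L y) = y"
  unfolding chart_inv_def
  by (subst chart_map_span[OF assms]) (simp_all add: affine_chartD(3)[OF assms])

lemma chart_inv_chart_map:
  assumes L: "affine_chart L" and P: "P \<in> chart_dom L"
  shows "chart_inv L (chart_map L P) = P"
proof -
  obtain w w' where w: "P = span {w}" "w' \<in> P" "snd (L w') \<noteq> 0"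
    using P by (auto simp: chart_dom_def proj_space_def)
  then obtain c where "w' = c *\<^sub>R w" by (auto simp: span_singleton)
  then have s: "snd (L w) \<noteq> 0"
    using w(3) by (auto simp: linear_cmul[OF affine_chartD(1)[OF L]])
  have "inv L (chart_map L P, 1) = inv L (inverse (snd (L w)) *\<^sub>R L w)"
    using s by (simp add: w(1) chart_map_span[OF L s] prod_eq_iff scaleR_prod_def)
  also have "\<dots> = inverse (snd (L w)) *\<^sub>R w"
    by (simp add: linear_cmul[OF affine_chartD(2)[OF L]] affine_chartD(4)[OF L])
  finally have "inv L (chart_map L P, 1) = inverse (snd (L w)) *\<^sub>R w" .
  moreover have "span {c *\<^sub>R w} = span {w}" if c: "c \<noteq> 0" for c
  proof -
    have "w = inverse c *\<^sub>R (c *\<^sub>R w)" using c by simp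
    then show ?thesis unfolding span_eq by (metis empty_subsetI insert_subset insertI1 span_base span_scale)
  qed
  ultimately show ?thesis
    using s unfolding chart_inv_def w(1) by simp
qed

text \<open>The preimage form reduces openness and closure of chart images to the continuity and
  openness of \<open>chart_inv\<close>.\<close>

lemma chart_image_eq:
  assumes "affine_chart L"
  shows "chart_image L S = {y. chart_inv L y \<in> S}"
proof (intro equalityI subsetI CollectI)
  fix y assume "y \<in> chart_image L S"
  then show "chart_inv L y \<in> S"
    using chart_inv_chart_map[OF assms] by (auto simp: chart_image_def)
next
  fix y assume "y \<in> {y. chart_inv L y \<in> S}"
  then show "y \<in> chart_image L S"
    unfolding chart_image_def
    by (intro image_eqI[of _ _ "chart_inv L y"])
       (simp_all add: chart_map_chart_inv[OF assms] chart_inv_in_chart_dom[OF assms])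
qed

lemma chart_map_in_chart_image:
  assumes "affine_chart L" "P \<in> chart_dom L"
  shows "chart_map L P \<in> chart_image L S \<longleftrightarrow> P \<in> S"
  using assms by (simp add: chart_image_eq chart_inv_chart_map)

lemma open_chart_inv_vimage:
  assumes L: "affine_chart L" and U: "openin proj_topology U"
  shows "open {y. chart_inv L y \<in> U}"
proof -
  have "{y. chart_inv L y \<in> U} = (\<lambda>y. inv L (y, 1)) -` {w. w \<noteq> 0 \<and> span {w} \<in> U}"
    using chart_inv_nonzero[OF L] by (auto simp: chart_inv_def)
  moreover have "continuous_on UNIV (\<lambda>y. inv L (y, 1))"
  proof (rule continuous_on_compose2[of UNIV "inv L"])
    show "continuous_on UNIV (inv L)"
      using affine_chartD(2)[OF L] by (simp add: linear_continuous_on linear_conv_bounded_linear)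
  qed (auto intro!: continuous_intros)
  moreover have "open {w. w \<noteq> 0 \<and> span {w} \<in> U}"
    using U unfolding openin_proj_topology by (rule conjunct2)
  ultimately show ?thesis by (simp only: open_vimage)
qed

lemma openin_chart_inv_image:
  assumes L: "affine_chart L" and V: "open V"
  shows "openin proj_topology (chart_inv L ` V)"
proof -
  let ?U = "{w. snd (L w) \<noteq> 0 \<and> fst (L w) /\<^sub>R snd (L w) \<in> V}"
  have lin: "linear L" using affine_chartD(1)[OF L] .
  then have cL: "continuous_on A L" for A
    by (simp add: linear_continuous_on linear_conv_bounded_linear)
  have o: "open {w. snd (L w) \<noteq> 0}"
    by (intro open_Collect_neq continuous_intros cL)
  have "continuous_on {w. snd (L w) \<noteq> 0} (\<lambda>w. fst (L w) /\<^sub>R snd (L w))"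
    by (intro continuous_intros cL) auto
  then have "open ((\<lambda>w. fst (L w) /\<^sub>R snd (L w)) -` V \<inter> {w. snd (L w) \<noteq> 0})"
    using o V by (simp add: continuous_on_open_vimage)
  also have "(\<lambda>w. fst (L w) /\<^sub>R snd (L w)) -` V \<inter> {w. snd (L w) \<noteq> 0} = ?U" by auto
  finally have "openin proj_topology ((\<lambda>w. span {w}) ` ?U)"
  proof (rule openin_proj_cone)
    fix w c assume w: "w \<in> ?U" and c: "c \<noteq> (0::real)"
    have "fst (L (c *\<^sub>R w)) /\<^sub>R snd (L (c *\<^sub>R w)) = fst (L w) /\<^sub>R snd (L w)"
      using c by (simp add: linear_cmul[OF lin] field_simps)
    then have "fst (L (c *\<^sub>R w)) /\<^sub>R snd (L (c *\<^sub>R w)) \<in> V" using w by (metis (mono_tags, lifting) mem_Collect_eq)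
    moreover have "snd (L (c *\<^sub>R w)) \<noteq> 0" using w c by (simp add: linear_cmul[OF lin])
    ultimately show "c *\<^sub>R w \<in> ?U" by blast
  qed (simp add: linear_0[OF lin])
  moreover have "(\<lambda>w. span {w}) ` ?U = chart_inv L ` V"
  proof (intro equalityI subsetI)
    fix P assume "P \<in> (\<lambda>w. span {w}) ` ?U"
    then obtain w where w: "P = span {w}" "w \<in> ?U" by auto
    then have "w \<noteq> 0" using linear_0[OF lin] by auto
    then have "P \<in> chart_dom L"
      using w chart_dom_span_iff[OF L] by simp
    then have "P = chart_inv L (fst (L w) /\<^sub>R snd (L w))"
      using w chart_inv_chart_map[OF L, of P] chart_map_span[OF L, of w] by simp
    then show "P \<in> chart_inv L ` V" using w by simp
  next
    fix P assume "P \<in> chart_inv L ` V"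
    then obtain y where "y \<in> V" "P = span {inv L (y, 1)}" by (auto simp: chart_inv_def)
    then show "P \<in> (\<lambda>w. span {w}) ` ?U"
      by (intro image_eqI[of _ _ "inv L (y, 1)"]) (simp_all add: affine_chartD(3)[OF L])
  qed
  ultimately show ?thesis by (simp only:)
qed

lemma chart_inv_in_closure_of:
  assumes L: "affine_chart L"
  shows "chart_inv L y \<in> proj_topology closure_of S \<longleftrightarrow> y \<in> closure {y. chart_inv L y \<in> S}"
proof
  assume c: "chart_inv L y \<in> proj_topology closure_of S"
  show "y \<in> closure {y. chart_inv L y \<in> S}"
    unfolding closure_iff_nhds_not_empty
  proof (intro allI impI)
    fix A V assume V: "V \<subseteq> A" "open V" "y \<in> V"
    have "\<forall>T. chart_inv L y \<in> T \<and> openin proj_topology T \<longrightarrow> (\<exists>P. P \<in> S \<and> P \<in> T)"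
      using c unfolding in_closure_of by (rule conjunct2)
    from this[rule_format, of "chart_inv L ` V"] openin_chart_inv_image[OF L V(2)] V(3)
    have "\<exists>P. P \<in> S \<and> P \<in> chart_inv L ` V" by simp
    then show "{y. chart_inv L y \<in> S} \<inter> A \<noteq> {}" using V by auto
  qed
next
  assume c: "y \<in> closure {y. chart_inv L y \<in> S}"
  have "\<exists>P. P \<in> S \<and> P \<in> U" if U: "chart_inv L y \<in> U" "openin proj_topology U" for U
  proof -
    have "{y. chart_inv L y \<in> S} \<inter> {y. chart_inv L y \<in> U} \<noteq> {}"
      using c[unfolded closure_iff_nhds_not_empty, rule_format, OF order_refl
          open_chart_inv_vimage[OF L U(2)]] U(1) by simp
    then show ?thesis by auto
  qed
  then have "\<forall>U. chart_inv L y \<in> U \<and> openin proj_topology U \<longrightarrow> (\<exists>P. P \<in> S \<and> P \<in> U)"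
    by (intro allI impI) (elim conjE)
  moreover have "chart_inv L y \<in> topspace proj_topology"
    using chart_inv_in_chart_dom[OF L, of y] unfolding topspace_proj_topology chart_dom_def by blast
  ultimately show "chart_inv L y \<in> proj_topology closure_of S"
    unfolding in_closure_of by (intro conjI)
qed

text \<open>A frontier is the intersection of the closures of a set and its complement, and closures
  pull back along \<open>chart_inv\<close>, which is continuous and open.\<close>

lemma chart_image_proj_boundary:
  assumes L: "affine_chart L"
  shows "chart_image L (proj_boundary S) = frontier (chart_image L S)"
proof -
  have t: "chart_inv L y \<in> topspace proj_topology" for y
    using chart_inv_in_chart_dom[OF L, of y] unfolding topspace_proj_topology chart_dom_def by blast
  have *: "- {y. chart_inv L y \<in> S} = {y. chart_inv L y \<in> topspace proj_topology - S}"
    using t by auto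
  have "frontier (chart_image L S)
      = closure {y. chart_inv L y \<in> S} \<inter> closure {y. chart_inv L y \<in> topspace proj_topology - S}"
    unfolding chart_image_eq[OF L] frontier_closures * ..
  also have "\<dots> = {y. chart_inv L y \<in> proj_topology closure_of S}
      \<inter> {y. chart_inv L y \<in> proj_topology closure_of (topspace proj_topology - S)}"
    unfolding chart_inv_in_closure_of[OF L] by (simp only: Collect_mem_eq)
  also have "\<dots> = chart_image L (proj_boundary S)"
    unfolding chart_image_eq[OF L] frontier_of_closures by (simp only: Int_iff Collect_conj_eq)
  finally show ?thesis ..
qed

lemma open_chart_image:
  assumes "affine_chart L" "openin proj_topology S"
  shows "open (chart_image L S)"
  using assms by (simp add: chart_image_eq open_chart_inv_vimage)

text \<open>If K bounds the chart image, the cone K \<bar>snd (L w)\<bar> < norm (fst (L w)) gives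
  an open neighbourhood of the hyperplane at infinity that misses S; a boundary point at infinity
  could not be approached from S.\<close>

lemma proj_boundary_subset_chart_dom:
  assumes "bounded_chart S L"
  shows "proj_boundary S \<subseteq> chart_dom L"
proof (rule subsetI)
  fix X assume "X \<in> proj_boundary S"
  then have X: "X \<in> proj_topology closure_of S" unfolding frontier_of_def by (rule DiffD1)
  then have "X \<in> proj_space" unfolding in_closure_of topspace_proj_topology by (rule conjunct1)
  then obtain w where w: "X = span {w}" "w \<noteq> 0" unfolding proj_space_def by blast
  have L: "affine_chart L" and S: "S \<subseteq> chart_dom L" using assms by (auto simp: bounded_chart_def)
  have lin: "linear L" using affine_chartD(1)[OF L] .
  obtain K where K: "\<And>y. y \<in> chart_image L S \<Longrightarrow> norm y \<le> K" and K0: "K > 0"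
    using assms by (auto simp: bounded_chart_def bounded_pos)
  let ?U = "{w. K * \<bar>snd (L w)\<bar> < norm (fst (L w))}"
  have cL: "continuous_on A L" for A
    using lin by (simp add: linear_continuous_on linear_conv_bounded_linear)
  have "snd (L w) \<noteq> 0"
  proof
    assume 0: "snd (L w) = 0"
    have "L w \<noteq> 0" using w(2) affine_chartD(4)[OF L, of w] linear_0[OF affine_chartD(2)[OF L]] by metis
    then have "w \<in> ?U" using 0 by (simp add: prod_eq_iff)
    moreover have "openin proj_topology ((\<lambda>w. span {w}) ` ?U)"
    proof (rule openin_proj_cone)
      show "open ?U" by (intro open_Collect_less continuous_intros cL)
    next
      fix v c assume v: "v \<in> ?U" and c: "c \<noteq> (0::real)"
      have "\<bar>c\<bar> * (K * \<bar>snd (L v)\<bar>) < \<bar>c\<bar> * norm (fst (L v))"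
        using v c by (intro mult_strict_left_mono) auto
      then show "c *\<^sub>R v \<in> ?U" by (simp add: linear_cmul[OF lin] abs_mult mult_ac)
    qed (simp add: linear_0[OF lin])
    moreover have "\<forall>T. X \<in> T \<and> openin proj_topology T \<longrightarrow> (\<exists>P. P \<in> S \<and> P \<in> T)"
      using X unfolding in_closure_of by (rule conjunct2)
    ultimately have "\<exists>P. P \<in> S \<and> P \<in> (\<lambda>w. span {w}) ` ?U"
      unfolding w(1) by (meson imageI)
    then obtain P w' where P: "P \<in> S" and w': "P = span {w'}" "w' \<in> ?U" by (elim exE conjE imageE)
    have "\<exists>v\<in>P. snd (L v) \<noteq> 0" using P S unfolding chart_dom_def by blast
    then have s: "snd (L w') \<noteq> 0"
      unfolding w'(1) by (auto simp: span_singleton linear_cmul[OF lin])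
    have "chart_map L P \<in> chart_image L S" using P S by (auto simp: chart_image_def)
    then have "norm (fst (L w') /\<^sub>R snd (L w')) \<le> K"
      using K unfolding w'(1) chart_map_span[OF L s] by blast
    moreover have "norm (fst (L w') /\<^sub>R snd (L w')) = norm (fst (L w')) / \<bar>snd (L w')\<bar>"
      by (simp add: divide_inverse)
    ultimately show False using w'(2) s by (simp add: pos_divide_le_eq)
  qed
  then show "X \<in> chart_dom L"
    using w chart_dom_span_iff[OF L] by simp
qed

text \<open>Convexity is given in some bounded chart, while the flow is studied in another. The
  change is a quotient n / d of affine functions; d has no zero on the convex set, hence a constant
  sign there, and then segments go to segments with rescaled weights.\<close>

lemma convex_chart_image:
  assumes L: "affine_chart L" "S \<subseteq> chart_dom L" and con: "convex (chart_image L S)"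
    and B: "affine_chart B" "S \<subseteq> chart_dom B"
  shows "convex (chart_image B S)"
proof -
  define M where "M w = B (inv L w)" for w
  have M: "linear M"
    using linear_compose[OF affine_chartD(2)[OF L(1)] affine_chartD(1)[OF B(1)]]
    by (simp add: M_def[abs_def] comp_def)
  let ?D = "chart_image L S"
  let ?d = "\<lambda>y. snd (M (y, 1))" and ?n = "\<lambda>y. fst (M (y, 1))"
  have D: "y \<in> ?D \<longleftrightarrow> span {inv L (y, 1)} \<in> S" for y
    using L by (simp add: chart_image_eq chart_inv_def)
  have d0: "?d y \<noteq> 0" if "y \<in> ?D" for y
    using that B chart_dom_span_iff[OF B(1) chart_inv_nonzero[OF L(1)]]
    by (auto simp: D M_def)
  have img: "chart_image B S = (\<lambda>y. ?n y /\<^sub>R ?d y) ` ?D"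
  proof -
    have *: "chart_map B (chart_inv L y) = ?n y /\<^sub>R ?d y" if "y \<in> ?D" for y
      using chart_map_span[OF B(1), of "inv L (y, 1)"] d0[OF that]
      by (simp add: chart_inv_def M_def)
    have "S = chart_inv L ` ?D"
      using L chart_inv_chart_map[OF L(1)] by (force simp: chart_image_eq image_iff)
    then have "chart_image B S = chart_map B ` chart_inv L ` ?D"
      using B by (metis chart_image_def inf.absorb1)
    then show ?thesis using * by (simp add: image_image)
  qed
  have comb: "M ((1 - t) *\<^sub>R a + t *\<^sub>R b, 1) = (1 - t) *\<^sub>R M (a, 1) + t *\<^sub>R M (b, 1)" for a b t
  proof -
    have "((1 - t) *\<^sub>R a + t *\<^sub>R b, 1::real) = (1 - t) *\<^sub>R (a, 1) + t *\<^sub>R (b, 1)"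
      by (simp add: scaleR_prod_def)
    then show ?thesis by (simp only: linear_add[OF M] linear_cmul[OF M])
  qed
  have pos: "?d a * ?d b > 0" if ab: "a \<in> ?D" "b \<in> ?D" for a b
  proof (rule ccontr)
    assume "\<not> ?d a * ?d b > 0"
    then have neg: "?d a * ?d b < 0" using d0 ab by (metis linorder_neqE mult_eq_0_iff)
    \<comment> \<open>The parameter at which d, affine along the segment from a to b, vanishes if
      its values at the ends have opposite signs.\<close>
    define t where "t = ?d a / (?d a - ?d b)"
    have ne: "?d a - ?d b \<noteq> 0" using neg by (auto simp: mult_less_0_iff)
    have t: "0 \<le> t" "t \<le> 1"
      using neg unfolding t_def by (auto simp: mult_less_0_iff divide_simps)
    then have "(1 - t) *\<^sub>R a + t *\<^sub>R b \<in> ?D"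
      using con ab by (simp add: convex_alt)
    moreover have "?d ((1 - t) *\<^sub>R a + t *\<^sub>R b) = 0"
      unfolding comb using ne by (simp add: t_def divide_simps)
    ultimately show False using d0 by blast
  qed
  show ?thesis
    unfolding img convex_alt
  proof (intro ballI allI impI, elim imageE)
    fix p q t a b
    assume t: "0 \<le> t \<and> t \<le> (1::real)" and ab: "a \<in> ?D" "b \<in> ?D"
      and pq: "p = ?n a /\<^sub>R ?d a" "q = ?n b /\<^sub>R ?d b"
    have nz: "?d a \<noteq> 0" "?d b \<noteq> 0" using d0 ab by auto
    \<comment> \<open>In homogeneous coordinates (1 - t) p + t q is \<alpha> n(a) + \<beta> n(b).
      Dividing \<alpha> and \<beta> by their sum \<sigma> gives the weights of the preimage on the
      segment from a to b, where d takes the value 1 / \<sigma>.\<close>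
    define \<alpha> \<beta> \<sigma> where "\<alpha> = (1 - t) / ?d a" "\<beta> = t / ?d b" "\<sigma> = \<alpha> + \<beta>"
    define r where "r = \<beta> / \<sigma>"
    have \<alpha>: "\<alpha> * ?d a = 1 - t" and \<beta>: "\<beta> * ?d b = t" "\<beta> * ?d a = t * (?d a / ?d b)"
      using nz by (simp_all add: \<alpha>_\<beta>_\<sigma>_def)
    have ratio: "?d a / ?d b > 0"
      using pos[OF ab] by (simp add: zero_less_divide_iff zero_less_mult_iff)
    have \<sigma>: "\<sigma> * ?d a = (1 - t) + t * (?d a / ?d b)"
      unfolding \<alpha>_\<beta>_\<sigma>_def(3) distrib_right \<alpha> \<beta>(2) ..
    also have "\<dots> > 0"
      using t mult_pos_pos[OF _ ratio, of t] by (cases "t = 0") auto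
    finally have \<sigma>a: "\<sigma> * ?d a > 0" .
    then have \<sigma>0: "\<sigma> \<noteq> 0" by auto
    have r: "1 - r = \<alpha> / \<sigma>" "\<sigma> * (1 - r) = \<alpha>" "\<sigma> * r = \<beta>"
    proof -
      have "1 - r = (\<sigma> - \<beta>) / \<sigma>" unfolding r_def diff_divide_distrib using \<sigma>0 by simp
      also have "\<sigma> - \<beta> = \<alpha>" by (simp add: \<alpha>_\<beta>_\<sigma>_def(3))
      finally show "1 - r = \<alpha> / \<sigma>" .
      then show "\<sigma> * (1 - r) = \<alpha>" "\<sigma> * r = \<beta>" unfolding r_def using \<sigma>0 by simp_all
    qed
    have "r = (\<beta> * ?d a) / (\<sigma> * ?d a)" "1 - r = (\<alpha> * ?d a) / (\<sigma> * ?d a)"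
      using nz unfolding r(1) unfolding r_def by simp_all
    moreover have "0 \<le> t * (?d a / ?d b)" using t ratio by (intro mult_nonneg_nonneg) auto
    ultimately have "0 \<le> r" "0 \<le> 1 - r"
      unfolding \<alpha> \<beta>(2) using \<sigma>a t by (metis divide_nonneg_pos, simp)
    then have y: "(1 - r) *\<^sub>R a + r *\<^sub>R b \<in> ?D"
      using con ab by (simp add: convex_alt)
    let ?y = "(1 - r) *\<^sub>R a + r *\<^sub>R b"
    have "\<sigma> * ?d ?y = \<sigma> * (1 - r) * ?d a + \<sigma> * r * ?d b"
      unfolding comb by (simp add: distrib_left)
    also have "\<dots> = 1" unfolding r(2,3) \<alpha> \<beta>(1) by simp
    finally have dy: "?d ?y = 1 / \<sigma>" using \<sigma>0 by (simp add: field_simps)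
    have "?n ?y /\<^sub>R ?d ?y = \<sigma> *\<^sub>R ((1 - r) *\<^sub>R ?n a + r *\<^sub>R ?n b)"
      unfolding dy by (simp add: comb)
    also have "\<dots> = \<alpha> *\<^sub>R ?n a + \<beta> *\<^sub>R ?n b"
      unfolding scaleR_add_right scaleR_scaleR r(2,3) ..
    also have "\<dots> = (1 - t) *\<^sub>R p + t *\<^sub>R q"
      by (simp add: pq \<alpha>_\<beta>_\<sigma>_def divide_inverse)
    finally have "(1 - t) *\<^sub>R p + t *\<^sub>R q = ?n ?y /\<^sub>R ?d ?y" ..
    then show "(1 - t) *\<^sub>R p + t *\<^sub>R q \<in> (\<lambda>y. ?n y /\<^sub>R ?d y) ` ?D"
      using y by (rule image_eqI)
  qed
qed

text \<open>Homogeneous coordinates keep a change of chart linear: points enter as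
  \<open>(y, 1)\<close>, directions as \<open>(h, 0)\<close>, and the last coordinate of the image
  is the projective factor.\<close>

definition transition :: "('a::euclidean_space \<times> real \<Rightarrow> 'a \<times> real) \<Rightarrow> ('a \<times> real \<Rightarrow> 'a \<times> real)
    \<Rightarrow> 'a \<times> real \<Rightarrow> 'a \<times> real" where
  "transition B C w = C (inv B w)"

lemma linear_transition:
  assumes "affine_chart B" "affine_chart C"
  shows "linear (transition B C)"
  using linear_compose[OF affine_chartD(2)[OF assms(1)] affine_chartD(1)[OF assms(2)]]
  by (simp add: transition_def[abs_def] comp_def)

lemma transition_inverse:
  assumes "affine_chart B" "affine_chart C"
  shows "transition C B (transition B C w) = w"
  by (simp add: transition_def affine_chartD(3)[OF assms(1)] affine_chartD(4)[OF assms(2)])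

lemma chart_inv_in_dom_iff:
  assumes "affine_chart B" "affine_chart C"
  shows "chart_inv B y \<in> chart_dom C \<longleftrightarrow> snd (transition B C (y, 1)) \<noteq> 0"
  by (simp add: chart_inv_def transition_def chart_dom_span_iff[OF assms(2) chart_inv_nonzero[OF assms(1)]])

lemma transition_chart_map:
  assumes BC: "affine_chart B" "affine_chart C" and P: "P \<in> chart_dom B" "P \<in> chart_dom C"
  shows "snd (transition B C (chart_map B P, 1)) \<noteq> 0"
    and "transition B C (chart_map B P, 1) = snd (transition B C (chart_map B P, 1)) *\<^sub>R (chart_map C P, 1)"
proof -
  have Pi: "chart_inv B (chart_map B P) = P" by (rule chart_inv_chart_map[OF BC(1) P(1)])
  show nz: "snd (transition B C (chart_map B P, 1)) \<noteq> 0"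
    using chart_inv_in_dom_iff[OF BC, of "chart_map B P"] P(2) unfolding Pi by simp
  then have "chart_map C P = fst (transition B C (chart_map B P, 1)) /\<^sub>R snd (transition B C (chart_map B P, 1))"
    using chart_map_span[OF BC(2), of "inv B (chart_map B P, 1)"] Pi
    by (simp add: chart_inv_def transition_def)
  then show "transition B C (chart_map B P, 1) = snd (transition B C (chart_map B P, 1)) *\<^sub>R (chart_map C P, 1)"
    using nz by (simp add: prod_eq_iff)
qed

lemma chart_change_eq:
  assumes BC: "affine_chart B" "affine_chart C" and nz: "snd (transition B C (y, 1)) \<noteq> 0"
  shows "chart_map C (chart_inv B y) = fst (transition B C (y, 1)) /\<^sub>R snd (transition B C (y, 1))"
  using chart_map_span[OF BC(2), of "inv B (y, 1)"] nz by (simp add: chart_inv_def transition_def)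

text \<open>Quotient rule for numerator over denominator; replacing the quotient at y by the image
  point turns the result into the image of \<open>(h, 0)\<close> with its last coordinate subtracted
  along that point.\<close>

lemma chart_change_has_derivative:
  assumes BC: "affine_chart B" "affine_chart C" and nz: "snd (transition B C (y, 1)) \<noteq> 0"
  shows "((chart_map C \<circ> chart_inv B) has_derivative
    (\<lambda>h. (fst (transition B C (h, 0)) - snd (transition B C (h, 0)) *\<^sub>R chart_map C (chart_inv B y))
      /\<^sub>R snd (transition B C (y, 1)))) (at y)"
proof -
  let ?M = "transition B C"
  let ?n = "\<lambda>y. fst (?M (y, 1))" and ?d = "\<lambda>y. snd (?M (y, 1))"
  have lin: "linear ?M" by (rule linear_transition[OF BC])
  then have bl: "bounded_linear ?M" by (simp add: linear_conv_bounded_linear)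
  have "((\<lambda>y. (y, 1::real)) has_derivative (\<lambda>h. (h, 0))) (at y)"
    by (intro has_derivative_Pair has_derivative_ident has_derivative_const)
  then have M: "((\<lambda>y. ?M (y, 1)) has_derivative (\<lambda>h. ?M (h, 0))) (at y)"
    by (rule bounded_linear.has_derivative[OF bl])
  then have n: "(?n has_derivative (\<lambda>h. fst (?M (h, 0)))) (at y)"
    and d: "(?d has_derivative (\<lambda>h. snd (?M (h, 0)))) (at y)"
    by (auto intro: has_derivative_fst has_derivative_snd)
  have "((\<lambda>y. inverse (?d y) *\<^sub>R ?n y) has_derivative
      (\<lambda>h. inverse (?d y) *\<^sub>R fst (?M (h, 0)) + (- (inverse (?d y) * snd (?M (h, 0)) * inverse (?d y))) *\<^sub>R ?n y)) (at y)"
    by (rule has_derivative_scaleR[OF Deriv.has_derivative_inverse[OF nz d] n])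
  moreover have "(\<lambda>h. inverse (?d y) *\<^sub>R fst (?M (h, 0)) + (- (inverse (?d y) * snd (?M (h, 0)) * inverse (?d y))) *\<^sub>R ?n y)
      = (\<lambda>h. (fst (?M (h, 0)) - snd (?M (h, 0)) *\<^sub>R chart_map C (chart_inv B y)) /\<^sub>R ?d y)"
    unfolding chart_change_eq[OF BC nz] by (simp add: scaleR_diff_right mult.assoc)
  ultimately have der: "((\<lambda>y. inverse (?d y) *\<^sub>R ?n y) has_derivative
      (\<lambda>h. (fst (?M (h, 0)) - snd (?M (h, 0)) *\<^sub>R chart_map C (chart_inv B y)) /\<^sub>R ?d y)) (at y)"
    by simp
  have "open {y. ?d y \<noteq> 0}"
  proof -
    have "continuous_on UNIV (\<lambda>y. ?M (y, 1))"
      using bl by (intro bounded_linear.continuous_on[OF bl] continuous_intros)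
    then show ?thesis by (intro open_Collect_neq continuous_on_snd continuous_on_const)
  qed
  from has_derivative_transform_within_open[OF der this, of "chart_map C \<circ> chart_inv B"] nz
  show ?thesis by (simp add: chart_change_eq[OF BC])
qed

lemma tangent_space_transition:
  assumes BC: "affine_chart B" "affine_chart C" and X: "X \<in> chart_dom B" "X \<in> chart_dom C"
    and u: "u \<in> tangent_space (chart_image B \<Sigma>) (chart_map B X)"
  shows "(fst (transition B C (u, 0)) - snd (transition B C (u, 0)) *\<^sub>R chart_map C X)
      /\<^sub>R snd (transition B C (chart_map B X, 1)) \<in> tangent_space (chart_image C \<Sigma>) (chart_map C X)"
proof -
  let ?z = "chart_map B X" and ?\<Phi> = "chart_map C \<circ> chart_inv B"
  have nz: "snd (transition B C (?z, 1)) \<noteq> 0" by (rule transition_chart_map(1)[OF BC X])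
  have Xi: "chart_inv B ?z = X" by (rule chart_inv_chart_map[OF BC(1) X(1)])
  obtain \<gamma> where \<gamma>: "\<gamma> (0::real) = ?z" "(\<gamma> has_vector_derivative u) (at 0)"
    "\<forall>\<^sub>F s in at 0. \<gamma> s \<in> chart_image B \<Sigma>"
    using u unfolding tangent_space_def by (elim CollectE exE conjE)
  have d\<Phi>: "(?\<Phi> has_derivative (\<lambda>h. (fst (transition B C (h, 0)) - snd (transition B C (h, 0)) *\<^sub>R chart_map C X)
      /\<^sub>R snd (transition B C (?z, 1)))) (at (\<gamma> 0))"
    using chart_change_has_derivative[OF BC nz] unfolding Xi \<gamma>(1) .
  have "((\<lambda>s. ?\<Phi> (\<gamma> s)) has_derivative (\<lambda>h. (fst (transition B C (h *\<^sub>R u, 0)) - snd (transition B C (h *\<^sub>R u, 0)) *\<^sub>R chart_map C X)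
      /\<^sub>R snd (transition B C (?z, 1)))) (at 0)"
    using \<gamma>(2) by (intro has_derivative_compose[where f = \<gamma> and x = 0 and g = "?\<Phi>", OF _ d\<Phi>]) (simp add: has_vector_derivative_def)
  moreover have "transition B C (h *\<^sub>R u, 0) = h *\<^sub>R transition B C (u, 0)" for h
    using linear_cmul[OF linear_transition[OF BC], of h "(u, 0)"] by (simp add: scaleR_prod_def)
  ultimately have "((\<lambda>s. ?\<Phi> (\<gamma> s)) has_vector_derivative
      (fst (transition B C (u, 0)) - snd (transition B C (u, 0)) *\<^sub>R chart_map C X)
      /\<^sub>R snd (transition B C (?z, 1))) (at 0)"
    by (simp add: has_vector_derivative_def scaleR_diff_right mult_ac)
  moreover have "?\<Phi> (\<gamma> 0) = chart_map C X" using \<gamma>(1) Xi by simp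
  moreover have "\<forall>\<^sub>F s in at 0. ?\<Phi> (\<gamma> s) \<in> chart_image C \<Sigma>"
  proof -
    have "(\<gamma> \<longlongrightarrow> ?z) (at 0)"
      using has_vector_derivative_continuous[OF \<gamma>(2)] \<gamma>(1) by (simp add: continuous_within)
    then have "((\<lambda>s. (\<gamma> s, 1::real)) \<longlongrightarrow> (?z, 1)) (at 0)" by (intro tendsto_intros)
    then have "((\<lambda>s. snd (transition B C (\<gamma> s, 1))) \<longlongrightarrow> snd (transition B C (?z, 1))) (at 0)"
      using linear_transition[OF BC]
      by (intro tendsto_snd bounded_linear.tendsto[of "transition B C"]) (simp add: linear_conv_bounded_linear)
    then have "\<forall>\<^sub>F s in at 0. snd (transition B C (\<gamma> s, 1)) \<noteq> 0"
      using nz by (rule tendsto_imp_eventually_ne)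
    with \<gamma>(3) show ?thesis
    proof eventually_elim
      case (elim s)
      have "chart_inv B (\<gamma> s) \<in> chart_dom C" using elim(2) unfolding chart_inv_in_dom_iff[OF BC] .
      moreover have "chart_inv B (\<gamma> s) \<in> \<Sigma>"
        using elim(1) unfolding chart_image_eq[OF BC(1)] by (rule CollectD)
      ultimately show ?case using chart_map_in_chart_image[OF BC(2)] by simp
    qed
  qed
  ultimately show ?thesis
    unfolding tangent_space_def by (intro CollectI exI[of _ "\<lambda>s. ?\<Phi> (\<gamma> s)"] conjI)
qed

section \<open>Chords and the radial flow\<close>

text \<open>Time is measured in units of \<open>h\<close>, not in length. It scales inversely with
  \<open>h\<close>, and the Finsler norm becomes the mean of two reciprocals.\<close>

definition exit_time :: "'a::euclidean_space set \<Rightarrow> 'a \<Rightarrow> 'a \<Rightarrow> real" where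
  "exit_time D p h = (THE s. s > 0 \<and> p + s *\<^sub>R h \<in> frontier D)"

locale bounded_convex_domain =
  fixes D :: "'a::euclidean_space set"
  assumes open_D: "open D" and bounded_D: "bounded D" and convex_D: "convex D"
begin

lemma frontier_not_in_D: "y \<in> frontier D \<Longrightarrow> y \<notin> D"
  using open_D by (simp add: frontier_def interior_open)

lemma segment_in_D:
  assumes "p \<in> D" "b \<in> closure D" "0 < c" "c \<le> 1"
  shows "b + c *\<^sub>R (p - b) \<in> D"
proof (cases "p = b \<or> c = 1")
  case True
  then show ?thesis using assms by auto
next
  case False
  have "b + c *\<^sub>R (p - b) \<in> open_segment b p"
    using False assms by (auto simp: in_segment algebra_simps intro!: exI[of _ c])
  then show ?thesis
    using in_interior_closure_convex_segment[OF convex_D, of p b] assms open_D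
    by (auto simp: interior_open open_segment_commute)
qed

lemma exit_time:
  assumes p: "p \<in> D" and h: "h \<noteq> 0"
  shows exit_time_pos: "0 < exit_time D p h"
    and exit_time_frontier: "p + exit_time D p h *\<^sub>R h \<in> frontier D"
    and before_exit_time: "\<And>r. 0 \<le> r \<Longrightarrow> r < exit_time D p h \<Longrightarrow> p + r *\<^sub>R h \<in> D"
    and after_exit_time: "\<And>r. exit_time D p h < r \<Longrightarrow> p + r *\<^sub>R h \<notin> closure D"
    and exit_time_unique: "\<And>s. 0 < s \<Longrightarrow> p + s *\<^sub>R h \<in> frontier D \<Longrightarrow> exit_time D p h = s"
proof -
  obtain d where d: "0 < d" "p + d *\<^sub>R h \<in> frontier D"
    "\<And>e. 0 \<le> e \<Longrightarrow> e < d \<Longrightarrow> p + e *\<^sub>R h \<in> interior D"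
    using ray_to_frontier[OF bounded_D, of p h] p h open_D by (auto simp: interior_open)
  have after: "p + r *\<^sub>R h \<notin> closure D" if "d < r" for r
  proof
    assume "p + r *\<^sub>R h \<in> closure D"
    \<comment> \<open>The point at time d lies strictly between p and this point of the closure, so
      it would be in the open set D although it is on the frontier.\<close>
    from segment_in_D[OF p this, of "1 - d / r"] that d(1)
    have "p + r *\<^sub>R h + (1 - d / r) *\<^sub>R (p - (p + r *\<^sub>R h)) \<in> D" by simp
    also have "p + r *\<^sub>R h + (1 - d / r) *\<^sub>R (p - (p + r *\<^sub>R h)) = p + (r - (1 - d / r) * r) *\<^sub>R h"
      by (simp add: scaleR_diff_left)
    also have "r - (1 - d / r) * r = d" using that d(1) by (simp add: field_simps)
    finally show False using frontier_not_in_D[OF d(2)] by contradiction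
  qed
  have uni: "s = d" if "0 < s" "p + s *\<^sub>R h \<in> frontier D" for s
  proof -
    have "p + s *\<^sub>R h \<in> closure D" "p + s *\<^sub>R h \<notin> interior D"
      using that(2) by (simp_all add: frontier_def)
    then have "\<not> d < s" "\<not> s < d"
      using after[of s] d(3)[of s] that(1) less_imp_le by blast+
    then show ?thesis by simp
  qed
  have ex: "exit_time D p h = d"
    unfolding exit_time_def by (rule the_equality) (simp add: d, simp add: uni)
  show "0 < exit_time D p h" "p + exit_time D p h *\<^sub>R h \<in> frontier D"
    unfolding ex by (fact d)+
  show "p + r *\<^sub>R h \<in> D" if "0 \<le> r" "r < exit_time D p h" for r
    using d(3)[of r] that open_D by (simp add: ex interior_open)
  show "p + r *\<^sub>R h \<notin> closure D" if "exit_time D p h < r" for r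
    using after that unfolding ex .
  show "exit_time D p h = s" if "0 < s" "p + s *\<^sub>R h \<in> frontier D" for s
    unfolding ex using uni[OF that] by (rule sym)
qed

lemma exit_point_eq:
  assumes "p \<in> D" "h \<noteq> 0"
  shows "exit_point D p h = p + exit_time D p h *\<^sub>R h"
  unfolding exit_point_def
proof (rule the_equality)
  show "p + exit_time D p h *\<^sub>R h \<in> frontier D \<and> (\<exists>s>0. p + exit_time D p h *\<^sub>R h = p + s *\<^sub>R h)"
    using exit_time_frontier[OF assms] exit_time_pos[OF assms] by blast
  fix w assume "w \<in> frontier D \<and> (\<exists>s>0. w = p + s *\<^sub>R h)"
  then obtain s where "w \<in> frontier D" "0 < s" "w = p + s *\<^sub>R h" by blast
  then show "w = p + exit_time D p h *\<^sub>R h"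
    using exit_time_unique[OF assms, of s] by simp
qed

lemma finsler_eq:
  assumes "p \<in> D" "h \<noteq> 0"
  shows "finsler D p h = (1 / exit_time D p h + 1 / exit_time D p (- h)) / 2"
  using assms exit_time_pos[OF assms] exit_time_pos[of p "- h"]
  by (simp add: finsler_def exit_point_eq dist_norm field_simps)

lemma exit_time_scale:
  assumes "p \<in> D" "h \<noteq> 0" "c > 0"
  shows "exit_time D p (c *\<^sub>R h) = exit_time D p h / c"
  using assms exit_time_pos[OF assms(1,2)] exit_time_frontier[OF assms(1,2)]
  by (intro exit_time_unique) simp_all

lemma finsler_scale:
  assumes "p \<in> D" "h \<noteq> 0" "c > 0"
  shows "finsler D p (c *\<^sub>R h) = c * finsler D p h"
proof -
  have "exit_time D p (- (c *\<^sub>R h)) = exit_time D p (- h) / c"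
    using assms exit_time_scale[of p "- h" c] by simp
  then show ?thesis
    using assms by (simp add: finsler_eq exit_time_scale[OF assms] add_divide_distrib distrib_left)
qed

text \<open>Lying in D at a time before the exit, and lying outside the closure at a time after it,
  are both open conditions on the base point and the direction; they bound the exit time from below
  and from above.\<close>

lemma exit_time_tendsto:
  assumes p: "(p \<longlongrightarrow> p0) F" and h: "(h \<longlongrightarrow> h0) F" and "p0 \<in> D" "h0 \<noteq> 0"
  shows "((\<lambda>x. exit_time D (p x) (h x)) \<longlongrightarrow> exit_time D p0 h0) F"
proof (rule order_tendstoI)
  have pD: "\<forall>\<^sub>F x in F. p x \<in> D" using p open_D assms(3) by (auto simp: tendsto_def)
  have h0: "\<forall>\<^sub>F x in F. h x \<noteq> 0" using h assms(4) by (rule tendsto_imp_eventually_ne)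
  have lim: "((\<lambda>x. p x + r *\<^sub>R h x) \<longlongrightarrow> p0 + r *\<^sub>R h0) F" for r
    by (intro tendsto_intros p h)
  fix a assume a: "a < exit_time D p0 h0"
  \<comment> \<open>\<open>before_exit_time\<close> speaks of nonnegative times only, while a may be
    negative.\<close>
  define r where "r = max 0 a"
  have r: "0 \<le> r" "r < exit_time D p0 h0" "a \<le> r"
    using a exit_time_pos[OF assms(3,4)] by (auto simp: r_def)
  have "\<forall>\<^sub>F x in F. p x + r *\<^sub>R h x \<in> D"
    using lim[of r] open_D before_exit_time[OF assms(3,4) r(1,2)] by (auto simp: tendsto_def)
  with pD h0 show "\<forall>\<^sub>F x in F. a < exit_time D (p x) (h x)"
  proof eventually_elim
    case (elim x)
    have "p x + r *\<^sub>R h x \<in> closure D" using elim closure_subset by blast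
    then have "r \<le> exit_time D (p x) (h x)"
      using after_exit_time[OF elim(1,2), of r] by (meson not_less)
    moreover have "r \<noteq> exit_time D (p x) (h x)"
      using exit_time_frontier[OF elim(1,2)] elim(3) frontier_not_in_D by auto
    ultimately show ?case using r(3) by simp
  qed
next
  have pD: "\<forall>\<^sub>F x in F. p x \<in> D" using p open_D assms(3) by (auto simp: tendsto_def)
  have h0: "\<forall>\<^sub>F x in F. h x \<noteq> 0" using h assms(4) by (rule tendsto_imp_eventually_ne)
  have lim: "((\<lambda>x. p x + r *\<^sub>R h x) \<longlongrightarrow> p0 + r *\<^sub>R h0) F" for r
    by (intro tendsto_intros p h)
  fix a assume a: "exit_time D p0 h0 < a"
  have "\<forall>\<^sub>F x in F. p x + a *\<^sub>R h x \<in> - closure D"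
    using lim[of a] after_exit_time[OF assms(3,4) a] unfolding tendsto_def
    by (metis ComplI closed_closure open_Compl)
  with pD h0 show "\<forall>\<^sub>F x in F. exit_time D (p x) (h x) < a"
  proof eventually_elim
    case (elim x)
    have "0 < a" using a exit_time_pos[OF assms(3,4)] by simp
    then have "\<not> a < exit_time D (p x) (h x)"
      using before_exit_time[OF elim(1,2), of a] elim(3) closure_subset[of D] by auto
    moreover have "a \<noteq> exit_time D (p x) (h x)"
      using exit_time_frontier[OF elim(1,2)] elim(3) by (auto simp: frontier_def)
    ultimately show ?case by simp
  qed
qed

text \<open>If x - w were tangent, the curve points \<gamma> s, magnified from w by the factor 1 /
  s, would tend to x and so enter D. Shrinking back toward w keeps them in D, although \<gamma> s is
  on the frontier.\<close>

lemma transversal: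
  assumes "w \<in> frontier D" "x \<in> D"
  shows "x - w \<notin> tangent_space (frontier D) w"
proof
  assume "x - w \<in> tangent_space (frontier D) w"
  then obtain \<gamma> where \<gamma>: "\<gamma> (0::real) = w" "(\<gamma> has_vector_derivative (x - w)) (at 0)"
    "\<forall>\<^sub>F s in at 0. \<gamma> s \<in> frontier D"
    by (auto simp: tangent_space_def)
  have "((\<lambda>s. (\<gamma> s - w) /\<^sub>R s) \<longlongrightarrow> x - w) (at 0)"
  proof (rule LIM_zero_cancel, rule tendsto_norm_zero_cancel)
    have "((\<lambda>s. norm (\<gamma> s - w - s *\<^sub>R (x - w)) / norm s) \<longlongrightarrow> 0) (at 0)"
      using \<gamma>(1,2) by (simp add: has_vector_derivative_def has_derivative_iff_norm)
    moreover have "\<forall>\<^sub>F s in at 0. norm (\<gamma> s - w - s *\<^sub>R (x - w)) / norm s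
        = norm ((\<gamma> s - w) /\<^sub>R s - (x - w))"
    proof (rule eventually_mono)
      show "\<forall>\<^sub>F s in at 0. s \<noteq> (0::real)" by (simp add: eventually_at_filter)
      fix s :: real assume "s \<noteq> 0"
      then have "(\<gamma> s - w) /\<^sub>R s - (x - w) = (\<gamma> s - w - s *\<^sub>R (x - w)) /\<^sub>R s"
        by (simp add: scaleR_diff_right)
      then show "norm (\<gamma> s - w - s *\<^sub>R (x - w)) / norm s = norm ((\<gamma> s - w) /\<^sub>R s - (x - w))"
        by (simp add: divide_inverse)
    qed
    ultimately show "((\<lambda>s. norm ((\<gamma> s - w) /\<^sub>R s - (x - w))) \<longlongrightarrow> 0) (at 0)"
      by (rule Lim_transform_eventually)
  qed
  then have "((\<lambda>s. w + (\<gamma> s - w) /\<^sub>R s) \<longlongrightarrow> w + (x - w)) (at_right 0)"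
    by (intro tendsto_intros) (rule filterlim_mono[OF _ order_refl at_le], auto)
  then have "\<forall>\<^sub>F s in at_right 0. w + (\<gamma> s - w) /\<^sub>R s \<in> D"
    using open_D assms(2) by (auto simp: tendsto_def)
  moreover have "\<forall>\<^sub>F s in at_right 0. \<gamma> s \<in> frontier D"
    using \<gamma>(3) by (auto simp: eventually_at_split)
  moreover have "\<forall>\<^sub>F s in at_right 0. 0 < s \<and> s < (1::real)"
    using eventually_at_right_real[OF zero_less_one] by simp
  ultimately have "\<forall>\<^sub>F s in at_right (0::real). False"
  proof eventually_elim
    case (elim s)
    have "w + s *\<^sub>R (w + (\<gamma> s - w) /\<^sub>R s - w) \<in> D"
      using elim assms(1) by (intro segment_in_D[of "w + (\<gamma> s - w) /\<^sub>R s" w s]) (auto simp: frontier_def)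
    also have "w + s *\<^sub>R (w + (\<gamma> s - w) /\<^sub>R s - w) = \<gamma> s" using elim by simp
    finally show ?case using elim frontier_not_in_D by blast
  qed
  then show False by simp
qed

end

section \<open>Chords through a fixed boundary point and the flow along them\<close>

locale pointed_convex_domain = bounded_convex_domain D for D :: "'a::euclidean_space set" +
  fixes z :: 'a
  assumes z_frontier: "z \<in> frontier D"
begin

text \<open>The chord through \<open>y\<close> and \<open>z\<close> leaves \<open>D\<close> at \<open>z\<close> and at \<open>z + (y - z) / depth y\<close>.\<close>

definition depth :: "'a \<Rightarrow> real" where
  "depth y = 1 / (1 + exit_time D y (y - z))"

lemma z_closure: "z \<in> closure D" and z_notin: "z \<notin> D"
  using z_frontier frontier_not_in_D by (auto simp: frontier_def)

lemma neq_z: "y \<in> D \<Longrightarrow> y - z \<noteq> 0" "y \<in> D \<Longrightarrow> z - y \<noteq> 0"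
  using z_notin by auto

lemma exit_time_away: "y \<in> D \<Longrightarrow> exit_time D y (y - z) = 1 / depth y - 1"
  by (simp add: depth_def)

lemma depth_bounds: assumes "y \<in> D" shows "0 < depth y" "depth y < 1"
  using exit_time_pos[OF assms neq_z(1)[OF assms]] by (simp_all add: depth_def)

lemma exit_time_toward: "y \<in> D \<Longrightarrow> exit_time D y (z - y) = 1"
  using neq_z z_frontier by (intro exit_time_unique) auto

lemma finsler_toward:
  assumes "y \<in> D"
  shows "finsler D y (z - y) = 1 / (2 * (1 - depth y))"
proof -
  have "finsler D y (z - y) = (1 + 1 / (1 / depth y - 1)) / 2"
    using neq_z[OF assms] by (simp add: finsler_eq assms exit_time_toward exit_time_away)
  also have "1 / depth y - 1 = (1 - depth y) / depth y"
    using depth_bounds[OF assms] by (simp add: field_simps)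
  finally show ?thesis
    using depth_bounds[OF assms] by (simp add: field_simps)
qed

lemma end_frontier:
  assumes "y \<in> D" shows "z + (1 / depth y) *\<^sub>R (y - z) \<in> frontier D"
proof -
  have "z + (1 / depth y) *\<^sub>R (y - z) = y + (1 / depth y - 1) *\<^sub>R (y - z)"
    by (simp add: algebra_simps)
  then show ?thesis
    using exit_time_frontier[OF assms neq_z(1)[OF assms]] exit_time_away[OF assms] by simp
qed

lemma ray_in_D:
  assumes y: "y \<in> D" and k: "0 < k"
  shows "z + k *\<^sub>R (y - z) \<in> D \<longleftrightarrow> k * depth y < 1"
proof (cases "k \<le> 1")
  case True
  then have "k * depth y \<le> 1 * depth y" using depth_bounds[OF y] by (intro mult_right_mono) auto
  then have "k * depth y < 1" using depth_bounds[OF y] by linarith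
  then show ?thesis
    using segment_in_D[OF y z_closure k True] by simp
next
  case False
  have eq: "z + k *\<^sub>R (y - z) = y + (k - 1) *\<^sub>R (y - z)" by (simp add: algebra_simps)
  have iff: "k - 1 < exit_time D y (y - z) \<longleftrightarrow> k * depth y < 1"
    using depth_bounds[OF y] unfolding exit_time_away[OF y] by (simp add: field_simps)
  show ?thesis
  proof
    assume "z + k *\<^sub>R (y - z) \<in> D"
    moreover from this have "z + k *\<^sub>R (y - z) \<in> closure D" using closure_subset by blast
    ultimately have "k - 1 < exit_time D y (y - z)"
      using after_exit_time[OF y neq_z(1)[OF y], of "k - 1"]
        exit_time_frontier[OF y neq_z(1)[OF y]] frontier_not_in_D unfolding eq
      by (metis linorder_neqE)
    then show "k * depth y < 1" using iff by simp
  next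
    assume "k * depth y < 1"
    then show "z + k *\<^sub>R (y - z) \<in> D"
      unfolding eq using iff False by (intro before_exit_time[OF y neq_z(1)[OF y]]) auto
  qed
qed

text \<open>Both points have the same chord and the same far end, so \<open>depth\<close> is linear
  along it. This makes the flow explicitly solvable.\<close>

lemma depth_ray:
  assumes y: "y \<in> D" and k: "0 < k" and D: "z + k *\<^sub>R (y - z) \<in> D"
  shows "depth (z + k *\<^sub>R (y - z)) = k * depth y"
proof -
  let ?y = "z + k *\<^sub>R (y - z)"
  have lt: "k * depth y < 1" using ray_in_D[OF y k] D by simp
  have d: "0 < depth y" using depth_bounds[OF y] by simp
  have "exit_time D ?y (?y - z) = 1 / (k * depth y) - 1"
  proof (rule exit_time_unique[OF D neq_z(1)[OF D]])
    show "0 < 1 / (k * depth y) - 1" using lt d k by simp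
    have "?y + (1 / (k * depth y) - 1) *\<^sub>R (?y - z) = z + ((1 / (k * depth y)) * k) *\<^sub>R (y - z)"
      by (simp add: algebra_simps)
    also have "(1 / (k * depth y)) * k = 1 / depth y" using k d by simp
    finally show "?y + (1 / (k * depth y) - 1) *\<^sub>R (?y - z) \<in> frontier D"
      using end_frontier[OF y] by (simp only:)
  qed
  then show ?thesis by (simp add: depth_def[of ?y])
qed

lemma continuous_depth:
  assumes "(p \<longlongrightarrow> p0) F" "p0 \<in> D"
  shows "((\<lambda>s. depth (p s)) \<longlongrightarrow> depth p0) F"
proof -
  have "1 + exit_time D p0 (p0 - z) \<noteq> 0"
    using exit_time_pos[OF assms(2) neq_z(1)[OF assms(2)]] by simp
  then show ?thesis
    unfolding depth_def using assms neq_z(1)[OF assms(2)]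
    by (intro tendsto_intros exit_time_tendsto) auto
qed

text \<open>On the curve z + \<epsilon> (y - z) unit speed reads \<epsilon>' = - 2 \<epsilon> (1 -
  \<epsilon> m) with m = depth y. For I = 1 / \<epsilon> this is the linear equation I' = 2 (I - m)
  with I = 1 at time 0, whose solution is the denominator.\<close>

definition contraction :: "real \<Rightarrow> 'a \<Rightarrow> real" where
  "contraction t y = 1 / (depth y + exp (2 * t) * (1 - depth y))"

lemma contraction_denom: "y \<in> D \<Longrightarrow> depth y < depth y + exp (2 * t) * (1 - depth y)"
  using depth_bounds by simp

lemma contraction_pos: "y \<in> D \<Longrightarrow> 0 < contraction t y"
  unfolding contraction_def
  by (rule divide_pos_pos[OF zero_less_one less_trans[OF depth_bounds(1) contraction_denom]])

lemma contraction_in_D: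
  assumes "y \<in> D" shows "z + contraction t y *\<^sub>R (y - z) \<in> D"
  using contraction_denom[OF assms, of t] depth_bounds[OF assms]
  by (subst ray_in_D[OF assms contraction_pos[OF assms]])
     (simp only: contraction_def times_divide_eq_left mult_1 divide_less_eq_1_pos less_trans)

lemma radial_flow_exists:
  assumes y: "y \<in> D"
  defines "\<gamma> \<equiv> \<lambda>s. z + contraction s y *\<^sub>R (y - z)"
  shows "(\<gamma> has_vector_derivative ((z - \<gamma> s) /\<^sub>R finsler D (\<gamma> s) (z - \<gamma> s))) (at s)"
proof -
  let ?m = "depth y" and ?E = "contraction s y"
  have m: "0 < ?m" "?m < 1" using depth_bounds[OF y] by auto
  have den: "?m + exp (2 * s) * (1 - ?m) \<noteq> 0" using contraction_denom[OF y, of s] m by linarith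
  have D: "\<gamma> s \<in> D" unfolding \<gamma>_def by (rule contraction_in_D[OF y])
  have E: "1 - ?E * ?m = exp (2 * s) * (1 - ?m) * ?E"
    using den unfolding contraction_def by (simp add: field_simps)
  have "((\<lambda>s. contraction s y) has_real_derivative - (2 * exp (2 * s) * (1 - ?m) * ?E\<^sup>2)) (at s)"
  proof -
    have "((\<lambda>s. ?m + exp (2 * s) * (1 - ?m)) has_real_derivative 2 * exp (2 * s) * (1 - ?m)) (at s)"
      by (auto intro!: derivative_eq_intros)
    from DERIV_inverse'[OF this den] show ?thesis
      by (simp add: contraction_def inverse_eq_divide power2_eq_square mult_ac)
  qed
  then have "(\<gamma> has_vector_derivative (- (2 * exp (2 * s) * (1 - ?m) * ?E\<^sup>2)) *\<^sub>R (y - z)) (at s)"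
    unfolding \<gamma>_def by (auto intro!: derivative_eq_intros)
  moreover have "(z - \<gamma> s) /\<^sub>R finsler D (\<gamma> s) (z - \<gamma> s)
      = (- (2 * exp (2 * s) * (1 - ?m) * ?E\<^sup>2)) *\<^sub>R (y - z)"
  proof -
    have "(z - \<gamma> s) /\<^sub>R finsler D (\<gamma> s) (z - \<gamma> s) = (2 * (1 - ?E * ?m)) *\<^sub>R (- ?E *\<^sub>R (y - z))"
      unfolding finsler_toward[OF D]
      using depth_ray[OF y contraction_pos[OF y, of s] contraction_in_D[OF y, of s]]
      by (simp add: \<gamma>_def)
    then show ?thesis unfolding E by (simp add: power2_eq_square algebra_simps)
  qed
  ultimately show ?thesis by simp
qed

text \<open>Along a given solution the coefficient \<open>c\<close> is a continuous function of
  time, so the equation is linear in \<gamma> - z. The integrating factor I places the curve on its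
  chord; there \<open>depth_ray\<close> turns c I into 2 (I - depth y), and the factor exp (- 2 s)
  solves the resulting equation. The interval {a..b} contains 0 and t and carries the primitive g of
  c.\<close>

lemma radial_flow_unique:
  assumes y: "y \<in> D" and \<gamma>0: "\<gamma> 0 = y"
    and D: "\<And>s. \<gamma> s \<in> D"
    and ode: "\<And>s. (\<gamma> has_vector_derivative ((z - \<gamma> s) /\<^sub>R finsler D (\<gamma> s) (z - \<gamma> s))) (at s)"
  shows "\<gamma> t = z + contraction t y *\<^sub>R (y - z)"
proof -
  define a b where "a = min 0 t - 1" "b = max 0 t + 1"
  have ab: "0 \<in> {a..b}" "t \<in> {a..b}" "a < b" by (auto simp: a_b_def)
  define c where "c s = 2 * (1 - depth (\<gamma> s))" for s
  have ode': "(\<gamma> has_vector_derivative (c s *\<^sub>R (z - \<gamma> s))) (at s)" for s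
    using ode[of s] unfolding finsler_toward[OF D] by (simp add: c_def)
  have "isCont \<gamma> s" for s
    using ode' by (rule has_vector_derivative_continuous)
  then have "isCont c s" for s
    unfolding c_def isCont_def by (intro tendsto_intros continuous_depth D) (auto simp: isCont_def)
  then have cont: "continuous_on {a..b} c" by (simp add: continuous_at_imp_continuous_on)
  have "\<exists>g. \<forall>s\<in>{a..b}. (g has_vector_derivative c s) (at s within {a..b})"
  proof (rule antiderivative_continuous[OF cont])
    fix g assume "\<And>x. x \<in> {a..b} \<Longrightarrow> (g has_vector_derivative c x) (at x within {a..b})"
    then show ?thesis by (intro exI ballI)
  qed
  then obtain g where g: "\<forall>s\<in>{a..b}. (g has_vector_derivative c s) (at s within {a..b})" ..
  define E where "E s = exp (g 0 - g s)" for s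
  define I where "I s = exp (g s - g 0)" for s
  have Epos: "E s > 0" and EI: "E s * I s = 1" for s
    by (simp_all add: E_def I_def flip: exp_add)
  have dI: "(I has_real_derivative c s * I s) (at s within {a..b})" if "s \<in> {a..b}" for s
  proof -
    have "(g has_real_derivative c s) (at s within {a..b})"
      using bspec[OF g that] by (simp add: has_real_derivative_iff_has_vector_derivative)
    then have "((\<lambda>s. g s - g 0) has_real_derivative c s - 0) (at s within {a..b})"
      by (intro DERIV_diff DERIV_const)
    from DERIV_chain2[OF DERIV_exp this] show ?thesis unfolding I_def by (simp add: mult.commute)
  qed
  have der0: "((\<lambda>s. I s *\<^sub>R (\<gamma> s - z)) has_derivative (\<lambda>h. 0)) (at s within {a..b})"
    if "s \<in> {a..b}" for s
  proof -
    have "((\<lambda>s. \<gamma> s - z) has_vector_derivative c s *\<^sub>R (z - \<gamma> s) - 0) (at s within {a..b})"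
      by (intro has_vector_derivative_diff has_vector_derivative_const
          has_vector_derivative_at_within[OF ode'])
    from has_vector_derivative_scaleR[OF dI[OF that] this]
    have "((\<lambda>s. I s *\<^sub>R (\<gamma> s - z)) has_vector_derivative 0) (at s within {a..b})"
      by (simp add: algebra_simps)
    then show ?thesis by (simp add: has_vector_derivative_def)
  qed
  have const: "I s *\<^sub>R (\<gamma> s - z) = y - z" if "s \<in> {a..b}" for s
    using has_derivative_zero_unique[of "{a..b}" "\<lambda>s. I s *\<^sub>R (\<gamma> s - z)" s 0, OF _ der0 that ab(1)] \<gamma>0
    by (simp add: I_def[of 0])
  have line: "\<gamma> s = z + E s *\<^sub>R (y - z)" if "s \<in> {a..b}" for s
    unfolding const[OF that, symmetric] scaleR_scaleR EI by simp
  have cE: "c s * I s = 2 * (I s - depth y)" if "s \<in> {a..b}" for s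
  proof -
    have "depth (\<gamma> s) = E s * depth y"
      using depth_ray[OF y Epos, of s] D[of s] unfolding line[OF that] by simp
    then have "c s * I s = 2 * (I s - E s * I s * depth y)" by (simp add: c_def algebra_simps)
    then show ?thesis unfolding EI by simp
  qed
  have der1: "((\<lambda>s. (I s - depth y) * exp (- 2 * s)) has_derivative (\<lambda>h. 0)) (at s within {a..b})"
    if "s \<in> {a..b}" for s
  proof -
    have "((\<lambda>s. exp (- 2 * s)) has_real_derivative - 2 * exp (- 2 * s)) (at s within {a..b})"
      by (auto intro!: derivative_eq_intros)
    from DERIV_mult[OF DERIV_diff[OF dI[OF that] DERIV_const[of "depth y"]] this]
    have "((\<lambda>s. (I s - depth y) * exp (- 2 * s)) has_real_derivative 0) (at s within {a..b})"
      unfolding cE[OF that] by (simp add: algebra_simps)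
    then show ?thesis by (simp add: has_field_derivative_def lambda_zero)
  qed
  have "(I t - depth y) * exp (- 2 * t) = 1 - depth y"
    using has_derivative_zero_unique[of "{a..b}" "\<lambda>s. (I s - depth y) * exp (- 2 * s)" t 0, OF _ der1 ab(2,1)]
    by (simp add: I_def[of 0])
  then have "(I t - depth y) * exp (- 2 * t) * exp (2 * t) = (1 - depth y) * exp (2 * t)" by simp
  then have "I t - depth y = (1 - depth y) * exp (2 * t)" by (simp add: mult.assoc mult_exp_exp)
  then have "I t = depth y + exp (2 * t) * (1 - depth y)" by (simp add: algebra_simps)
  moreover have "E t = 1 / I t" using EI[of t] by (metis nonzero_eq_divide_eq zero_neq_one mult_zero_right)
  ultimately have "E t = contraction t y"
    by (simp add: contraction_def)
  then show ?thesis using line ab by simp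
qed

lemma radial_flow_eq:
  assumes y: "y \<in> D"
  shows "radial_flow D z t y = z + contraction t y *\<^sub>R (y - z)"
  unfolding radial_flow_def
proof (rule the_equality)
  let ?\<gamma> = "\<lambda>s. z + contraction s y *\<^sub>R (y - z)"
  have "?\<gamma> 0 = y" by (simp add: contraction_def)
  then show "\<exists>\<gamma>. \<gamma> 0 = y \<and> (\<forall>s. \<gamma> s \<in> D \<and>
      (\<gamma> has_vector_derivative ((z - \<gamma> s) /\<^sub>R finsler D (\<gamma> s) (z - \<gamma> s))) (at s)) \<and>
      z + contraction t y *\<^sub>R (y - z) = \<gamma> t"
    using contraction_in_D[OF y] radial_flow_exists[OF y] by (intro exI[of _ ?\<gamma>]) simp
next
  fix w assume "\<exists>\<gamma>. \<gamma> 0 = y \<and> (\<forall>s. \<gamma> s \<in> D \<and>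
      (\<gamma> has_vector_derivative ((z - \<gamma> s) /\<^sub>R finsler D (\<gamma> s) (z - \<gamma> s))) (at s)) \<and> w = \<gamma> t"
  then obtain \<gamma> where "\<gamma> 0 = y" "\<And>s. \<gamma> s \<in> D" "w = \<gamma> t"
    "\<And>s. (\<gamma> has_vector_derivative ((z - \<gamma> s) /\<^sub>R finsler D (\<gamma> s) (z - \<gamma> s))) (at s)"
    by (elim exE conjE) simp
  then show "w = z + contraction t y *\<^sub>R (y - z)"
    using radial_flow_unique[OF y] by simp
qed

end

section \<open>Horospheres and parallel transport\<close>

text \<open>Caratheodory's form of differentiability. It suits implicitly defined functions, whose
  increments satisfy an exact secant identity with a convergent slope Q.\<close>

lemma has_derivative_caratheodory:
  fixes f :: "'a::euclidean_space \<Rightarrow> real"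
  assumes Q: "(Q \<longlongrightarrow> q) (at x)" and f: "\<forall>\<^sub>F y in at x. f y - f x = Q y \<bullet> (y - x)"
  shows "(f has_derivative (\<lambda>h. q \<bullet> h)) (at x)"
  unfolding has_derivative_iff_norm
proof
  show "bounded_linear (\<lambda>h. q \<bullet> h)" by (rule bounded_linear_inner_right)
  have ne: "\<forall>\<^sub>F y in at x. y \<noteq> x" by (simp add: eventually_at_filter)
  have "((\<lambda>y. norm (Q y - q)) \<longlongrightarrow> 0) (at x)"
    by (intro tendsto_norm_zero LIM_zero Q)
  moreover have "\<forall>\<^sub>F y in at x. norm (norm (f y - f x - q \<bullet> (y - x)) / norm (y - x)) \<le> norm (Q y - q)"
    using f ne
  proof eventually_elim
    case (elim y)
    have "f y - f x - q \<bullet> (y - x) = (Q y - q) \<bullet> (y - x)"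
      using elim by (simp add: inner_diff_left)
    then have "norm (f y - f x - q \<bullet> (y - x)) \<le> norm (Q y - q) * norm (y - x)"
      using Cauchy_Schwarz_ineq2[of "Q y - q" "y - x"] by simp
    then show ?case using elim by (simp add: pos_divide_le_eq)
  qed
  ultimately show "((\<lambda>y. norm (f y - f x - q \<bullet> (y - x)) / norm (y - x)) \<longlongrightarrow> 0) (at x)"
    by (rule Lim_null_comparison[rotated])
qed

section \<open>Depth, Hilbert distance and Busemann functions for a C1 boundary\<close>

locale smooth_pointed_domain = pointed_convex_domain D z for D :: "'a::euclidean_space set" and z +
  assumes C1: "C1_hypersurface (frontier D)"
begin

text \<open>The far ends \<open>?W y\<close> and \<open>?W x\<close> of the chords lie on the
  boundary, so the secant normal is orthogonal to their difference. This identity is solved for the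
  increment of depth; transversality at \<open>?W x\<close> keeps the denominator away from 0. The
  value on x - z is Euler's relation for a function linear along the ray.\<close>

lemma depth_has_derivative:
  assumes x: "x \<in> D"
  obtains q where "(depth has_derivative (\<lambda>h. q \<bullet> h)) (at x)" "q \<bullet> (x - z) = depth x"
proof -
  let ?W = "\<lambda>y. z + (1 / depth y) *\<^sub>R (y - z)"
  let ?w = "?W x"
  obtain g A where g: "tangent_space (frontier D) ?w = {u. g \<bullet> u = 0}"
    and A: "((\<lambda>p. A (fst p) (snd p)) \<longlongrightarrow> g) (nhds (?w, ?w))"
    and sec: "\<forall>\<^sub>F p in nhds (?w, ?w). fst p \<in> frontier D \<longrightarrow> snd p \<in> frontier D \<longrightarrow>
        A (fst p) (snd p) \<bullet> (fst p - snd p) = 0"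
    by (rule C1_hypersurface_normal[OF C1 end_frontier[OF x]])
  have mx: "0 < depth x" "depth x < 1" using depth_bounds[OF x] by auto
  have xw: "x - ?w = (1 - 1 / depth x) *\<^sub>R (x - z)" by (simp add: algebra_simps)
  have "g \<bullet> (x - ?w) \<noteq> 0"
    using transversal[OF end_frontier[OF x] x] unfolding g by simp
  then have gx: "g \<bullet> (x - z) \<noteq> 0" unfolding xw by auto
  have id: "((\<lambda>y. y) \<longlongrightarrow> x) (at x)" by (rule tendsto_ident_at)
  have dep: "(depth \<longlongrightarrow> depth x) (at x)" by (rule continuous_depth[OF id x])
  have "((\<lambda>y. (?W y, ?w)) \<longlongrightarrow> (?w, ?w)) (at x)"
    using mx by (intro tendsto_intros dep) auto
  then have AW: "((\<lambda>y. A (?W y) ?w) \<longlongrightarrow> g) (at x)"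
    and sW: "\<forall>\<^sub>F y in at x. ?W y \<in> frontier D \<longrightarrow> A (?W y) ?w \<bullet> (?W y - ?w) = 0"
    using filterlim_compose[OF A, of "\<lambda>y. (?W y, ?w)"]
      eventually_compose_filterlim[OF sec, of "\<lambda>y. (?W y, ?w)"] end_frontier[OF x] by simp_all
  have yD: "\<forall>\<^sub>F y in at x. y \<in> D" using open_D x by (rule eventually_at_in_open')
  let ?den = "\<lambda>y. (1 / depth y) * (A (?W y) ?w \<bullet> (y - z))"
  have den: "(?den \<longlongrightarrow> (1 / depth x) * (g \<bullet> (x - z))) (at x)"
    using mx by (intro tendsto_intros AW dep) auto
  have den0: "(1 / depth x) * (g \<bullet> (x - z)) \<noteq> 0" using mx gx by simp
  define Q where "Q y = (1 / ?den y) *\<^sub>R A (?W y) ?w" for y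
  define q where "q = (1 / ((1 / depth x) * (g \<bullet> (x - z)))) *\<^sub>R g"
  have "(Q \<longlongrightarrow> q) (at x)"
    unfolding Q_def q_def using mx gx by (intro tendsto_scaleR tendsto_divide tendsto_const den AW) auto
  moreover have "\<forall>\<^sub>F y in at x. depth y - depth x = Q y \<bullet> (y - x)"
    using sW yD tendsto_imp_eventually_ne[OF den den0]
  proof eventually_elim
    case (elim y)
    let ?A = "A (?W y) ?w"
    have my: "0 < depth y" using depth_bounds[OF elim(2)] by simp
    have "?den y \<noteq> 0" using elim(3) mx gx by simp
    have "?A \<bullet> (?W y - ?w) = 0" using elim(1) end_frontier[OF elim(2)] by simp
    also have "?W y - ?w = (1 / depth y - 1 / depth x) *\<^sub>R (y - z) + (1 / depth x) *\<^sub>R (y - x)"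
      by (simp add: algebra_simps)
    finally have "(1 / depth y - 1 / depth x) * (?A \<bullet> (y - z)) + (1 / depth x) * (?A \<bullet> (y - x)) = 0"
      by (simp add: inner_add_right)
    then have "depth x * depth y * ((1 / depth y - 1 / depth x) * (?A \<bullet> (y - z)) + (1 / depth x) * (?A \<bullet> (y - x))) = 0"
      by simp
    also have "depth x * depth y * ((1 / depth y - 1 / depth x) * (?A \<bullet> (y - z)) + (1 / depth x) * (?A \<bullet> (y - x)))
        = (depth x - depth y) * (?A \<bullet> (y - z)) + depth y * (?A \<bullet> (y - x))"
      using mx my by (simp add: field_simps)
    finally have "(depth y - depth x) * (?A \<bullet> (y - z)) = depth y * (?A \<bullet> (y - x))"
      by (simp add: algebra_simps)
    then have "depth y - depth x = depth y * (?A \<bullet> (y - x)) / (?A \<bullet> (y - z))"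
      using \<open>?den y \<noteq> 0\<close> by (simp add: nonzero_eq_divide_eq)
    then show ?case by (simp add: Q_def)
  qed
  ultimately have "(depth has_derivative (\<lambda>h. q \<bullet> h)) (at x)"
    by (rule has_derivative_caratheodory)
  moreover have "q \<bullet> (x - z) = depth x" using gx by (simp add: q_def)
  ultimately show ?thesis by (rule that)
qed

text \<open>The expression isolates ln (s - 1): as p tends to z, s tends to 1, and this is the only
  term that diverges.\<close>

lemma hilbert_dist_eq:
  assumes "x \<in> D" "p \<in> D" "x \<noteq> p"
  defines "r \<equiv> exit_time D x (x - p)" and "s \<equiv> exit_time D x (p - x)"
  shows "0 < r" "1 < s" "hilbert_dist D x p = (ln (s * (r + 1) / r) - ln (s - 1)) / 2"
proof -
  have ne: "x - p \<noteq> 0" "p - x \<noteq> 0" using assms(3) by auto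
  show r: "0 < r" unfolding r_def by (rule exit_time_pos[OF assms(1) ne(1)])
  have "x + s *\<^sub>R (p - x) \<in> frontier D" "s > 0"
    unfolding s_def by (rule exit_time_frontier[OF assms(1) ne(2)], rule exit_time_pos[OF assms(1) ne(2)])
  moreover have "x + s *\<^sub>R (p - x) \<in> D" if "s \<le> 1"
  proof -
    have "x \<in> closure D" using assms(1) closure_subset by blast
    from segment_in_D[OF assms(2) this \<open>s > 0\<close> that] show ?thesis .
  qed
  ultimately show s: "1 < s" using frontier_not_in_D by force
  define d where "d = norm (x - p)"
  have d: "d > 0" using ne by (simp add: d_def)
  have a: "exit_point D x (x - p) = x + r *\<^sub>R (x - p)" "exit_point D x (p - x) = x + s *\<^sub>R (p - x)"
    unfolding r_def s_def by (rule exit_point_eq[OF assms(1) ne(1)], rule exit_point_eq[OF assms(1) ne(2)])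
  have ax: "dist (x + r *\<^sub>R (x - p)) x = r * d" and bx: "dist (x + s *\<^sub>R (p - x)) x = s * d"
    using r s by (simp_all add: dist_norm d_def norm_minus_commute)
  have "x + r *\<^sub>R (x - p) - p = (r + 1) *\<^sub>R (x - p)" "x + s *\<^sub>R (p - x) - p = (s - 1) *\<^sub>R (p - x)"
    by (simp_all add: algebra_simps)
  then have ap: "dist (x + r *\<^sub>R (x - p)) p = (r + 1) * d" and bp: "dist (x + s *\<^sub>R (p - x)) p = (s - 1) * d"
    using r s by (simp_all add: dist_norm d_def norm_minus_commute)
  define c where "c = s * (r + 1) / r"
  have rat: "(r * d / (s * d)) / ((r + 1) * d / ((s - 1) * d)) = (s - 1) / c"
  proof -
    have e: "r * d / (s * d) = r / s" "(r + 1) * d / ((s - 1) * d) = (r + 1) / (s - 1)"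
      using d by simp_all
    show ?thesis unfolding e c_def using r s by (simp add: field_simps)
  qed
  have "c = s + s / r" unfolding c_def using r by (simp add: field_simps)
  moreover have "0 < s / r" using r s by simp
  ultimately have c: "s - 1 < c" "0 < c" using s by linarith+
  have "ln (s - 1) < ln c" using c s by simp
  then have "\<bar>ln ((r * d / (s * d)) / ((r + 1) * d / ((s - 1) * d)))\<bar> = ln c - ln (s - 1)"
    unfolding rat using ln_divide_pos[of "s - 1" c] c s by linarith
  then show "hilbert_dist D x p = (ln (s * (r + 1) / r) - ln (s - 1)) / 2"
    using assms(3) unfolding hilbert_dist_def a Let_def ax bx ap bp c_def by (simp only: if_False)
qed

text \<open>The rays from x and y through p leave D at two points tending to z, namely p + (s - 1)
  (p - x) and p + (s' - 1) (p - y) with the respective exit times s and s'. Orthogonality of their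
  difference to the secant normal gives the ratio of s' - 1 to s - 1 exactly, so the two divergent
  logarithms combine to a convergent one.\<close>

lemma busemann_eq:
  assumes x: "x \<in> D" and y: "y \<in> D"
    and g: "tangent_space (frontier D) z = {u. g \<bullet> u = 0}"
    and A: "((\<lambda>p. A (fst p) (snd p)) \<longlongrightarrow> g) (nhds (z, z))"
    and sec: "\<forall>\<^sub>F p in nhds (z, z). fst p \<in> frontier D \<longrightarrow> snd p \<in> frontier D \<longrightarrow>
        A (fst p) (snd p) \<bullet> (fst p - snd p) = 0"
  shows "0 < (g \<bullet> (x - z)) / (g \<bullet> (y - z))"
    and "busemann D z x y = (ln (1 / (1 - depth x)) - ln (1 / (1 - depth y))
           + ln ((g \<bullet> (x - z)) / (g \<bullet> (y - z)))) / 2"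
proof -
  let ?F = "at z within D"
  let ?r = "\<lambda>w p. exit_time D w (w - p)" and ?s = "\<lambda>w p. exit_time D w (p - w)"
  have nb: "?F \<noteq> bot" using z_closure z_notin by (simp add: trivial_limit_within islimpt_in_closure)
  have id: "((\<lambda>p. p) \<longlongrightarrow> z) ?F" by (rule tendsto_ident_at)
  have gn: "g \<bullet> (w - z) \<noteq> 0" if "w \<in> D" for w
    using transversal[OF z_frontier that] unfolding g by simp
  have r: "((\<lambda>p. ?r w p) \<longlongrightarrow> 1 / depth w - 1) ?F" if w: "w \<in> D" for w
    unfolding exit_time_away[OF w, symmetric]
    by (intro exit_time_tendsto tendsto_intros w neq_z)
  have s: "((\<lambda>p. ?s w p) \<longlongrightarrow> 1) ?F" if w: "w \<in> D" for w
    unfolding exit_time_toward[OF w, symmetric]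
    by (intro exit_time_tendsto tendsto_intros w neq_z)
  have L: "((\<lambda>p. ln (?s w p * (?r w p + 1) / ?r w p)) \<longlongrightarrow> ln (1 / (1 - depth w))) ?F" if w: "w \<in> D" for w
  proof -
    have dw: "0 < depth w" "depth w < 1" using depth_bounds[OF w] by auto
    then have nz: "1 / depth w - 1 \<noteq> 0" by (simp add: field_simps)
    have "((\<lambda>p. ?s w p * (?r w p + 1) / ?r w p) \<longlongrightarrow> 1 * (1 / depth w - 1 + 1) / (1 / depth w - 1)) ?F"
      by (intro tendsto_intros r[OF w] s[OF w] nz)
    also have "1 * (1 / depth w - 1 + 1) / (1 / depth w - 1) = 1 / (1 - depth w)"
      using dw by (simp add: field_simps)
    finally show ?thesis using dw by (intro tendsto_ln) auto
  qed
  let ?b = "\<lambda>w p. w + ?s w p *\<^sub>R (p - w)"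
  have b: "((\<lambda>p. ?b w p) \<longlongrightarrow> w + 1 *\<^sub>R (z - w)) ?F" if w: "w \<in> D" for w
    by (intro tendsto_intros s[OF w])
  then have "((\<lambda>p. (?b x p, ?b y p)) \<longlongrightarrow> (z, z)) ?F"
    using x y by (intro tendsto_Pair) simp_all
  then have Ab: "((\<lambda>p. A (?b x p) (?b y p)) \<longlongrightarrow> g) ?F"
    and sb: "\<forall>\<^sub>F p in ?F. ?b x p \<in> frontier D \<longrightarrow> ?b y p \<in> frontier D \<longrightarrow>
      A (?b x p) (?b y p) \<bullet> (?b x p - ?b y p) = 0"
    using filterlim_compose[OF A, of "\<lambda>p. (?b x p, ?b y p)"]
      eventually_compose_filterlim[OF sec, of "\<lambda>p. (?b x p, ?b y p)"] by simp_all
  have nn: "((\<lambda>p. A (?b x p) (?b y p) \<bullet> (p - w)) \<longlongrightarrow> g \<bullet> (z - w)) ?F" for w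
    by (intro tendsto_intros Ab)
  have gz: "g \<bullet> (z - w) \<noteq> 0" if "w \<in> D" for w
    using gn[OF that] by (simp add: inner_diff_right)
  have inD: "\<forall>\<^sub>F p in ?F. p \<in> D" by (simp add: eventually_at_filter)
  have ne: "\<forall>\<^sub>F p in ?F. p \<noteq> w" if "w \<in> D" for w
    using tendsto_imp_eventually_ne[OF id, of w] that z_notin by auto
  have q: "\<forall>\<^sub>F p in ?F. (?s y p - 1) / (?s x p - 1)
      = (A (?b x p) (?b y p) \<bullet> (p - x)) / (A (?b x p) (?b y p) \<bullet> (p - y)) \<and>
      0 < (?s y p - 1) / (?s x p - 1)"
    using sb inD ne[OF x] ne[OF y] tendsto_imp_eventually_ne[OF nn gz[OF y]]
  proof eventually_elim
    case (elim p)
    have s1: "1 < ?s x p" "1 < ?s y p"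
      using hilbert_dist_eq(2)[OF x elim(2)] hilbert_dist_eq(2)[OF y elim(2)] elim by auto
    have "?b x p \<in> frontier D" "?b y p \<in> frontier D"
      using exit_time_frontier[OF x] exit_time_frontier[OF y] elim by simp_all
    then have "A (?b x p) (?b y p) \<bullet> (?b x p - ?b y p) = 0" using elim(1) by simp
    also have "?b x p - ?b y p = (?s x p - 1) *\<^sub>R (p - x) - (?s y p - 1) *\<^sub>R (p - y)"
      by (simp add: algebra_simps)
    finally have "(?s y p - 1) * (A (?b x p) (?b y p) \<bullet> (p - y))
        = (A (?b x p) (?b y p) \<bullet> (p - x)) * (?s x p - 1)"
      by (simp add: inner_diff_right[of _ "_ *\<^sub>R _"] mult.commute)
    then show ?case using s1 elim(5) by (simp add: frac_eq_eq)
  qed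
  have "((\<lambda>p. (A (?b x p) (?b y p) \<bullet> (p - x)) / (A (?b x p) (?b y p) \<bullet> (p - y)))
      \<longlongrightarrow> (g \<bullet> (z - x)) / (g \<bullet> (z - y))) ?F"
    by (intro tendsto_divide nn gz y)
  moreover have "\<forall>\<^sub>F p in ?F. (A (?b x p) (?b y p) \<bullet> (p - x)) / (A (?b x p) (?b y p) \<bullet> (p - y))
      = (?s y p - 1) / (?s x p - 1)"
    using q by eventually_elim simp
  ultimately have lim: "((\<lambda>p. (?s y p - 1) / (?s x p - 1)) \<longlongrightarrow> (g \<bullet> (z - x)) / (g \<bullet> (z - y))) ?F"
    by (rule Lim_transform_eventually)
  have "0 \<le> (g \<bullet> (z - x)) / (g \<bullet> (z - y))"
    by (rule tendsto_lowerbound[OF lim _ nb]) (use q in \<open>auto elim: eventually_mono\<close>)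
  moreover have "(g \<bullet> (z - x)) / (g \<bullet> (z - y)) = (g \<bullet> (x - z)) / (g \<bullet> (y - z))"
  proof -
    have "g \<bullet> (z - w) = - (g \<bullet> (w - z))" for w by (simp add: inner_diff_right)
    then show ?thesis by simp
  qed
  ultimately show pos: "0 < (g \<bullet> (x - z)) / (g \<bullet> (y - z))"
    using gn[OF x] gn[OF y] by (metis divide_eq_0_iff order_le_less)
  have "((\<lambda>p. ln ((?s y p - 1) / (?s x p - 1))) \<longlongrightarrow> ln ((g \<bullet> (x - z)) / (g \<bullet> (y - z)))) ?F"
    using lim pos \<open>_ = (g \<bullet> (x - z)) / (g \<bullet> (y - z))\<close> by (intro tendsto_ln) auto
  from tendsto_divide[OF tendsto_add[OF tendsto_diff[OF L[OF x] L[OF y]] this] tendsto_const[of 2]]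
  have "((\<lambda>p. (ln (?s x p * (?r x p + 1) / ?r x p) - ln (?s y p * (?r y p + 1) / ?r y p)
      + ln ((?s y p - 1) / (?s x p - 1))) / 2) \<longlongrightarrow>
      (ln (1 / (1 - depth x)) - ln (1 / (1 - depth y)) + ln ((g \<bullet> (x - z)) / (g \<bullet> (y - z)))) / 2) ?F"
    by simp
  moreover have "\<forall>\<^sub>F p in ?F. (ln (?s x p * (?r x p + 1) / ?r x p) - ln (?s y p * (?r y p + 1) / ?r y p)
      + ln ((?s y p - 1) / (?s x p - 1))) / 2 = hilbert_dist D x p - hilbert_dist D y p"
    using inD ne[OF x] ne[OF y]
  proof eventually_elim
    case (elim p)
    have ne': "x \<noteq> p" "y \<noteq> p" using elim by auto
    note hx = hilbert_dist_eq[OF x elim(1) ne'(1)] and hy = hilbert_dist_eq[OF y elim(1) ne'(2)]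
    have "ln ((?s y p - 1) / (?s x p - 1)) = ln (?s y p - 1) - ln (?s x p - 1)"
      using hx(2) hy(2) by (intro ln_divide_pos) auto
    then show ?case unfolding hx(3) hy(3) by (simp add: field_simps)
  qed
  ultimately have "((\<lambda>p. hilbert_dist D x p - hilbert_dist D y p) \<longlongrightarrow>
      (ln (1 / (1 - depth x)) - ln (1 / (1 - depth y)) + ln ((g \<bullet> (x - z)) / (g \<bullet> (y - z)))) / 2) ?F"
    by (rule Lim_transform_eventually)
  from tendsto_Lim[OF nb this]
  show "busemann D z x y = (ln (1 / (1 - depth x)) - ln (1 / (1 - depth y))
           + ln ((g \<bullet> (x - z)) / (g \<bullet> (y - z)))) / 2"
    unfolding busemann_def .
qed

text \<open>Without logarithms and denominators the level set equation is affine in y and in depth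
  y, so the derivative of depth suffices to find its tangent vectors.\<close>

lemma horosphere_equation:
  assumes x: "x \<in> D" and y: "y \<in> horosphere D z x"
    and g: "tangent_space (frontier D) z = {u. g \<bullet> u = 0}"
    and A: "((\<lambda>p. A (fst p) (snd p)) \<longlongrightarrow> g) (nhds (z, z))"
    and sec: "\<forall>\<^sub>F p in nhds (z, z). fst p \<in> frontier D \<longrightarrow> snd p \<in> frontier D \<longrightarrow>
        A (fst p) (snd p) \<bullet> (fst p - snd p) = 0"
  shows "(1 - depth x) * (g \<bullet> (y - z)) + (g \<bullet> (x - z)) * depth y = g \<bullet> (x - z)"
proof -
  have yD: "y \<in> D" and b: "busemann D z x y = busemann D z x x" using y by (auto simp: horosphere_def)
  note bxy = busemann_eq[OF x yD g A sec] and bxx = busemann_eq[OF x x g A sec]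
  let ?q = "(g \<bullet> (x - z)) / (g \<bullet> (y - z))"
  have d: "0 < 1 - depth x" "0 < 1 - depth y" using depth_bounds[OF x] depth_bounds[OF yD] by auto
  have gx: "g \<bullet> (x - z) \<noteq> 0" and gy: "g \<bullet> (y - z) \<noteq> 0" using bxx(1) bxy(1) by auto
  have "ln ?q = ln (1 - depth x) - ln (1 - depth y)"
    using b gx d unfolding bxy(2) bxx(2) by (simp add: ln_div)
  also have "\<dots> = ln ((1 - depth x) / (1 - depth y))" using d by (simp add: ln_div)
  finally have "?q = (1 - depth x) / (1 - depth y)"
    using bxy(1) d by (subst (asm) ln_inj_iff) auto
  then have "(g \<bullet> (x - z)) * (1 - depth y) = (1 - depth x) * (g \<bullet> (y - z))"
    using gy d by (simp add: frac_eq_eq)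
  then show ?thesis by (simp add: algebra_simps)
qed

end

section \<open>Transport of horosphere tangent vectors and the chords in their directions\<close>

context smooth_pointed_domain
begin

text \<open>Tangency to the horosphere forces q \<bullet> v = - (1 - depth x) \<kappa>. Inserted
  into the derivative of \<open>contraction\<close>, this changes the radial coefficient from
  \<kappa> E to \<kappa> E^2, with E = contraction t x, while u is multiplied by E: the radial part
  becomes negligible.\<close>

lemma horosphere_tangent_vector:
  assumes x: "x \<in> D" and v: "v \<in> tangent_space (horosphere D z x) x" "v \<noteq> 0"
  obtains u \<kappa> where "u \<noteq> 0" "u \<in> tangent_space (frontier D) z" "v = u + \<kappa> *\<^sub>R (x - z)"
    and "\<forall>t. parallel_transport D z t x v
      = (exp t * contraction t x) *\<^sub>R (u + (\<kappa> * contraction t x) *\<^sub>R (x - z))"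
proof -
  obtain g A where g: "tangent_space (frontier D) z = {u. g \<bullet> u = 0}"
    and A: "((\<lambda>p. A (fst p) (snd p)) \<longlongrightarrow> g) (nhds (z, z))"
    and sec: "\<forall>\<^sub>F p in nhds (z, z). fst p \<in> frontier D \<longrightarrow> snd p \<in> frontier D \<longrightarrow>
        A (fst p) (snd p) \<bullet> (fst p - snd p) = 0"
    by (rule C1_hypersurface_normal[OF C1 z_frontier])
  obtain q where q: "(depth has_derivative (\<lambda>h. q \<bullet> h)) (at x)" "q \<bullet> (x - z) = depth x"
    by (rule depth_has_derivative[OF x])
  have gx: "g \<bullet> (x - z) \<noteq> 0"
    using transversal[OF z_frontier x] unfolding g by simp
  have mx: "0 < depth x" "depth x < 1" using depth_bounds[OF x] by auto
  let ?\<psi> = "\<lambda>y. (1 - depth x) * (g \<bullet> (y - z)) + (g \<bullet> (x - z)) * depth y"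
  have "(?\<psi> has_derivative (\<lambda>h. ((1 - depth x) *\<^sub>R g + (g \<bullet> (x - z)) *\<^sub>R q) \<bullet> h)) (at x)"
    by (auto intro!: derivative_eq_intros q(1) simp: inner_add_left)
  moreover have "\<forall>\<^sub>F y in nhds x. y \<in> horosphere D z x \<longrightarrow> ?\<psi> y = g \<bullet> (x - z)"
    by (intro always_eventually allI impI horosphere_equation[OF x _ g A sec])
  moreover have "?\<psi> x = g \<bullet> (x - z)" by (simp add: algebra_simps)
  ultimately have "((1 - depth x) *\<^sub>R g + (g \<bullet> (x - z)) *\<^sub>R q) \<bullet> v = 0"
    using v(1) by (rule tangent_space_orthogonal)
  then have qv: "(1 - depth x) * (g \<bullet> v) + (g \<bullet> (x - z)) * (q \<bullet> v) = 0"
    by (simp add: inner_add_left)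
  define \<kappa> where "\<kappa> = (g \<bullet> v) / (g \<bullet> (x - z))"
  define u where "u = v - \<kappa> *\<^sub>R (x - z)"
  have gv: "g \<bullet> v = \<kappa> * (g \<bullet> (x - z))" using gx by (simp add: \<kappa>_def)
  have "(g \<bullet> (x - z)) * (q \<bullet> v + (1 - depth x) * \<kappa>) = 0"
    using qv unfolding gv by (simp add: algebra_simps)
  then have qv': "q \<bullet> v = - ((1 - depth x) * \<kappa>)" using gx by (simp add: eq_neg_iff_add_eq_0)
  have vu: "v = u + \<kappa> *\<^sub>R (x - z)" by (simp add: u_def)
  have 1: "u \<in> tangent_space (frontier D) z"
    unfolding g using gv by (simp add: u_def inner_diff_right)
  \<comment> \<open>For a purely radial v Euler's relation gives q \<bullet> v = \<kappa> depth x,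
    and tangency gives - (1 - depth x) \<kappa>; the two agree only for \<kappa> = 0.\<close>
  have 2: "u \<noteq> 0"
  proof
    assume u0: "u = 0"
    have "q \<bullet> v = \<kappa> * depth x" unfolding vu u0 using q(2) by simp
    then have "\<kappa> = 0" unfolding qv' by (simp add: algebra_simps)
    then show False using vu v(2) u0 by simp
  qed
  have 3: "\<forall>t. parallel_transport D z t x v
      = (exp t * contraction t x) *\<^sub>R (u + (\<kappa> * contraction t x) *\<^sub>R (x - z))"
  proof
    fix t
    let ?e = "exp (2 * t)" and ?E = "contraction t x"
    let ?l = "\<lambda>y. depth y + ?e * (1 - depth y)"
    have l: "?l x \<noteq> 0" using contraction_denom[OF x, of t] mx by linarith
    have "(?l has_derivative (\<lambda>h. q \<bullet> h + ?e * (0 - q \<bullet> h))) (at x)"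
      by (intro has_derivative_add has_derivative_mult_right has_derivative_diff
          has_derivative_const q(1))
    then have "(?l has_derivative (\<lambda>h. (1 - ?e) * (q \<bullet> h))) (at x)"
      by (simp add: algebra_simps)
    from Deriv.has_derivative_inverse[OF l this]
    have "((\<lambda>y. contraction t y) has_derivative (\<lambda>h. - (?E * ((1 - ?e) * (q \<bullet> h)) * ?E))) (at x)"
      by (simp add: contraction_def inverse_eq_divide)
    moreover have "((\<lambda>y. y - z) has_derivative (\<lambda>h. h)) (at x)"
      by (auto intro!: derivative_eq_intros)
    ultimately have "((\<lambda>y. contraction t y *\<^sub>R (y - z)) has_derivative
        (\<lambda>h. ?E *\<^sub>R h + (- (?E * ((1 - ?e) * (q \<bullet> h)) * ?E)) *\<^sub>R (x - z))) (at x)"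
      by (rule has_derivative_scaleR)
    from has_derivative_add[OF has_derivative_const[of z] this]
    have der: "((\<lambda>y. z + contraction t y *\<^sub>R (y - z)) has_derivative
        (\<lambda>h. ?E *\<^sub>R h + (- (?E * ((1 - ?e) * (q \<bullet> h)) * ?E)) *\<^sub>R (x - z))) (at x)"
      by (simp only: add_0)
    have "(radial_flow D z t has_derivative
        (\<lambda>h. ?E *\<^sub>R h + (- (?E * ((1 - ?e) * (q \<bullet> h)) * ?E)) *\<^sub>R (x - z))) (at x)"
      by (rule has_derivative_transform_within_open[OF der open_D x]) (simp add: radial_flow_eq)
    from fun_cong[OF frechet_derivative_at[OF this], of v]
    have fr: "frechet_derivative (radial_flow D z t) (at x) v
        = ?E *\<^sub>R v + (- (?E * ((1 - ?e) * (q \<bullet> v)) * ?E)) *\<^sub>R (x - z)" by (rule sym)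
    have lE: "?l x * ?E = 1" using l by (simp add: contraction_def)
    have "- (?E * ((1 - ?e) * (q \<bullet> v)) * ?E) = \<kappa> * ?E * (?E * ((1 - ?e) * (1 - depth x)))"
      unfolding qv' by (simp add: algebra_simps)
    also have "(1 - ?e) * (1 - depth x) = 1 - ?l x" by (simp add: algebra_simps)
    also have "?E * (1 - ?l x) = ?E - ?l x * ?E" by (simp add: algebra_simps)
    finally have c: "- (?E * ((1 - ?e) * (q \<bullet> v)) * ?E) = \<kappa> * ?E * (?E - 1)"
      unfolding lE .
    show "parallel_transport D z t x v
      = (exp t * contraction t x) *\<^sub>R (u + (\<kappa> * contraction t x) *\<^sub>R (x - z))"
      unfolding parallel_transport_def fr c by (simp add: vu algebra_simps)
  qed
  show ?thesis by (rule that[OF 2 1 vu 3])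
qed

text \<open>The two signs \<open>s\<close> give the two ends of the chord in the direction of the transported vector.\<close>

definition transport_exit :: "'a \<Rightarrow> 'a \<Rightarrow> real \<Rightarrow> real \<Rightarrow> real \<Rightarrow> real" where
  "transport_exit x u \<kappa> s \<epsilon> = exit_time D (z + \<epsilon> *\<^sub>R (x - z)) (s *\<^sub>R (u + (\<kappa> * \<epsilon>) *\<^sub>R (x - z)))"

lemma transport_direction_nonzero:
  assumes x: "x \<in> D" and u: "u \<in> tangent_space (frontier D) z" "u \<noteq> 0" and s: "s \<noteq> 0"
  shows "s *\<^sub>R (u + c *\<^sub>R (x - z)) \<noteq> 0"
proof
  assume "s *\<^sub>R (u + c *\<^sub>R (x - z)) = 0"
  then have e: "u + c *\<^sub>R (x - z) = 0" using s by simp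
  obtain g where g: "tangent_space (frontier D) z = {u. g \<bullet> u = 0}"
    by (rule C1_hypersurface_normal[OF C1 z_frontier])
  have "g \<bullet> (x - z) \<noteq> 0"
    using transversal[OF z_frontier x] unfolding g by simp
  moreover have "g \<bullet> (u + c *\<^sub>R (x - z)) = 0" unfolding e by simp
  then have "c * (g \<bullet> (x - z)) = 0" using u(1) unfolding g by (simp add: inner_add_right)
  ultimately have "c = 0" by simp
  then show False using e u(2) by simp
qed

lemma finsler_parallel_transport:
  assumes x: "x \<in> D" and u: "u \<in> tangent_space (frontier D) z" "u \<noteq> 0"
    and p: "parallel_transport D z t x v
      = (exp t * contraction t x) *\<^sub>R (u + (\<kappa> * contraction t x) *\<^sub>R (x - z))"
  shows "finsler D (radial_flow D z t x) (parallel_transport D z t x v)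
    = exp t * contraction t x * ((1 / transport_exit x u \<kappa> 1 (contraction t x)
        + 1 / transport_exit x u \<kappa> (- 1) (contraction t x)) / 2)"
proof -
  let ?E = "contraction t x" and ?h = "u + (\<kappa> * contraction t x) *\<^sub>R (x - z)"
  have h: "?h \<noteq> 0" using transport_direction_nonzero[OF x u, of 1] by simp
  have "finsler D (z + ?E *\<^sub>R (x - z)) ((exp t * ?E) *\<^sub>R ?h)
      = exp t * ?E * finsler D (z + ?E *\<^sub>R (x - z)) ?h"
    by (intro finsler_scale contraction_in_D x h mult_pos_pos exp_gt_zero contraction_pos)
  then show ?thesis
    unfolding p radial_flow_eq[OF x] transport_exit_def
    by (simp only: finsler_eq[OF contraction_in_D[OF x] h] scaleR_one scaleR_minus_left)
qed

text \<open>At \<epsilon> = 0 the half-chord degenerates to the tangent ray from z in direction s u.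
  By \<open>out\<close> that ray is off the closure at each fixed time a > 0, an open condition that
  persists for small \<epsilon>.\<close>

lemma transport_exit_tendsto_0:
  assumes x: "x \<in> D" and u: "u \<in> tangent_space (frontier D) z" "u \<noteq> 0" and s: "s \<noteq> 0"
    and out: "\<And>\<delta>. \<delta> > 0 \<Longrightarrow> z + (\<delta> * s) *\<^sub>R u \<notin> closure D"
  shows "filterlim (transport_exit x u \<kappa> s) (at_right 0) (at_right 0)"
proof -
  have pos: "0 < transport_exit x u \<kappa> s \<epsilon>" if "0 < \<epsilon>" "\<epsilon> < 1" for \<epsilon>
    unfolding transport_exit_def
    using segment_in_D[OF x z_closure] that
    by (intro exit_time_pos transport_direction_nonzero[OF x u s]) auto
  have small: "\<forall>\<^sub>F \<epsilon> in at_right 0. 0 < \<epsilon> \<and> \<epsilon> < (1::real)"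
    using eventually_at_right_real[OF zero_less_one] by simp
  have "(transport_exit x u \<kappa> s \<longlongrightarrow> 0) (at_right 0)"
  proof (rule order_tendstoI)
    fix a :: real assume "a < 0"
    show "\<forall>\<^sub>F \<epsilon> in at_right 0. a < transport_exit x u \<kappa> s \<epsilon>"
      using small
    proof eventually_elim
      case (elim \<epsilon>)
      then show ?case using pos[of \<epsilon>] \<open>a < 0\<close> by simp
    qed
  next
    fix a :: real assume a: "0 < a"
    have "((\<lambda>\<epsilon>. z + \<epsilon> *\<^sub>R (x - z) + a *\<^sub>R (s *\<^sub>R (u + (\<kappa> * \<epsilon>) *\<^sub>R (x - z)))) \<longlongrightarrow>
        z + 0 *\<^sub>R (x - z) + a *\<^sub>R (s *\<^sub>R (u + (\<kappa> * 0) *\<^sub>R (x - z)))) (at_right 0)"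
      by (intro tendsto_intros)
    then have "\<forall>\<^sub>F \<epsilon> in at_right 0. z + \<epsilon> *\<^sub>R (x - z) + a *\<^sub>R (s *\<^sub>R (u + (\<kappa> * \<epsilon>) *\<^sub>R (x - z))) \<in> - closure D"
      using out[OF a] by (intro topological_tendstoD) auto
    with small show "\<forall>\<^sub>F \<epsilon> in at_right 0. transport_exit x u \<kappa> s \<epsilon> < a"
    proof eventually_elim
      case (elim \<epsilon>)
      let ?p = "z + \<epsilon> *\<^sub>R (x - z)" and ?h = "s *\<^sub>R (u + (\<kappa> * \<epsilon>) *\<^sub>R (x - z))"
      have p: "?p \<in> D" using segment_in_D[OF x z_closure, of \<epsilon>] elim by simp
      have h: "?h \<noteq> 0" by (rule transport_direction_nonzero[OF x u s])
      have "?p + a *\<^sub>R ?h \<notin> closure D" using elim by simp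
      then have "?p + a *\<^sub>R ?h \<notin> D" "?p + a *\<^sub>R ?h \<notin> frontier D"
        using closure_subset by (auto simp: frontier_def)
      then have "\<not> a < exit_time D ?p ?h" "a \<noteq> exit_time D ?p ?h"
        using before_exit_time[OF p h, of a] exit_time_frontier[OF p h] a by auto
      then show ?case by (simp add: transport_exit_def)
    qed
  qed
  then show ?thesis
    unfolding filterlim_at_right_0_iff using small pos by (auto elim: eventually_mono)
qed

text \<open>Regrouped by directions, the chord end has the coefficient \<epsilon> (1 + \<kappa> r)
  along x - z. Once r is small this is comparable to \<epsilon>, whatever \<kappa> is.\<close>

lemma transport_exit_frontier:
  fixes \<kappa> :: real
  assumes x: "x \<in> D" and u: "u \<in> tangent_space (frontier D) z" "u \<noteq> 0" and s: "s \<noteq> 0"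
    and e: "0 < \<epsilon>" "\<epsilon> < 1"
  defines "r \<equiv> s * transport_exit x u \<kappa> s \<epsilon>"
  shows "z + r *\<^sub>R u + (\<epsilon> * (1 + \<kappa> * r)) *\<^sub>R (x - z) \<in> frontier D"
proof -
  have p: "z + \<epsilon> *\<^sub>R (x - z) \<in> D" using segment_in_D[OF x z_closure, of \<epsilon>] e by simp
  have "z + \<epsilon> *\<^sub>R (x - z) + transport_exit x u \<kappa> s \<epsilon> *\<^sub>R (s *\<^sub>R (u + (\<kappa> * \<epsilon>) *\<^sub>R (x - z))) \<in> frontier D"
    unfolding transport_exit_def
    by (rule exit_time_frontier[OF p transport_direction_nonzero[OF x u s]])
  then show ?thesis by (simp add: r_def algebra_simps)
qed

end

section \<open>The boundary as a convex graph\<close>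

text \<open>The derivative of \<open>f\<close> vanishes at 0 and is continuous, so \<open>f\<close>
  has an arbitrarily small Lipschitz constant in direction k near 0. This absorbs the shift of the
  base point that arises when the slice is not spanned by the normal.\<close>

lemma tilted_increment_bound:
  fixes f :: "'a::euclidean_space \<Rightarrow> real"
  assumes T: "subspace T" and r: "r > 0"
    and der: "\<And>w. w \<in> T \<Longrightarrow> norm w < r \<Longrightarrow> (f has_derivative f' w) (at w within T)"
    and cont: "continuous_on (T \<inter> ball 0 r) (\<lambda>w. f' w k)"
    and f'0: "f' 0 k = 0" and k: "k \<in> T" and c: "c > 0"
  shows "\<exists>d>0. \<forall>w\<in>T. \<forall>b. norm w < d \<longrightarrow> norm (w + b *\<^sub>R k) < d \<longrightarrow>
    \<bar>f (w + b *\<^sub>R k) - f w\<bar> \<le> c * \<bar>b\<bar>"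
proof -
  have "0 \<in> T \<inter> ball 0 r" using T r by (simp add: subspace_0)
  then obtain d0 where d0: "d0 > 0"
    "\<And>w. w \<in> T \<inter> ball 0 r \<Longrightarrow> dist w 0 < d0 \<Longrightarrow> dist (f' w k) (f' 0 k) < c"
    using cont c unfolding continuous_on_iff by metis
  define d where "d = min d0 r"
  show ?thesis
  proof (intro exI[of _ d] conjI ballI allI impI)
    show "d > 0" using d0 r by (simp add: d_def)
    fix w b assume w: "w \<in> T" "norm w < d" "norm (w + b *\<^sub>R k) < d"
    let ?p = "\<lambda>t. w + t *\<^sub>R (b *\<^sub>R k)"
    have pT: "?p t \<in> T" for t using T w(1) k by (intro subspace_add subspace_scale)
    have pd: "norm (?p t) < d" if "0 \<le> t" "t \<le> 1" for t
    proof -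
      have "?p t = (1 - t) *\<^sub>R w + t *\<^sub>R (w + b *\<^sub>R k)" by (simp add: algebra_simps)
      moreover have "\<dots> \<in> ball 0 d"
        using convexD_alt[OF convex_ball[of 0 d], of w "w + b *\<^sub>R k" t] w that by simp
      ultimately show ?thesis by simp
    qed
    have "\<exists>t\<in>{0<..<1}. f (?p 1) - f (?p 0) = (\<lambda>h. f' (?p t) (h *\<^sub>R (b *\<^sub>R k))) (1 - 0)"
    proof (rule mvt_simple[of 0 1 "\<lambda>t. f (?p t)"])
      fix t :: real assume t: "0 \<le> t" "t \<le> 1"
      have "(?p has_derivative (\<lambda>h. h *\<^sub>R (b *\<^sub>R k))) (at t within {0..1})"
        by (auto intro!: derivative_eq_intros)
      moreover have "(f has_derivative f' (?p t)) (at (?p t) within ?p ` {0..1})"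
        using pd[OF t] pT by (intro has_derivative_subset[OF der[OF pT]]) (auto simp: d_def)
      ultimately show "((\<lambda>t. f (?p t)) has_derivative (\<lambda>h. f' (?p t) (h *\<^sub>R (b *\<^sub>R k)))) (at t within {0..1})"
        by (rule has_derivative_in_compose)
    qed simp
    then obtain t where t: "0 < t" "t < 1" and eq: "f (w + b *\<^sub>R k) - f w = f' (?p t) (b *\<^sub>R k)"
      by auto
    have n: "norm (?p t) < d" using pd t by simp
    then have "bounded_linear (f' (?p t))"
      using der[OF pT] by (intro has_derivative_bounded_linear) (auto simp: d_def)
    then have "f' (?p t) (b *\<^sub>R k) = b * f' (?p t) k"
      by (simp add: linear_cmul bounded_linear.linear)
    moreover have "\<bar>f' (?p t) k\<bar> \<le> c"
      using d0(2)[of "?p t"] n pT f'0 by (simp add: d_def dist_real_def)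
    ultimately show "\<bar>f (w + b *\<^sub>R k) - f w\<bar> \<le> c * \<bar>b\<bar>"
      unfolding eq using mult_left_mono[of "\<bar>f' (?p t) k\<bar>" c "\<bar>b\<bar>"]
      by (simp add: abs_mult mult.commute)
  qed
qed

locale convex_graph =
  fixes T :: "'a::euclidean_space set" and f :: "'a \<Rightarrow> real" and f' :: "'a \<Rightarrow> 'a \<Rightarrow> real" and r :: real
  assumes T: "subspace T" and r: "r > 0"
    and strict: "\<And>w w' s. w \<in> T \<Longrightarrow> norm w < r \<Longrightarrow> w' \<in> T \<Longrightarrow> norm w' < r \<Longrightarrow> w \<noteq> w' \<Longrightarrow>
        0 < s \<Longrightarrow> s < 1 \<Longrightarrow> f ((1 - s) *\<^sub>R w + s *\<^sub>R w') < (1 - s) * f w + s * f w'"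
    and der: "\<And>w. w \<in> T \<Longrightarrow> norm w < r \<Longrightarrow> (f has_derivative f' w) (at w within T)"
    and cont: "\<And>h. h \<in> T \<Longrightarrow> continuous_on (T \<inter> ball 0 r) (\<lambda>w. f' w h)"
    and nonneg: "\<And>w. w \<in> T \<Longrightarrow> norm w < r \<Longrightarrow> f w \<ge> 0"
    and f0: "f 0 = 0" and f'0: "\<And>h. h \<in> T \<Longrightarrow> f' 0 h = 0"
begin

lemma shrink_less:
  assumes "w \<in> T" "norm w < r" "w \<noteq> 0" "0 < s" "s < 1"
  shows "f (s *\<^sub>R w) < s * f w"
  using strict[of 0 w s] assms T r f0 by (simp add: subspace_0)

lemma graph_pos:
  assumes "w \<in> T" "norm w < r" "w \<noteq> 0"
  shows "0 < f w"
proof -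
  have "norm ((1 / 2) *\<^sub>R w) < r" using assms(2) r by simp
  then have "0 \<le> f ((1 / 2) *\<^sub>R w)"
    using assms T by (intro nonneg) (simp_all add: subspace_scale)
  also have "\<dots> < 1 / 2 * f w" using shrink_less[OF assms, of "1 / 2"] by simp
  finally show ?thesis by simp
qed

lemma ray_strict_mono:
  assumes u: "u \<in> T" "u \<noteq> 0" and s: "0 < s" "s < t" and t: "t * norm u < r"
  shows "f (s *\<^sub>R u) < f (t *\<^sub>R u)"
proof -
  have w: "t *\<^sub>R u \<in> T" "norm (t *\<^sub>R u) < r" "t *\<^sub>R u \<noteq> 0"
    using u s t T by (auto simp: subspace_scale)
  have "f ((s / t) *\<^sub>R (t *\<^sub>R u)) < (s / t) * f (t *\<^sub>R u)"
    using s by (intro shrink_less w) auto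
  also have "\<dots> < 1 * f (t *\<^sub>R u)"
    using s graph_pos[OF w] by (intro mult_strict_right_mono) auto
  finally show ?thesis using s by simp
qed

definition mean_height :: "'a \<Rightarrow> real \<Rightarrow> real" where
  "mean_height u s = (f (s *\<^sub>R u) + f (- s *\<^sub>R u)) / 2"

lemma mean_height_pos:
  assumes u: "u \<in> T" "u \<noteq> 0" and s: "0 < s" "s * norm u < r"
  shows "0 < mean_height u s"
  using graph_pos[of "s *\<^sub>R u"] graph_pos[of "- s *\<^sub>R u"] assms T
  by (simp add: mean_height_def subspace_scale subspace_neg)

lemma mean_height_strict_mono:
  assumes u: "u \<in> T" "u \<noteq> 0" and s: "0 < s" "s < t" "t * norm u < r"
  shows "mean_height u s < mean_height u t"
  using ray_strict_mono[OF assms] ray_strict_mono[of "- u" s t] assms T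
  by (simp add: mean_height_def subspace_neg)

text \<open>A consequence of the zero derivative at 0. With h the mean height, it keeps ln s / ln (h
  s) between 0 and 1 for small s, which bounds the ratio of logarithms in the growth
  estimate.\<close>

lemma mean_height_le:
  assumes u: "u \<in> T"
  shows "\<exists>d>0. \<forall>s. 0 < s \<longrightarrow> s < d \<longrightarrow> mean_height u s \<le> s"
proof -
  obtain d where d: "d > 0" "\<forall>w\<in>T. \<forall>b. norm w < d \<longrightarrow> norm (w + b *\<^sub>R u) < d \<longrightarrow>
      \<bar>f (w + b *\<^sub>R u) - f w\<bar> \<le> 1 * \<bar>b\<bar>"
    using tilted_increment_bound[OF T r der cont[OF u] f'0[OF u] u zero_less_one] by metis
  have *: "f (b *\<^sub>R u) \<le> \<bar>b\<bar>" if "\<bar>b\<bar> * norm u < d" for b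
    using d(2)[rule_format, of 0 b] d(1) that T f0 by (simp add: subspace_0)
  show ?thesis
  proof (intro exI[of _ "d / (norm u + 1)"] conjI allI impI)
    show "0 < d / (norm u + 1)" using d by (simp add: add_nonneg_pos)
    fix s :: real assume s: "0 < s" "s < d / (norm u + 1)"
    then have "s * (norm u + 1) < d" by (simp add: pos_less_divide_eq add_nonneg_pos)
    then have "\<bar>s\<bar> * norm u < d" using s by (simp add: distrib_left)
    then show "mean_height u s \<le> s"
      using *[of s] *[of "- s"] s by (simp add: mean_height_def)
  qed
qed

text \<open>At the smaller of p and q one side has its height between c and C, and monotonicity
  along the ray keeps the other side below C. The factor 1 / 2 is lost because that other height may
  be negligible, as for a very asymmetric boundary.\<close>

lemma mean_height_min:
  assumes u: "u \<in> T" "u \<noteq> 0" and \<sigma>: "\<sigma> = 1 \<or> \<sigma> = - (1::real)"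
    and p: "0 < p" "p * norm u < r" and q: "0 < q" "q * norm u < r"
    and fp: "c \<le> f ((\<sigma> * p) *\<^sub>R u)" "f ((\<sigma> * p) *\<^sub>R u) \<le> C"
    and fq: "c \<le> f ((- \<sigma> * q) *\<^sub>R u)" "f ((- \<sigma> * q) *\<^sub>R u) \<le> C"
  shows "c / 2 \<le> mean_height u (min p q)" "mean_height u (min p q) \<le> C"
proof -
  define w where "w = \<sigma> *\<^sub>R u"
  have w: "w \<in> T" "w \<noteq> 0" "- w \<in> T" "- w \<noteq> 0" "norm w = norm u"
    using u \<sigma> T by (auto simp: w_def subspace_neg)
  have m: "mean_height u s = (f (s *\<^sub>R w) + f (s *\<^sub>R (- w))) / 2" for s
    using \<sigma> by (auto simp: mean_height_def w_def)
  have fw: "c \<le> f (p *\<^sub>R w)" "f (p *\<^sub>R w) \<le> C" "c \<le> f (q *\<^sub>R (- w))" "f (q *\<^sub>R (- w)) \<le> C"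
    using fp fq by (simp_all add: w_def mult.commute)
  have nn: "0 \<le> f (s *\<^sub>R w)" "0 \<le> f (s *\<^sub>R (- w))" if "0 < s" "s * norm u < r" for s
    using that w T by (auto intro!: nonneg subspace_scale simp: subspace_neg subspace_scale)
  have "p = q \<or> p < q \<or> q < p" by linarith
  then have "c / 2 \<le> mean_height u (min p q) \<and> mean_height u (min p q) \<le> C"
  proof (elim disjE)
    assume "p = q" then show ?thesis using fw nn[OF p] unfolding m by simp
  next
    assume pq: "p < q"
    have "f (p *\<^sub>R (- w)) < f (q *\<^sub>R (- w))"
      using ray_strict_mono[OF w(3,4) p(1) pq] q w by simp
    then have "f (p *\<^sub>R (- w)) \<le> C" using fw by linarith
    then show ?thesis using pq fw nn[OF p] unfolding m by simp
  next
    assume qp: "q < p"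
    have "f (q *\<^sub>R w) < f (p *\<^sub>R w)"
      using ray_strict_mono[OF w(1,2) q(1) qp] p w by simp
    then have "f (q *\<^sub>R w) \<le> C" using fw by linarith
    then show ?thesis using qp fw nn[OF q] unfolding m by simp
  qed
  then show "c / 2 \<le> mean_height u (min p q)" "mean_height u (min p q) \<le> C" by auto
qed

lemma graph_exponents_at_right:
  "upper_graph_exponent f u = Limsup (at_right 0) (\<lambda>s. ereal (ln (mean_height u s) / ln s))"
  "lower_graph_exponent f u = Liminf (at_right 0) (\<lambda>s. ereal (ln (mean_height u s) / ln s))"
proof -
  let ?g = "\<lambda>t. ereal (ln ((f (t *\<^sub>R u) + f (- t *\<^sub>R u)) / 2) / ln \<bar>t\<bar>)"
  have even: "?g (- t) = ?g t" for t by (simp add: add.commute)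
  have ev: "\<forall>\<^sub>F s in at_right 0. ?g s = ereal (ln (mean_height u s) / ln s)"
    using eventually_at_right_less[of 0] by eventually_elim (simp add: mean_height_def)
  show "upper_graph_exponent f u = Limsup (at_right 0) (\<lambda>s. ereal (ln (mean_height u s) / ln s))"
    unfolding upper_graph_exponent_def Limsup_Liminf_at_0_even(1)[of ?g, OF even] by (rule Limsup_eq[OF ev])
  show "lower_graph_exponent f u = Liminf (at_right 0) (\<lambda>s. ereal (ln (mean_height u s) / ln s))"
    unfolding lower_graph_exponent_def Limsup_Liminf_at_0_even(2)[of ?g, OF even] by (rule Liminf_eq[OF ev])
qed

end

text \<open>The two-dimensional slice of \<open>D\<close> through \<open>z\<close> spanned by \<open>u\<close> and \<open>x - z\<close>, read in a second
  chart, where \<open>z\<close>, \<open>u\<close>, \<open>x - z\<close> become \<open>z'\<close>, \<open>u'\<close>, \<open>e\<close> up to the projective factors.\<close>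

locale boundary_slice = smooth_pointed_domain D z + convex_graph T f f' r
  for D :: "'a::euclidean_space set" and z and T :: "'a set" and f f' r +
  fixes x u u' e \<nu> z' :: 'a and dz dx \<delta> :: real and S N :: "'a set"
  assumes x: "x \<in> D" and u: "u \<in> tangent_space (frontier D) z" "u \<noteq> 0"
    and dz: "dz \<noteq> 0" and dx: "dx \<noteq> 0"
    and slice: "\<And>a b. z + a *\<^sub>R u + b *\<^sub>R (x - z) \<in> frontier D \<Longrightarrow> (1 - b) * dz + b * dx + a * \<delta> \<noteq> 0 \<Longrightarrow>
      z' + (a * (dx / ((1 - b) * dz + b * dx + a * \<delta>))) *\<^sub>R u'
         + (b * (dx / ((1 - b) * dz + b * dx + a * \<delta>))) *\<^sub>R e \<in> S"
    and T_eq: "T = {w. \<nu> \<bullet> w = 0}" and \<nu>: "norm \<nu> = 1"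
    and u': "u' \<in> T" "u' \<noteq> 0" and e: "\<nu> \<bullet> e \<noteq> 0"
    and N: "open N" "z' \<in> N"
    and SN: "S \<inter> N = (\<lambda>w. z' + w + f w *\<^sub>R \<nu>) ` (T \<inter> ball 0 r)"
begin

text \<open>The tangential part of \<open>e\<close>. Moving by \<beta> along \<open>e\<close> raises
  the height by \<beta> (\<nu> \<bullet> e) and shifts the base point by \<beta> k.\<close>

definition k :: 'a where "k = e - (\<nu> \<bullet> e) *\<^sub>R \<nu>"

lemma \<nu>\<nu>: "\<nu> \<bullet> \<nu> = 1"
  using \<nu> by (simp add: dot_square_norm)

lemma k_in_T: "k \<in> T"
  by (simp add: T_eq k_def inner_diff_right \<nu>\<nu>)

lemma boundary_height:
  assumes "z' + \<alpha> *\<^sub>R u' + \<beta> *\<^sub>R e \<in> S" "z' + \<alpha> *\<^sub>R u' + \<beta> *\<^sub>R e \<in> N"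
  shows "norm (\<alpha> *\<^sub>R u' + \<beta> *\<^sub>R k) < r" "f (\<alpha> *\<^sub>R u' + \<beta> *\<^sub>R k) = \<beta> * (\<nu> \<bullet> e)"
proof -
  have "z' + \<alpha> *\<^sub>R u' + \<beta> *\<^sub>R e \<in> (\<lambda>w. z' + w + f w *\<^sub>R \<nu>) ` (T \<inter> ball 0 r)"
    using assms SN by blast
  then obtain w where w: "w \<in> T" "norm w < r" "z' + \<alpha> *\<^sub>R u' + \<beta> *\<^sub>R e = z' + w + f w *\<^sub>R \<nu>"
    by auto
  then have eq: "\<alpha> *\<^sub>R u' + \<beta> *\<^sub>R e = w + f w *\<^sub>R \<nu>" by (simp add: add.assoc)
  have "\<nu> \<bullet> (\<alpha> *\<^sub>R u' + \<beta> *\<^sub>R e) = \<nu> \<bullet> (w + f w *\<^sub>R \<nu>)" unfolding eq ..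
  then have fw: "f w = \<beta> * (\<nu> \<bullet> e)"
    using w(1) u'(1) by (simp add: T_eq inner_add_right \<nu>\<nu>)
  have "\<alpha> *\<^sub>R u' + \<beta> *\<^sub>R k = w"
    using eq unfolding fw k_def by (simp add: algebra_simps)
  then show "norm (\<alpha> *\<^sub>R u' + \<beta> *\<^sub>R k) < r" "f (\<alpha> *\<^sub>R u' + \<beta> *\<^sub>R k) = \<beta> * (\<nu> \<bullet> e)"
    using w(2) fw by simp_all
qed

text \<open>Otherwise the open segment from z to this point would lie in the closure and, by
  transversality, outside D, hence in the frontier. Read in the second chart near z' it would give
  zeros of \<open>f\<close> other than 0, against strict convexity.\<close>

lemma outside_closure:
  assumes c: "c \<noteq> 0"
  shows "z + c *\<^sub>R u \<notin> closure D"
proof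
  assume cl: "z + c *\<^sub>R u \<in> closure D"
  obtain g where g: "tangent_space (frontier D) z = {u. g \<bullet> u = 0}"
    by (rule C1_hypersurface_normal[OF C1 z_frontier])
  have fr: "z + (\<theta> * c) *\<^sub>R u + 0 *\<^sub>R (x - z) \<in> frontier D" if "0 < \<theta>" "\<theta> < 1" for \<theta>
  proof -
    have "(1 - \<theta>) *\<^sub>R z + \<theta> *\<^sub>R (z + c *\<^sub>R u) \<in> closure D"
      using convexD_alt[OF convex_closure[OF convex_D] z_closure cl, of \<theta>] that by simp
    moreover have "(1 - \<theta>) *\<^sub>R z + \<theta> *\<^sub>R (z + c *\<^sub>R u) = z + (\<theta> * c) *\<^sub>R u + 0 *\<^sub>R (x - z)"
      by (simp add: algebra_simps)
    moreover have "z + (\<theta> * c) *\<^sub>R u + 0 *\<^sub>R (x - z) \<notin> D"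
      using transversal[OF z_frontier, of "z + (\<theta> * c) *\<^sub>R u"] u(1) unfolding g by auto
    ultimately show ?thesis by (simp add: frontier_def interior_open open_D)
  qed
  let ?q = "\<lambda>\<theta>. dx / ((1 - 0) * dz + 0 * dx + (\<theta> * c) * \<delta>)"
  have den: "((\<lambda>\<theta>. (1 - 0) * dz + 0 * dx + (\<theta> * c) * \<delta>) \<longlongrightarrow> (1 - 0) * dz + 0 * dx + (0 * c) * \<delta>) (at_right 0)"
    by (intro tendsto_intros)
  then have q: "(?q \<longlongrightarrow> dx / ((1 - 0) * dz + 0 * dx + (0 * c) * \<delta>)) (at_right 0)"
    using dz by (intro tendsto_divide tendsto_const) auto
  have "((\<lambda>\<theta>. z' + ((\<theta> * c) * ?q \<theta>) *\<^sub>R u' + (0 * ?q \<theta>) *\<^sub>R e)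
      \<longlongrightarrow> z' + ((0 * c) * (dx / ((1 - 0) * dz + 0 * dx + (0 * c) * \<delta>))) *\<^sub>R u'
        + (0 * (dx / ((1 - 0) * dz + 0 * dx + (0 * c) * \<delta>))) *\<^sub>R e) (at_right 0)"
    by (intro tendsto_add tendsto_scaleR tendsto_mult tendsto_const q tendsto_ident_at)
  then have "\<forall>\<^sub>F \<theta> in at_right 0. z' + ((\<theta> * c) * ?q \<theta>) *\<^sub>R u' + (0 * ?q \<theta>) *\<^sub>R e \<in> N"
    using N by (intro topological_tendstoD) simp_all
  moreover have "\<forall>\<^sub>F \<theta> in at_right 0. (1 - 0) * dz + 0 * dx + (\<theta> * c) * \<delta> \<noteq> 0"
    using tendsto_imp_eventually_ne[OF den, of 0] dz by simp
  moreover have "\<forall>\<^sub>F \<theta> in at_right 0. 0 < \<theta> \<and> \<theta> < (1::real)"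
    using eventually_at_right_real[OF zero_less_one] by simp
  ultimately have "\<forall>\<^sub>F \<theta> in at_right (0::real). False"
  proof eventually_elim
    case (elim \<theta>)
    have "z' + ((\<theta> * c) * ?q \<theta>) *\<^sub>R u' + (0 * ?q \<theta>) *\<^sub>R e \<in> S"
      using elim by (intro slice fr) auto
    note h = boundary_height[OF this elim(1)]
    let ?w = "((\<theta> * c) * ?q \<theta>) *\<^sub>R u'"
    have "?w \<noteq> 0" using elim c dx u' by simp
    moreover have "?w \<in> T" using u' T by (simp add: subspace_scale)
    moreover have "norm ?w < r" "f ?w = 0" using h by simp_all
    ultimately show False using graph_pos[of ?w] by simp
  qed
  then show False by simp
qed

text \<open>The limit at z of the projective factor of the slice. If it is negative, the two ends of
  the chord change sides relative to u'.\<close>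

definition \<rho> :: real where "\<rho> = dx / dz"

lemma \<rho>0: "\<rho> \<noteq> 0"
  using dx dz by (simp add: \<rho>_def)

text \<open>Three distortions, each near its limit, multiply: 1 + \<kappa> a lies between 1/2 and
  3/2 in modulus, the projective factor between 1/2 and 2 times \<bar>\<rho>\<bar>, and the tilt
  changes the height by a factor between 1/2 and 3/2. The products are 1/8 and 9/2.\<close>

lemma chord_end_height:
  fixes \<kappa> :: real
  assumes s: "s = 1 \<or> s = - (1::real)"
  defines "\<tau> \<equiv> transport_exit x u \<kappa> s"
  shows "\<exists>p. \<forall>\<^sub>F \<epsilon> in at_right 0. 0 < \<tau> \<epsilon> \<and> \<bar>\<rho>\<bar> / 2 * \<tau> \<epsilon> \<le> p \<epsilon> \<and> p \<epsilon> \<le> 2 * \<bar>\<rho>\<bar> * \<tau> \<epsilon> \<and>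
    \<bar>\<rho>\<bar> * \<bar>\<nu> \<bullet> e\<bar> / 8 * \<epsilon> \<le> f ((s * sgn \<rho> * p \<epsilon>) *\<^sub>R u') \<and>
    f ((s * sgn \<rho> * p \<epsilon>) *\<^sub>R u') \<le> 9 / 2 * \<bar>\<rho>\<bar> * \<bar>\<nu> \<bullet> e\<bar> * \<epsilon>"
proof -
  have s0: "s \<noteq> 0" using s by auto
  have tau: "filterlim \<tau> (at_right 0) (at_right 0)"
    unfolding \<tau>_def using outside_closure s0 by (intro transport_exit_tendsto_0[OF x u s0]) simp
  then have \<tau>0: "(\<tau> \<longlongrightarrow> 0) (at_right 0)" and \<tau>pos: "\<forall>\<^sub>F \<epsilon> in at_right 0. 0 < \<tau> \<epsilon>"
    by (simp_all add: filterlim_at_right_0_iff)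
  have id: "((\<lambda>\<epsilon>. \<epsilon>) \<longlongrightarrow> 0) (at_right (0::real))" by (rule tendsto_ident_at)
  define a where "a \<epsilon> = s * \<tau> \<epsilon>" for \<epsilon>
  define b where "b \<epsilon> = \<epsilon> * (1 + \<kappa> * a \<epsilon>)" for \<epsilon>
  define den where "den \<epsilon> = (1 - b \<epsilon>) * dz + b \<epsilon> * dx + a \<epsilon> * \<delta>" for \<epsilon>
  define q where "q \<epsilon> = dx / den \<epsilon>" for \<epsilon>
  define \<alpha> where "\<alpha> \<epsilon> = a \<epsilon> * q \<epsilon>" for \<epsilon>
  define \<beta> where "\<beta> \<epsilon> = b \<epsilon> * q \<epsilon>" for \<epsilon>
  have a0: "(a \<longlongrightarrow> 0) (at_right 0)" unfolding a_def by (rule tendsto_mult_right_zero[OF \<tau>0])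
  have "(b \<longlongrightarrow> 0 * (1 + \<kappa> * 0)) (at_right 0)" unfolding b_def by (intro tendsto_intros a0 id)
  then have b0: "(b \<longlongrightarrow> 0) (at_right 0)" by simp
  have "(den \<longlongrightarrow> (1 - 0) * dz + 0 * dx + 0 * \<delta>) (at_right 0)"
    unfolding den_def by (intro tendsto_intros a0 b0)
  then have den0: "(den \<longlongrightarrow> dz) (at_right 0)" by simp
  have q0: "(q \<longlongrightarrow> \<rho>) (at_right 0)"
    unfolding q_def \<rho>_def by (intro tendsto_divide tendsto_const den0 dz)
  have \<alpha>0: "(\<alpha> \<longlongrightarrow> 0) (at_right 0)" and \<beta>0: "(\<beta> \<longlongrightarrow> 0) (at_right 0)"
    unfolding \<alpha>_def \<beta>_def using tendsto_mult[OF a0 q0] tendsto_mult[OF b0 q0] by simp_all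
  \<comment> \<open>The Lipschitz constant is half of \<bar>\<nu> \<bullet> e\<bar>, so that undoing
    the shift along k alters the height \<beta> (\<nu> \<bullet> e) by at most half of it.\<close>
  obtain d where d: "d > 0" "\<forall>w\<in>T. \<forall>b. norm w < d \<longrightarrow> norm (w + b *\<^sub>R k) < d \<longrightarrow>
      \<bar>f (w + b *\<^sub>R k) - f w\<bar> \<le> \<bar>\<nu> \<bullet> e\<bar> / 2 * \<bar>b\<bar>"
    using tilted_increment_bound[OF T r der cont[OF k_in_T] f'0[OF k_in_T] k_in_T, of "\<bar>\<nu> \<bullet> e\<bar> / 2"] e
    by auto
  have "((\<lambda>\<epsilon>. z' + \<alpha> \<epsilon> *\<^sub>R u' + \<beta> \<epsilon> *\<^sub>R e) \<longlongrightarrow> z' + 0 *\<^sub>R u' + 0 *\<^sub>R e) (at_right 0)"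
    by (intro tendsto_intros \<alpha>0 \<beta>0)
  then have inN: "\<forall>\<^sub>F \<epsilon> in at_right 0. z' + \<alpha> \<epsilon> *\<^sub>R u' + \<beta> \<epsilon> *\<^sub>R e \<in> N"
    using N by (intro topological_tendstoD) simp_all
  have "((\<lambda>\<epsilon>. norm (\<alpha> \<epsilon> *\<^sub>R u')) \<longlongrightarrow> norm (0 *\<^sub>R u')) (at_right 0)"
    by (intro tendsto_intros \<alpha>0)
  then have n1: "\<forall>\<^sub>F \<epsilon> in at_right 0. norm (\<alpha> \<epsilon> *\<^sub>R u') < d"
    using d(1) by (intro order_tendstoD) simp_all
  have "((\<lambda>\<epsilon>. norm (\<alpha> \<epsilon> *\<^sub>R u' + \<beta> \<epsilon> *\<^sub>R k)) \<longlongrightarrow> norm (0 *\<^sub>R u' + 0 *\<^sub>R k)) (at_right 0)"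
    by (intro tendsto_intros \<alpha>0 \<beta>0)
  then have n2: "\<forall>\<^sub>F \<epsilon> in at_right 0. norm (\<alpha> \<epsilon> *\<^sub>R u' + \<beta> \<epsilon> *\<^sub>R k) < d"
    using d(1) by (intro order_tendstoD) simp_all
  have qb: "\<forall>\<^sub>F \<epsilon> in at_right 0. dist (q \<epsilon>) \<rho> < \<bar>\<rho>\<bar> / 2"
    using q0 \<rho>0 by (intro tendstoD) simp_all
  have "((\<lambda>\<epsilon>. \<kappa> * a \<epsilon>) \<longlongrightarrow> 0) (at_right 0)" by (rule tendsto_mult_right_zero[OF a0])
  then have kb: "\<forall>\<^sub>F \<epsilon> in at_right 0. dist (\<kappa> * a \<epsilon>) 0 < 1 / 2" by (rule tendstoD) simp
  have den_ne: "\<forall>\<^sub>F \<epsilon> in at_right 0. den \<epsilon> \<noteq> 0"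
    by (rule tendsto_imp_eventually_ne[OF den0 dz])
  have small: "\<forall>\<^sub>F \<epsilon> in at_right 0. 0 < \<epsilon> \<and> \<epsilon> < (1::real)"
    using eventually_at_right_real[OF zero_less_one] by simp
  show ?thesis
  proof (intro exI[of _ "\<lambda>\<epsilon>. \<bar>q \<epsilon>\<bar> * \<tau> \<epsilon>"])
    show "\<forall>\<^sub>F \<epsilon> in at_right 0. 0 < \<tau> \<epsilon> \<and> \<bar>\<rho>\<bar> / 2 * \<tau> \<epsilon> \<le> \<bar>q \<epsilon>\<bar> * \<tau> \<epsilon> \<and> \<bar>q \<epsilon>\<bar> * \<tau> \<epsilon> \<le> 2 * \<bar>\<rho>\<bar> * \<tau> \<epsilon> \<and>
      \<bar>\<rho>\<bar> * \<bar>\<nu> \<bullet> e\<bar> / 8 * \<epsilon> \<le> f ((s * sgn \<rho> * (\<bar>q \<epsilon>\<bar> * \<tau> \<epsilon>)) *\<^sub>R u') \<and>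
      f ((s * sgn \<rho> * (\<bar>q \<epsilon>\<bar> * \<tau> \<epsilon>)) *\<^sub>R u') \<le> 9 / 2 * \<bar>\<rho>\<bar> * \<bar>\<nu> \<bullet> e\<bar> * \<epsilon>"
      using \<tau>pos inN n1 n2 qb kb den_ne small
    proof eventually_elim
      case (elim \<epsilon>)
      have q: "\<bar>\<rho>\<bar> / 2 \<le> \<bar>q \<epsilon>\<bar>" "\<bar>q \<epsilon>\<bar> \<le> 2 * \<bar>\<rho>\<bar>" "sgn \<rho> * \<bar>q \<epsilon>\<bar> = q \<epsilon>"
        using elim(5) \<rho>0 unfolding dist_real_def by (auto simp: sgn_if abs_if split: if_splits)
      have al: "s * sgn \<rho> * (\<bar>q \<epsilon>\<bar> * \<tau> \<epsilon>) = \<alpha> \<epsilon>"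
      proof -
        have "s * sgn \<rho> * (\<bar>q \<epsilon>\<bar> * \<tau> \<epsilon>) = s * \<tau> \<epsilon> * (sgn \<rho> * \<bar>q \<epsilon>\<bar>)" by (simp add: mult_ac)
        then show ?thesis unfolding q(3) \<alpha>_def a_def .
      qed
      have "z + a \<epsilon> *\<^sub>R u + b \<epsilon> *\<^sub>R (x - z) \<in> frontier D"
        using transport_exit_frontier[OF x u s0, of \<epsilon> \<kappa>] elim(8) unfolding a_def b_def \<tau>_def by simp
      then have "z' + \<alpha> \<epsilon> *\<^sub>R u' + \<beta> \<epsilon> *\<^sub>R e \<in> S"
        using slice[of "a \<epsilon>" "b \<epsilon>"] elim(7) unfolding \<alpha>_def \<beta>_def q_def den_def by blast
      note h = boundary_height[OF this elim(2)]
      let ?w = "\<alpha> \<epsilon> *\<^sub>R u'" and ?b = "\<bar>\<beta> \<epsilon>\<bar> * \<bar>\<nu> \<bullet> e\<bar>"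
      have wT: "?w \<in> T" using u' T by (simp add: subspace_scale)
      then have "?w + \<beta> \<epsilon> *\<^sub>R k \<in> T" using T k_in_T by (simp add: subspace_add subspace_scale)
      \<comment> \<open>The signs of \<beta> and \<nu> \<bullet> e are not known separately;
        nonnegativity of \<open>f\<close> fixes the sign of their product and permits absolute
        values.\<close>
      then have "0 \<le> \<beta> \<epsilon> * (\<nu> \<bullet> e)" using nonneg h by metis
      then have fw: "f (?w + \<beta> \<epsilon> *\<^sub>R k) = ?b" unfolding h(2) abs_mult[symmetric] by simp
      have "\<bar>f (?w + \<beta> \<epsilon> *\<^sub>R k) - f ?w\<bar> \<le> \<bar>\<nu> \<bullet> e\<bar> / 2 * \<bar>\<beta> \<epsilon>\<bar>"
        using d(2) wT elim(3,4) by blast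
      then have "\<bar>?b - f ?w\<bar> \<le> ?b / 2" unfolding fw by (simp add: mult.commute)
      then have fb: "?b / 2 \<le> f ?w" "f ?w \<le> 3 / 2 * ?b" unfolding abs_le_iff by linarith+
      have "\<bar>1 + \<kappa> * a \<epsilon>\<bar> \<ge> 1 / 2" "\<bar>1 + \<kappa> * a \<epsilon>\<bar> \<le> 3 / 2"
        using elim(6) unfolding dist_real_def by linarith+
      then have "\<epsilon> * (1 / 2) \<le> \<bar>b \<epsilon>\<bar>" "\<bar>b \<epsilon>\<bar> \<le> \<epsilon> * (3 / 2)"
        using elim(8) unfolding b_def abs_mult by (simp_all add: mult_left_mono)
      then have "(\<epsilon> * (1 / 2)) * (\<bar>\<rho>\<bar> / 2) \<le> \<bar>\<beta> \<epsilon>\<bar>" "\<bar>\<beta> \<epsilon>\<bar> \<le> (\<epsilon> * (3 / 2)) * (2 * \<bar>\<rho>\<bar>)"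
        using q elim(8) unfolding \<beta>_def abs_mult by (intro mult_mono; simp)+
      then have "(\<epsilon> * (1 / 2)) * (\<bar>\<rho>\<bar> / 2) * \<bar>\<nu> \<bullet> e\<bar> \<le> ?b" "?b \<le> (\<epsilon> * (3 / 2)) * (2 * \<bar>\<rho>\<bar>) * \<bar>\<nu> \<bullet> e\<bar>"
        by (intro mult_right_mono; simp)+
      then have "\<bar>\<rho>\<bar> * \<bar>\<nu> \<bullet> e\<bar> / 8 * \<epsilon> \<le> f ?w" "f ?w \<le> 9 / 2 * \<bar>\<rho>\<bar> * \<bar>\<nu> \<bullet> e\<bar> * \<epsilon>"
        using fb by (simp_all add: mult_ac)
      then show ?case
        unfolding al using elim(1) q(1,2) mult_right_mono[OF q(1), of "\<tau> \<epsilon>"] mult_right_mono[OF q(2), of "\<tau> \<epsilon>"]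
        by simp
    qed
  qed
qed

text \<open>The witness a is the minimum of the two end positions p, q in the second chart, each
  comparable to its exit time. It governs the mean height and, since it realises one of the two
  ratios, also the sum of reciprocals. The constants 1/16 and 1/4 are 1/8 and 1/2 halved by taking
  means.\<close>

lemma chord_rate:
  fixes \<kappa> :: real
  defines "\<tau>1 \<equiv> transport_exit x u \<kappa> 1" and "\<tau>2 \<equiv> transport_exit x u \<kappa> (- 1)"
  shows "\<exists>a. filterlim a (at_right 0) (at_right 0) \<and>
    (\<forall>\<^sub>F \<epsilon> in at_right 0. \<bar>\<rho>\<bar> * \<bar>\<nu> \<bullet> e\<bar> / 16 * \<epsilon> \<le> mean_height u' (a \<epsilon>) \<and>
      mean_height u' (a \<epsilon>) \<le> 9 / 2 * \<bar>\<rho>\<bar> * \<bar>\<nu> \<bullet> e\<bar> * \<epsilon>) \<and>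
    (\<forall>\<^sub>F \<epsilon> in at_right 0. \<bar>\<rho>\<bar> / 4 \<le> (1 / \<tau>1 \<epsilon> + 1 / \<tau>2 \<epsilon>) / 2 * a \<epsilon> \<and>
      (1 / \<tau>1 \<epsilon> + 1 / \<tau>2 \<epsilon>) / 2 * a \<epsilon> \<le> 2 * \<bar>\<rho>\<bar>)"
proof -
  obtain p where p: "\<forall>\<^sub>F \<epsilon> in at_right 0. 0 < \<tau>1 \<epsilon> \<and> \<bar>\<rho>\<bar> / 2 * \<tau>1 \<epsilon> \<le> p \<epsilon> \<and> p \<epsilon> \<le> 2 * \<bar>\<rho>\<bar> * \<tau>1 \<epsilon> \<and>
    \<bar>\<rho>\<bar> * \<bar>\<nu> \<bullet> e\<bar> / 8 * \<epsilon> \<le> f ((1 * sgn \<rho> * p \<epsilon>) *\<^sub>R u') \<and>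
    f ((1 * sgn \<rho> * p \<epsilon>) *\<^sub>R u') \<le> 9 / 2 * \<bar>\<rho>\<bar> * \<bar>\<nu> \<bullet> e\<bar> * \<epsilon>"
    using chord_end_height[of 1 \<kappa>, OF disjI1[OF refl]] unfolding \<tau>1_def by (elim exE)
  obtain q where q: "\<forall>\<^sub>F \<epsilon> in at_right 0. 0 < \<tau>2 \<epsilon> \<and> \<bar>\<rho>\<bar> / 2 * \<tau>2 \<epsilon> \<le> q \<epsilon> \<and> q \<epsilon> \<le> 2 * \<bar>\<rho>\<bar> * \<tau>2 \<epsilon> \<and>
    \<bar>\<rho>\<bar> * \<bar>\<nu> \<bullet> e\<bar> / 8 * \<epsilon> \<le> f ((- 1 * sgn \<rho> * q \<epsilon>) *\<^sub>R u') \<and>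
    f ((- 1 * sgn \<rho> * q \<epsilon>) *\<^sub>R u') \<le> 9 / 2 * \<bar>\<rho>\<bar> * \<bar>\<nu> \<bullet> e\<bar> * \<epsilon>"
    using chord_end_height[of "- 1" \<kappa>, OF disjI2[OF refl]] unfolding \<tau>2_def by (elim exE)
  have \<rho>pos: "0 < \<bar>\<rho>\<bar>" using \<rho>0 by simp
  have lim: "filterlim \<tau>1 (at_right 0) (at_right 0)" "filterlim \<tau>2 (at_right 0) (at_right 0)"
    unfolding \<tau>1_def \<tau>2_def
    by (rule transport_exit_tendsto_0[OF x u], simp, rule outside_closure, simp)+
  have p0: "filterlim p (at_right 0) (at_right 0)" and q0: "filterlim q (at_right 0) (at_right 0)"
  proof -
    have "filterlim P (at_right 0) (at_right 0)" if P: "\<forall>\<^sub>F \<epsilon> in at_right 0. 0 < \<tau> \<epsilon> \<and>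
      \<bar>\<rho>\<bar> / 2 * \<tau> \<epsilon> \<le> P \<epsilon> \<and> P \<epsilon> \<le> 2 * \<bar>\<rho>\<bar> * \<tau> \<epsilon>" and \<tau>: "filterlim \<tau> (at_right 0) (at_right 0)"
      for P \<tau> :: "real \<Rightarrow> real"
    proof -
      have pos: "\<forall>\<^sub>F \<epsilon> in at_right 0. 0 < P \<epsilon>"
        using P
      proof eventually_elim
        case (elim \<epsilon>)
        then have "0 < \<bar>\<rho>\<bar> / 2 * \<tau> \<epsilon>" using \<rho>pos by (intro mult_pos_pos) auto
        then show ?case using elim by linarith
      qed
      have "((\<lambda>\<epsilon>. 2 * \<bar>\<rho>\<bar> * \<tau> \<epsilon>) \<longlongrightarrow> 0) (at_right 0)"
        using \<tau> by (intro tendsto_mult_right_zero) (simp add: filterlim_at_right_0_iff)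
      moreover have "\<forall>\<^sub>F \<epsilon> in at_right 0. norm (P \<epsilon>) \<le> 2 * \<bar>\<rho>\<bar> * \<tau> \<epsilon>"
        using P pos by eventually_elim simp
      ultimately have "(P \<longlongrightarrow> 0) (at_right 0)" by (rule Lim_null_comparison[rotated])
      then show ?thesis using pos by (simp add: filterlim_at_right_0_iff)
    qed
    note * = this
    show "filterlim p (at_right 0) (at_right 0)"
      by (rule *[OF _ lim(1)]) (use p in \<open>auto elim: eventually_mono\<close>)
    show "filterlim q (at_right 0) (at_right 0)"
      by (rule *[OF _ lim(2)]) (use q in \<open>auto elim: eventually_mono\<close>)
  qed
  have tiny: "\<forall>\<^sub>F s in at_right 0. 0 < s \<and> s * norm u' < r"
  proof -
    have "((\<lambda>s. s * norm u') \<longlongrightarrow> 0 * norm u') (at_right 0)" by (intro tendsto_intros)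
    then have "\<forall>\<^sub>F s in at_right 0. s * norm u' < r" using r by (intro order_tendstoD) simp_all
    with eventually_at_right_less[of 0] show ?thesis by eventually_elim simp
  qed
  have pt: "\<forall>\<^sub>F \<epsilon> in at_right 0. 0 < p \<epsilon> \<and> p \<epsilon> * norm u' < r"
    and qt: "\<forall>\<^sub>F \<epsilon> in at_right 0. 0 < q \<epsilon> \<and> q \<epsilon> * norm u' < r"
    by (rule eventually_compose_filterlim[OF tiny p0], rule eventually_compose_filterlim[OF tiny q0])
  let ?a = "\<lambda>\<epsilon>. min (p \<epsilon>) (q \<epsilon>)"
  have "filterlim ?a (at_right 0) (at_right 0)"
  proof -
    have "(?a \<longlongrightarrow> min 0 0) (at_right 0)"
      using p0 q0 by (intro tendsto_min) (simp_all add: filterlim_at_right_0_iff)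
    moreover have "\<forall>\<^sub>F \<epsilon> in at_right 0. 0 < ?a \<epsilon>" using pt qt by eventually_elim simp
    ultimately show ?thesis by (simp add: filterlim_at_right_0_iff)
  qed
  moreover have "\<forall>\<^sub>F \<epsilon> in at_right 0. \<bar>\<rho>\<bar> * \<bar>\<nu> \<bullet> e\<bar> / 16 * \<epsilon> \<le> mean_height u' (?a \<epsilon>) \<and>
      mean_height u' (?a \<epsilon>) \<le> 9 / 2 * \<bar>\<rho>\<bar> * \<bar>\<nu> \<bullet> e\<bar> * \<epsilon>"
    using p q pt qt
  proof eventually_elim
    case (elim \<epsilon>)
    have sg: "sgn \<rho> = 1 \<or> sgn \<rho> = - 1" using \<rho>0 by (auto simp: sgn_if)
    note mh = mean_height_min[OF u' sg, of "p \<epsilon>" "q \<epsilon>" "\<bar>\<rho>\<bar> * \<bar>\<nu> \<bullet> e\<bar> / 8 * \<epsilon>"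
        "9 / 2 * \<bar>\<rho>\<bar> * \<bar>\<nu> \<bullet> e\<bar> * \<epsilon>"]
    have "\<bar>\<rho>\<bar> * \<bar>\<nu> \<bullet> e\<bar> / 8 * \<epsilon> / 2 \<le> mean_height u' (?a \<epsilon>)"
      by (rule mh(1); use elim in simp)
    moreover have "mean_height u' (?a \<epsilon>) \<le> 9 / 2 * \<bar>\<rho>\<bar> * \<bar>\<nu> \<bullet> e\<bar> * \<epsilon>"
      by (rule mh(2); use elim in simp)
    ultimately show ?case by simp
  qed
  moreover have "\<forall>\<^sub>F \<epsilon> in at_right 0. \<bar>\<rho>\<bar> / 4 \<le> (1 / \<tau>1 \<epsilon> + 1 / \<tau>2 \<epsilon>) / 2 * ?a \<epsilon> \<and>
      (1 / \<tau>1 \<epsilon> + 1 / \<tau>2 \<epsilon>) / 2 * ?a \<epsilon> \<le> 2 * \<bar>\<rho>\<bar>"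
    using p q pt qt
  proof eventually_elim
    case (elim \<epsilon>)
    have t: "0 < \<tau>1 \<epsilon>" "0 < \<tau>2 \<epsilon>" and pq: "0 < p \<epsilon>" "0 < q \<epsilon>" using elim by auto
    have P: "\<bar>\<rho>\<bar> / 2 \<le> p \<epsilon> / \<tau>1 \<epsilon>" "p \<epsilon> / \<tau>1 \<epsilon> \<le> 2 * \<bar>\<rho>\<bar>"
      and Q: "\<bar>\<rho>\<bar> / 2 \<le> q \<epsilon> / \<tau>2 \<epsilon>" "q \<epsilon> / \<tau>2 \<epsilon> \<le> 2 * \<bar>\<rho>\<bar>"
      using elim t by (auto simp only: pos_le_divide_eq pos_divide_le_eq)
    define A where "A = ?a \<epsilon>"
    have A: "A \<le> p \<epsilon>" "A \<le> q \<epsilon>" "A = p \<epsilon> \<or> A = q \<epsilon>" "0 < A"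
      using pq by (auto simp: A_def min_def)
    have eq: "(1 / \<tau>1 \<epsilon> + 1 / \<tau>2 \<epsilon>) / 2 * A = (A / \<tau>1 \<epsilon> + A / \<tau>2 \<epsilon>) / 2"
      by (simp add: distrib_right)
    have le: "A / \<tau>1 \<epsilon> \<le> p \<epsilon> / \<tau>1 \<epsilon>" "A / \<tau>2 \<epsilon> \<le> q \<epsilon> / \<tau>2 \<epsilon>"
      using t A by (intro divide_right_mono; simp)+
    have nn: "0 \<le> A / \<tau>1 \<epsilon>" "0 \<le> A / \<tau>2 \<epsilon>" using t A by simp_all
    have sum: "\<bar>\<rho>\<bar> / 2 \<le> A / \<tau>1 \<epsilon> + A / \<tau>2 \<epsilon>"
      using A(3)
    proof
      assume "A = p \<epsilon>"
      with P(1) have "\<bar>\<rho>\<bar> / 2 \<le> A / \<tau>1 \<epsilon>" by simp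
      then show ?thesis using nn by linarith
    next
      assume "A = q \<epsilon>"
      with Q(1) have "\<bar>\<rho>\<bar> / 2 \<le> A / \<tau>2 \<epsilon>" by simp
      then show ?thesis using nn by linarith
    qed
    have "R / 4 \<le> (a + b) / 2 \<and> (a + b) / 2 \<le> 2 * R"
      if "R / 2 \<le> a + b" "a \<le> p'" "b \<le> q'" "p' \<le> 2 * R" "q' \<le> 2 * R" for R a b p' q' :: real
      using that by auto
    from this[OF sum le P(2) Q(2)] show ?case unfolding A_def[symmetric] eq .
  qed
  ultimately show ?thesis by blast
qed

text \<open>The affine map 2 y - 1 is pulled out of the limits so that the variable can change from
  \<epsilon> to s = height parameter of \<open>h\<close>, and is then put back. Inverting the ratio
  of logarithms comes last; this is where the upper and lower exponents trade places.\<close>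

lemma parallel_exponents_eq:
  assumes pt: "\<forall>t. parallel_transport D z t x v
      = (exp t * contraction t x) *\<^sub>R (u + (\<kappa> * contraction t x) *\<^sub>R (x - z))"
  shows "upper_parallel_exponent D z x v = 2 / lower_graph_exponent f u' - 1"
    and "lower_parallel_exponent D z x v = 2 / upper_graph_exponent f u' - 1"
proof -
  define W where "W \<epsilon> = (1 / transport_exit x u \<kappa> 1 \<epsilon> + 1 / transport_exit x u \<kappa> (- 1) \<epsilon>) / 2" for \<epsilon>
  define h where "h = mean_height u'"
  obtain a where a: "filterlim a (at_right 0) (at_right 0)"
    and ha: "\<forall>\<^sub>F \<epsilon> in at_right 0. \<bar>\<rho>\<bar> * \<bar>\<nu> \<bullet> e\<bar> / 16 * \<epsilon> \<le> h (a \<epsilon>) \<and>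
      h (a \<epsilon>) \<le> 9 / 2 * \<bar>\<rho>\<bar> * \<bar>\<nu> \<bullet> e\<bar> * \<epsilon>"
    and Wa: "\<forall>\<^sub>F \<epsilon> in at_right 0. \<bar>\<rho>\<bar> / 4 \<le> W \<epsilon> * a \<epsilon> \<and> W \<epsilon> * a \<epsilon> \<le> 2 * \<bar>\<rho>\<bar>"
    using chord_rate[of \<kappa>] unfolding W_def h_def by (elim exE conjE)
  have fin: "finsler D (radial_flow D z t x) (parallel_transport D z t x v)
      = exp t * contraction t x * W (contraction t x)" for t
    unfolding W_def by (rule finsler_parallel_transport[OF x u pt[rule_format]])
  obtain d where d: "d > 0" "\<forall>s. 0 < s \<longrightarrow> s < d \<longrightarrow> h s \<le> s"
    using mean_height_le[OF u'(1)] unfolding h_def by (elim exE conjE)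
  define r0 where "r0 = min 1 (min d (r / norm u'))"
  have nu: "0 < norm u'" using u' by simp
  have r0: "0 < r0" "r0 \<le> 1" using d r nu by (simp_all add: r0_def)
  have lt: "s * norm u' < r" if "s < r0" for s
    using that nu by (simp add: r0_def pos_less_divide_eq)
  have hp: "0 < h s" if "0 < s" "s < r0" for s
    unfolding h_def using that lt by (intro mean_height_pos u') auto
  have hm: "h s < h t" if "0 < s" "s < t" "t < r0" for s t
    unfolding h_def using that lt by (intro mean_height_strict_mono u') auto
  have hl: "h s \<le> s" if "0 < s" "s < r0" for s
    using d that by (simp add: r0_def)
  have c: "0 < \<bar>\<rho>\<bar> * \<bar>\<nu> \<bullet> e\<bar> / 16" "0 < 9 / 2 * \<bar>\<rho>\<bar> * \<bar>\<nu> \<bullet> e\<bar>" "0 < \<bar>\<rho>\<bar> / 4" using \<rho>0 e by simp_all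
  note rate = Limsup_Liminf_inverse_rate[OF r0 hp hm hl a c(1,2) ha]
  have "\<forall>\<^sub>F t in at_top. finsler D (radial_flow D z t x) (parallel_transport D z t x v)
      = exp t * (1 / (depth x + exp (2 * t) * (1 - depth x)))
        * W (1 / (depth x + exp (2 * t) * (1 - depth x)))"
    using fin unfolding contraction_def by simp
  note growth = Limsup_Liminf_growth[where W = W and Z = "\<lambda>t. finsler D (radial_flow D z t x) (parallel_transport D z t x v)",
      OF depth_bounds[OF x] a rate(3) c(3) Wa this]
  have nb: "at_right (0::real) \<noteq> bot" by simp
  have small: "\<forall>\<^sub>F s in at_right 0. 0 < s \<and> s < r0"
    using eventually_at_right_real[OF r0(1)] by simp
  have X: "\<forall>\<^sub>F s in at_right 0. 0 < ln (h s) / ln s"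
    using small
  proof eventually_elim
    case (elim s)
    then have "0 < h s" "h s \<le> s" "s < 1" using hp hl r0 by auto
    then have "ln (h s) < 0" "ln s < 0" using elim by simp_all
    then show ?case by (rule divide_neg_neg)
  qed
  have Y: "\<forall>\<^sub>F s in at_right 0. ln s / ln (h s) = inverse (ln (h s) / ln s)" by simp
  note inv = Limsup_Liminf_inverse_affine[OF nb X Y]
  have "upper_parallel_exponent D z x v
      = ereal 2 * Limsup (at_right 0) (\<lambda>\<epsilon>. ereal (ln (a \<epsilon>) / ln \<epsilon>)) + ereal (- 1)"
    unfolding upper_parallel_exponent_def by (rule trans[OF growth(1) Limsup_Liminf_affine(1)[OF nb]])
  also have "\<dots> = ereal 2 * Limsup (at_right 0) (\<lambda>s. ereal (ln s / ln (h s))) + ereal (- 1)"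
    by (rule arg_cong[where f = "\<lambda>L. ereal 2 * L + ereal (- 1)", OF rate(1)])
  also have "\<dots> = Limsup (at_right 0) (\<lambda>s. ereal (2 * (ln s / ln (h s)) - 1))"
    by (rule Limsup_Liminf_affine(1)[OF nb, symmetric])
  also have "\<dots> = 2 / Liminf (at_right 0) (\<lambda>s. ereal (ln (h s) / ln s)) - 1"
    by (rule inv(1))
  also have "\<dots> = 2 / lower_graph_exponent f u' - 1"
    unfolding graph_exponents_at_right h_def ..
  finally show "upper_parallel_exponent D z x v = 2 / lower_graph_exponent f u' - 1" .
  have "lower_parallel_exponent D z x v
      = ereal 2 * Liminf (at_right 0) (\<lambda>\<epsilon>. ereal (ln (a \<epsilon>) / ln \<epsilon>)) + ereal (- 1)"
    unfolding lower_parallel_exponent_def by (rule trans[OF growth(2) Limsup_Liminf_affine(2)[OF nb]])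
  also have "\<dots> = ereal 2 * Liminf (at_right 0) (\<lambda>s. ereal (ln s / ln (h s))) + ereal (- 1)"
    by (rule arg_cong[where f = "\<lambda>L. ereal 2 * L + ereal (- 1)", OF rate(2)])
  also have "\<dots> = Liminf (at_right 0) (\<lambda>s. ereal (2 * (ln s / ln (h s)) - 1))"
    by (rule Limsup_Liminf_affine(2)[OF nb, symmetric])
  also have "\<dots> = 2 / Limsup (at_right 0) (\<lambda>s. ereal (ln (h s) / ln s)) - 1"
    by (rule inv(2))
  also have "\<dots> = 2 / upper_graph_exponent f u' - 1"
    unfolding graph_exponents_at_right h_def ..
  finally show "lower_parallel_exponent D z x v = 2 / upper_graph_exponent f u' - 1" .
qed

end

section \<open>Exponents of parallel transport\<close>

text \<open>The difference of two candidates is both tangent and radial, hence zero by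
  transversality; this justifies the definite description.\<close>

lemma boundary_projection_eqI:
  assumes T: "subspace (tangent_space (chart_image L (proj_boundary \<Omega>)) (chart_map L X))"
    and tr: "chart_map L X - chart_map L P \<notin> tangent_space (chart_image L (proj_boundary \<Omega>)) (chart_map L X)"
    and u: "u \<in> tangent_space (chart_image L (proj_boundary \<Omega>)) (chart_map L X)"
    and w: "w - u = c *\<^sub>R (chart_map L X - chart_map L P)"
  shows "boundary_projection \<Omega> L X P w = u"
  unfolding boundary_projection_def
proof (rule the_equality)
  let ?T = "tangent_space (chart_image L (proj_boundary \<Omega>)) (chart_map L X)"
  let ?d = "chart_map L X - chart_map L P"
  show "u \<in> ?T \<and> w - u \<in> span {?d}"
    using u by (simp add: w span_base span_scale)
  fix u2 assume u2: "u2 \<in> ?T \<and> w - u2 \<in> span {?d}"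
  then obtain c2 where c2: "w - u2 = c2 *\<^sub>R ?d" by (auto simp: span_singleton)
  have "u2 - u = (w - u) - (w - u2)" by simp
  also have "\<dots> = (c - c2) *\<^sub>R ?d" unfolding w c2 by (simp add: scaleR_diff_left)
  finally have eq: "u2 - u = (c - c2) *\<^sub>R ?d" .
  have "c - c2 = 0"
  proof (rule ccontr)
    assume ne: "c - c2 \<noteq> 0"
    have "(c - c2) *\<^sub>R ?d \<in> ?T" using T u u2 unfolding eq[symmetric] by (simp add: subspace_diff)
    then have "inverse (c - c2) *\<^sub>R ((c - c2) *\<^sub>R ?d) \<in> ?T" using T by (simp only: subspace_scale)
    then show False using tr ne by simp
  qed
  then show "u2 = u" using eq by simp
qed

text \<open>The part w of \<nu> orthogonal to g lies in the hyperplane, so \<nu> annihilates it and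
  w \<bullet> w = 0. The graph condition only says that \<nu> is orthogonal to the tangent space;
  equality is needed to recover base points from heights.\<close>

lemma hyperplane_eq_orthogonal_complement:
  fixes g \<nu> :: "'a::euclidean_space"
  assumes "g \<noteq> 0" "\<nu> \<noteq> 0" and "\<forall>w\<in>{w. g \<bullet> w = 0}. \<nu> \<bullet> w = 0"
  shows "{w. g \<bullet> w = 0} = {w. \<nu> \<bullet> w = 0}"
proof -
  have gg: "g \<bullet> g \<noteq> 0" using assms(1) by simp
  define c where "c = (g \<bullet> \<nu>) / (g \<bullet> g)"
  define w where "w = \<nu> - c *\<^sub>R g"
  have gw: "g \<bullet> w = 0" using gg by (simp add: w_def c_def inner_diff_right)
  then have "\<nu> \<bullet> w = 0" using assms(3) by simp
  then have "w \<bullet> w = 0" using gw by (simp add: w_def inner_diff_left)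
  then have \<nu>: "\<nu> = c *\<^sub>R g" by (simp add: w_def)
  then have "c \<noteq> 0" using assms(2) by auto
  then show ?thesis unfolding \<nu> by simp
qed

theorem theorem4p9:
  fixes \<Omega> :: "('a::euclidean_space \<times> real) set set"
    and B C :: "'a \<times> real \<Rightarrow> 'a \<times> real"
    and X P :: "('a \<times> real) set"
    and v :: 'a
    and f :: "'a \<Rightarrow> real"
  assumes "DIM('a) \<ge> 2"
    and "strictly_convex_proper_open \<Omega>"
    and "C1_boundary \<Omega>"
    and "X \<in> proj_boundary \<Omega>"
    and "bounded_chart \<Omega> B"
    and "affine_chart C" and "X \<in> chart_dom C"
    and "boundary_graph \<Omega> C X f"
    and "P \<in> \<Omega>" and "P \<in> chart_dom C"
    and "v \<in> tangent_space (horosphere (chart_image B \<Omega>) (chart_map B X) (chart_map B P))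
                (chart_map B P)"
    and "v \<noteq> 0"
  shows "upper_parallel_exponent (chart_image B \<Omega>) (chart_map B X) (chart_map B P) v
           = 2 / lower_graph_exponent f (boundary_projection \<Omega> C X P (change_chart B C P v)) - 1
       \<and> lower_parallel_exponent (chart_image B \<Omega>) (chart_map B X) (chart_map B P) v
           = 2 / upper_graph_exponent f (boundary_projection \<Omega> C X P (change_chart B C P v)) - 1"
proof -
  define \<Sigma> where "\<Sigma> = proj_boundary \<Omega>"
  define D where "D = chart_image B \<Omega>"
  define S where "S = chart_image C \<Sigma>"
  define z x where "z = chart_map B X" and "x = chart_map B P"
  define z' x' where "z' = chart_map C X" and "x' = chart_map C P"
  define T where "T = tangent_space S z'"
  have B: "affine_chart B" "\<Omega> \<subseteq> chart_dom B" "bounded D"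
    using assms(5) by (auto simp: bounded_chart_def D_def)
  note C = assms(6) and BC = B(1) assms(6) and CB = assms(6) B(1)
  obtain L where op: "openin proj_topology \<Omega>" and L: "affine_chart L" "\<Omega> \<subseteq> chart_dom L"
    and cL: "convex (chart_image L \<Omega>)"
    using assms(2) unfolding strictly_convex_proper_open_def bounded_chart_def by (elim conjE exE)
  have XB: "X \<in> chart_dom B" using proj_boundary_subset_chart_dom[OF assms(5)] assms(4) by (rule subsetD)
  have PB: "P \<in> chart_dom B" using B(2) assms(9) by (rule subsetD)
  have frD: "frontier D = chart_image B \<Sigma>"
    unfolding D_def \<Sigma>_def by (rule chart_image_proj_boundary[OF B(1), symmetric])
  have zD: "z \<in> frontier D"
    unfolding frD z_def chart_map_in_chart_image[OF B(1) XB] \<Sigma>_def by (rule assms(4))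
  have xD: "x \<in> D" unfolding D_def x_def chart_map_in_chart_image[OF B(1) PB] by (rule assms(9))
  have C1D: "C1_hypersurface (frontier D)" and C1S: "C1_hypersurface S"
    using assms(3) BC unfolding C1_boundary_def frD S_def \<Sigma>_def by (simp_all only:)
  interpret smooth_pointed_domain D z
  proof
    show "open D" unfolding D_def by (rule open_chart_image[OF B(1) op])
    show "convex D" unfolding D_def by (rule convex_chart_image[OF L cL B(1,2)])
  qed (fact B(3) zD C1D)+
  obtain u \<kappa> where u: "u \<noteq> 0" "u \<in> tangent_space (frontier D) z" and vu: "v = u + \<kappa> *\<^sub>R (x - z)"
    and pt: "\<forall>t. parallel_transport D z t x v
      = (exp t * contraction t x) *\<^sub>R (u + (\<kappa> * contraction t x) *\<^sub>R (x - z))"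
    using assms(11) unfolding D_def[symmetric] z_def[symmetric] x_def[symmetric]
    by (rule horosphere_tangent_vector[OF xD _ assms(12)])
  define M where "M = transition B C"
  have lin: "linear M" unfolding M_def by (rule linear_transition[OF BC])
  \<comment> \<open>The last homogeneous coordinates of z, x and the direction u in the chart C. On
    the slice they combine to the denominator (1 - b) dz + b dx + a \<delta>.\<close>
  define dz dx \<delta> where "dz = snd (M (z, 1))" and "dx = snd (M (x, 1))" and "\<delta> = snd (M (u, 0))"
  have dz: "dz \<noteq> 0" and Mz: "M (z, 1) = dz *\<^sub>R (z', 1)"
    unfolding dz_def M_def z_def z'_def by (fact transition_chart_map[OF BC XB assms(7)])+
  have dx: "dx \<noteq> 0" and Mx: "M (x, 1) = dx *\<^sub>R (x', 1)"
    unfolding dx_def M_def x_def x'_def by (fact transition_chart_map[OF BC PB assms(10)])+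
  define e where "e = x' - z'"
  \<comment> \<open>The scale is dx and not dz: the vector v is read in C at P, where the derivative
    of the chart change divides by dx. The tangent vector carried over at X has dz instead, a
    nonzero multiple of u'.\<close>
  define u' where "u' = (fst (M (u, 0)) - \<delta> *\<^sub>R z') /\<^sub>R dx"
  have Mu: "M (u, 0) = (dx *\<^sub>R u' + \<delta> *\<^sub>R z', \<delta>)"
    using dx by (simp add: u'_def \<delta>_def prod_eq_iff)
  have "z' \<in> S"
    unfolding S_def z'_def chart_map_in_chart_image[OF C assms(7)] \<Sigma>_def by (rule assms(4))
  then obtain g where g: "g \<noteq> 0" "T = {w. g \<bullet> w = 0}"
    unfolding T_def by (rule C1_hypersurface_normal[OF C1S])
  have subT: "subspace T" unfolding g(2) by (rule subspace_hyperplane)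
  from assms(8) obtain \<nu> r N f' where bg: "norm \<nu> = 1 \<and> (\<forall>u\<in>T. \<nu> \<bullet> u = 0) \<and>
        (\<forall>\<^sub>F s in at_right 0. z' + s *\<^sub>R \<nu> \<in> chart_image C \<Omega>) \<and>
        r > 0 \<and> open N \<and> z' \<in> N \<and>
        S \<inter> N = (\<lambda>u. z' + u + f u *\<^sub>R \<nu>) ` (T \<inter> ball 0 r) \<and>
        (\<forall>u\<in>T \<inter> ball 0 r. \<forall>w\<in>T \<inter> ball 0 r. \<forall>s\<in>{0<..<1}.
           u \<noteq> w \<longrightarrow> f ((1 - s) *\<^sub>R u + s *\<^sub>R w) < (1 - s) * f u + s * f w) \<and>
        (\<forall>u\<in>T \<inter> ball 0 r. (f has_derivative f' u) (at u within T)) \<and>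
        (\<forall>h\<in>T. continuous_on (T \<inter> ball 0 r) (\<lambda>u. f' u h)) \<and>
        (\<forall>u\<in>T \<inter> ball 0 r. f u \<ge> 0) \<and> f 0 = 0 \<and> (\<forall>h\<in>T. f' 0 h = 0)"
    unfolding boundary_graph_def Let_def T_def S_def \<Sigma>_def z'_def by (elim exE)
  have T_eq: "T = {w. \<nu> \<bullet> w = 0}"
    unfolding g(2) using bg g by (intro hyperplane_eq_orthogonal_complement) auto
  have u'T: "u' \<in> T"
  proof -
    have "(fst (M (u, 0)) - \<delta> *\<^sub>R z') /\<^sub>R dz \<in> T"
      using tangent_space_transition[OF BC XB assms(7), of u \<Sigma>] u(2)
      unfolding frD z_def[symmetric] z'_def[symmetric] M_def[symmetric] dz_def \<delta>_def T_def S_def by blast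
    then have "(dz / dx) *\<^sub>R ((fst (M (u, 0)) - \<delta> *\<^sub>R z') /\<^sub>R dz) \<in> T"
      using subT by (simp only: subspace_scale)
    moreover have "dz / dx * inverse dz = inverse dx" using dz by (simp add: field_simps)
    ultimately show ?thesis unfolding u'_def by (simp only: scaleR_scaleR)
  qed
  have inv: "transition C B (M w) = w" for w unfolding M_def by (rule transition_inverse[OF BC])
  have lin': "linear (transition C B)" by (rule linear_transition[OF CB])
  have u'0: "u' \<noteq> 0"
  proof
    assume "u' = 0"
    then have "M (u, 0) = (\<delta> / dz) *\<^sub>R M (z, 1)" unfolding Mu Mz using dz by (simp add: prod_eq_iff)
    then have "transition C B (M (u, 0)) = (\<delta> / dz) *\<^sub>R transition C B (M (z, 1))"
      by (simp only: linear_cmul[OF lin'])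
    then have "(u, 0) = (\<delta> / dz) *\<^sub>R (z, 1::real)" unfolding inv .
    then show False using u(1) by (simp add: prod_eq_iff)
  qed
  \<comment> \<open>Transversality is available in the bounded convex chart B. A tangent
    \<open>e\<close> would be carried back there to a nonzero multiple of x - z.\<close>
  have eT: "e \<notin> T"
  proof
    assume "e \<in> T"
    have "(e, 0) = (1 / dx) *\<^sub>R M (x, 1) - (1 / dz) *\<^sub>R M (z, 1)"
      unfolding Mx Mz e_def using dx dz by (simp add: prod_eq_iff)
    then have "transition C B (e, 0) = (1 / dx) *\<^sub>R (x, 1) - (1 / dz) *\<^sub>R (z, 1)"
      by (simp only: linear_diff[OF lin'] linear_cmul[OF lin'] inv)
    then have te: "transition C B (e, 0) = ((1 / dx) *\<^sub>R x - (1 / dz) *\<^sub>R z, 1 / dx - 1 / dz)" by simp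
    have "(z', 1) = (1 / dz) *\<^sub>R M (z, 1)" unfolding Mz using dz by simp
    then have "transition C B (z', 1) = (1 / dz) *\<^sub>R (z, 1)"
      by (simp only: linear_cmul[OF lin'] inv)
    then have tz: "snd (transition C B (z', 1)) = 1 / dz" by simp
    have "(fst (transition C B (e, 0)) - snd (transition C B (e, 0)) *\<^sub>R z)
        /\<^sub>R snd (transition C B (z', 1)) \<in> tangent_space (frontier D) z"
      using tangent_space_transition[OF CB assms(7) XB, of e \<Sigma>] \<open>e \<in> T\<close>
      unfolding frD z_def[symmetric] z'_def[symmetric] T_def S_def by blast
    then have d: "dz *\<^sub>R ((1 / dx) *\<^sub>R (x - z)) \<in> tangent_space (frontier D) z"
      unfolding te tz using dz by (simp add: algebra_simps)
    obtain g2 where g2: "tangent_space (frontier D) z = {u. g2 \<bullet> u = 0}"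
      by (rule C1_hypersurface_normal[OF C1D zD])
    have "x - z \<in> tangent_space (frontier D) z" using d dz dx unfolding g2 by simp
    then show False using transversal[OF zD xD] by contradiction
  qed
  interpret boundary_slice D z T f f' r x u u' e \<nu> z' dz dx \<delta> S N
  proof (unfold_locales)
    show "f ((1 - s) *\<^sub>R w + s *\<^sub>R w') < (1 - s) * f w + s * f w'"
      if "w \<in> T" "norm w < r" "w' \<in> T" "norm w' < r" "w \<noteq> w'" "0 < s" "s < 1" for w w' s
      using bg that by simp
    show "(f has_derivative f' w) (at w within T)" if "w \<in> T" "norm w < r" for w
      using bg that by simp
    show "continuous_on (T \<inter> ball 0 r) (\<lambda>w. f' w h)" if "h \<in> T" for h using bg that by simp
    show "0 \<le> f w" if "w \<in> T" "norm w < r" for w using bg that by simp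
    show "f' 0 h = 0" if "h \<in> T" for h using bg that by simp
    show "\<nu> \<bullet> e \<noteq> 0" using eT unfolding T_eq by simp
    fix a b :: real
    let ?y = "z + a *\<^sub>R u + b *\<^sub>R (x - z)" and ?d = "(1 - b) * dz + b * dx + a * \<delta>"
    assume y: "?y \<in> frontier D" and d: "?d \<noteq> 0"
    have "(?y, 1::real) = (1 - b) *\<^sub>R (z, 1) + b *\<^sub>R (x, 1) + a *\<^sub>R (u, 0)"
      by (simp add: prod_eq_iff algebra_simps)
    then have "M (?y, 1) = (1 - b) *\<^sub>R M (z, 1) + b *\<^sub>R M (x, 1) + a *\<^sub>R M (u, 0)"
      by (simp only: linear_add[OF lin] linear_cmul[OF lin])
    then have My: "M (?y, 1) = (((1 - b) * dz) *\<^sub>R z' + (b * dx) *\<^sub>R x' + a *\<^sub>R (dx *\<^sub>R u' + \<delta> *\<^sub>R z'), ?d)"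
      unfolding Mz Mx Mu by simp
    have "chart_map C (chart_inv B ?y) = fst (M (?y, 1)) /\<^sub>R snd (M (?y, 1))"
      using chart_change_eq[OF BC, of ?y] d My unfolding M_def by simp
    also have "fst (M (?y, 1)) = ?d *\<^sub>R z' + (a * dx) *\<^sub>R u' + (b * dx) *\<^sub>R e"
      unfolding My e_def by (simp add: algebra_simps)
    also have "snd (M (?y, 1)) = ?d" unfolding My by simp
    also have "(?d *\<^sub>R z' + (a * dx) *\<^sub>R u' + (b * dx) *\<^sub>R e) /\<^sub>R ?d
        = z' + (a * (dx / ?d)) *\<^sub>R u' + (b * (dx / ?d)) *\<^sub>R e"
      using d by (simp only: scaleR_add_right scaleR_scaleR) (simp add: divide_inverse mult_ac)
    finally have \<Phi>: "chart_map C (chart_inv B ?y) = z' + (a * (dx / ?d)) *\<^sub>R u' + (b * (dx / ?d)) *\<^sub>R e" .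
    have "chart_inv B ?y \<in> chart_dom C"
      using chart_inv_in_dom_iff[OF BC, of ?y] d My unfolding M_def by simp
    moreover have "chart_inv B ?y \<in> \<Sigma>" using y unfolding frD chart_image_eq[OF B(1)] by (rule CollectD)
    ultimately have "chart_map C (chart_inv B ?y) \<in> S"
      unfolding S_def by (simp only: chart_map_in_chart_image[OF C])
    then show "z' + (a * (dx / ?d)) *\<^sub>R u' + (b * (dx / ?d)) *\<^sub>R e \<in> S" unfolding \<Phi> .
  qed (use bg in \<open>simp_all add: subT xD u dz dx T_eq[symmetric] u'T u'0\<close>)
  have "boundary_projection \<Omega> C X P (change_chart B C P v) = u'"
  proof (rule boundary_projection_eqI)
    show "subspace (tangent_space (chart_image C (proj_boundary \<Omega>)) (chart_map C X))"
      using subT unfolding T_def S_def \<Sigma>_def z'_def .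
    show "u' \<in> tangent_space (chart_image C (proj_boundary \<Omega>)) (chart_map C X)"
      using u'T unfolding T_def S_def \<Sigma>_def z'_def .
    have "- e \<notin> T" using eT unfolding T_eq by simp
    then show "chart_map C X - chart_map C P \<notin> tangent_space (chart_image C (proj_boundary \<Omega>)) (chart_map C X)"
      unfolding e_def T_def S_def \<Sigma>_def z'_def x'_def by simp
    have Pi: "chart_inv B (chart_map B P) = P" by (rule chart_inv_chart_map[OF B(1) PB])
    have nz: "snd (transition B C (chart_map B P, 1)) \<noteq> 0" using dx unfolding dx_def M_def x_def .
    have ch: "change_chart B C P v = (fst (M (v, 0)) - snd (M (v, 0)) *\<^sub>R x') /\<^sub>R dx"
      using fun_cong[OF frechet_derivative_at[OF chart_change_has_derivative[OF BC nz]], of v, symmetric]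
      unfolding change_chart_def Pi dx_def M_def x_def x'_def .
    have "(v, 0::real) = (u, 0) + \<kappa> *\<^sub>R ((x, 1) - (z, 1))" by (simp add: vu)
    then have "M (v, 0) = M (u, 0) + \<kappa> *\<^sub>R (M (x, 1) - M (z, 1))"
      by (simp only: linear_add[OF lin] linear_cmul[OF lin] linear_diff[OF lin])
    then have Mv: "M (v, 0) = (dx *\<^sub>R u' + \<delta> *\<^sub>R z' + \<kappa> *\<^sub>R (dx *\<^sub>R x' - dz *\<^sub>R z'), \<delta> + \<kappa> * (dx - dz))"
      unfolding Mu Mx Mz by simp
    \<comment> \<open>All terms other than u' collect into a multiple of z' - x', the direction that
      the projection removes.\<close>
    have "fst (M (v, 0)) - snd (M (v, 0)) *\<^sub>R x' = dx *\<^sub>R u' + (\<delta> - \<kappa> * dz) *\<^sub>R (z' - x')"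
      unfolding Mv by (simp add: algebra_simps)
    then have "change_chart B C P v = u' + ((\<delta> - \<kappa> * dz) / dx) *\<^sub>R (z' - x')"
      unfolding ch using dx by (simp add: scaleR_add_right divide_inverse mult.commute)
    then show "change_chart B C P v - u' = ((\<delta> - \<kappa> * dz) / dx) *\<^sub>R (chart_map C X - chart_map C P)"
      unfolding z'_def x'_def by simp
  qed
  then show ?thesis
    using parallel_exponents_eq[OF pt] unfolding D_def z_def x_def by simp
qed

end
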